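(* Let $F$ be an algebraically closed field, $\ell>1$ an integer, and $q=\xi\in F$ a primitive $2\ell$-th root of unity. Let $M$ be a simple module in $\mathrm{Rep}_I\mathscr{H}_n$ and let $i\in I=\mathbb{Z}/2\ell\mathbb{Z}$. If $e_{\widehat i}M\ne0$, then $\mathrm{soc}\,e_{\widehat i}M$ is simple. Furthermore, $\mathrm{soc}\,e_{\widehat i}M\cong\widetilde e_i\widetilde e_{i+\ell}M$ and $\varepsilon_{\widehat i}(\mathrm{soc}\,e_{\widehat i}M)=\varepsilon_{\widehat i}(M)-1$.
   Context: Affine Hecke algebra. For $n\ge 1$, $\mathscr{H}_n$ is the unital associative $F$-algebra with generators $T_1,\dots,T_{n-1},X_1^{\pm1},\dots,X_n^{\pm1}$ and relations $(T_i-q)(T_i+1)=0$; $T_iT_{i+1}T_i=T_{i+1}T_iT_{i+1}$; $T_iT_k=T_kT_i$ for $|i-k|>1$; the $X_j^{\pm1}$ commute and $X_kX_k^{-1}=X_k^{-1}X_k=1$; $T_iX_k=X_kT_i$ for $k\ne i,i+1$; $X_{i+1}=q^{-1}T_iX_iT_i$. $\mathscr{H}_0=F$; $\mathscr{H}_{n-1}\subset\mathscr{H}_n$ is generated by $T_1,\dots,T_{n-2},X_1^{\pm1},\dots,X_{n-1}^{\pm1}$. All modules are finite dimensional. For $i\in I$ we write $i+\ell$ for $i+\ell+2\ell\mathbb{Z}\in I$. $\mathrm{Rep}_I\mathscr{H}_n$ is the category of finite dimensional $\mathscr{H}_n$-modules on which all eigenvalues of $X_1,\dots,X_n$ lie in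 $\{q^i: i\in I\}$. $\mathrm{soc}$ denotes the socle. For $i\in I$ and $M\in\mathrm{Rep}_I\mathscr{H}_n$, $e_iM$ is the generalized $q^i$-eigenspace of $X_n$ on $M$, viewed as an $\mathscr{H}_{n-1}$-module ($e_iM=0$ if $n=0$). For simple $M$, $\widetilde e_iM=\mathrm{soc}\,e_iM$ (zero or simple), $\widetilde e_i0=0$. $\widehat i=(i,i+\ell)$, $e_{\widehat i}=e_ie_{i+\ell}:\mathrm{Rep}_I\mathscr{H}_n\to\mathrm{Rep}_I\mathscr{H}_{n-2}$ for $n\ge2$ (and $e_{\widehat i}=0$ for $n<2$). For simple $M$, $\varepsilon_{\widehat i}(M)=\max\{m\ge0:e_{\widehat i}^mM\ne0\}$. *)

theory Defs
  imports
    "HOL-Algebra.QuotRing"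
    "HOL-Algebra.Module"
    "HOL-Computational_Algebra.Polynomial"
    "HOL-Library.Poly_Mapping"
begin

section \<open>Left modules over a ring\<close>

text \<open>
  The locale \<^locale>\<open>module\<close> demands a commutative ring, but its own axioms are
  those of a unital left module and make sense over every ring.
\<close>

definition left_module :: "('a, 'r) ring_scheme \<Rightarrow> ('a, 'v, 'm) module_scheme \<Rightarrow> bool" where
  "left_module R M \<longleftrightarrow> ring R \<and> abelian_group M \<and> module_axioms R M"

definition nonzero_module :: "('a, 'v, 'm) module_scheme \<Rightarrow> bool" where
  "nonzero_module M \<longleftrightarrow> carrier M \<noteq> {\<zero>\<^bsub>M\<^esub>}"

definition simple_module :: "('a, 'r) ring_scheme \<Rightarrow> ('a, 'v, 'm) module_scheme \<Rightarrow> bool" where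
  "simple_module R M \<longleftrightarrow> left_module R M \<and> nonzero_module M \<and>
     (\<forall>N. submodule N R M \<longrightarrow> N = {\<zero>\<^bsub>M\<^esub>} \<or> N = carrier M)"

text \<open>The socle: the sum of all simple submodules, i.e. the least submodule containing them.\<close>

definition socle :: "('a, 'r) ring_scheme \<Rightarrow> ('a, 'v, 'm) module_scheme \<Rightarrow> ('a, 'v, 'm) module_scheme" where
  "socle R M = M\<lparr>carrier := \<Inter>{N. submodule N R M \<and>
     (\<forall>S. submodule S R M \<and> simple_module R (M\<lparr>carrier := S\<rparr>) \<longrightarrow> S \<subseteq> N)}\<rparr>"

definition module_iso ::
  "('a, 'r) ring_scheme \<Rightarrow> ('a, 'v, 'm) module_scheme \<Rightarrow> ('a, 'w, 'n) module_scheme \<Rightarrow> bool" where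
  "module_iso R M N \<longleftrightarrow> (\<exists>f. bij_betw f (carrier M) (carrier N) \<and>
     (\<forall>x\<in>carrier M. \<forall>y\<in>carrier M. f (x \<oplus>\<^bsub>M\<^esub> y) = f x \<oplus>\<^bsub>N\<^esub> f y) \<and>
     (\<forall>a\<in>carrier R. \<forall>x\<in>carrier M. f (a \<odot>\<^bsub>M\<^esub> x) = a \<odot>\<^bsub>N\<^esub> f x))"


section \<open>The affine Hecke algebra\<close>

text \<open>
  Words in the generators form a monoid under concatenation; it is written additively
  because the product of \<^type>\<open>poly_mapping\<close> is convolution over an additive monoid.
  Thus \<open>'f free_alg\<close> is the free associative unital algebra over \<open>'f\<close> on
  \<^emph>\<open>all\<close> the symbols of type \<open>gen\<close>.
\<close>

datatype gen = GT nat | GX nat | GXinv nat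

datatype word = Word (letters: "gen list")

instantiation word :: monoid_add
begin
definition zero_word :: word where "zero_word = Word []"
definition plus_word :: "word \<Rightarrow> word \<Rightarrow> word" where
  "plus_word u v = Word (letters u @ letters v)"
instance by standard (auto simp: zero_word_def plus_word_def)
end

type_synonym 'f free_alg = "word \<Rightarrow>\<^sub>0 'f"

definition scalar :: "'f::field \<Rightarrow> 'f free_alg" where
  "scalar c = Poly_Mapping.single 0 c"

definition var :: "gen \<Rightarrow> 'f::field free_alg" where
  "var g = Poly_Mapping.single (Word [g]) 1"

abbreviation (input) tT :: "nat \<Rightarrow> 'f::field free_alg" where "tT i \<equiv> var (GT i)"
abbreviation (input) tX :: "nat \<Rightarrow> 'f::field free_alg" where "tX i \<equiv> var (GX i)"
abbreviation (input) tXinv :: "nat \<Rightarrow> 'f::field free_alg" where "tXinv i \<equiv> var (GXinv i)"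

definition gens :: "nat \<Rightarrow> gen set" where
  "gens n = GT ` {1..<n} \<union> GX ` {1..n} \<union> GXinv ` {1..n}"

definition free_ring :: "nat \<Rightarrow> ('f::field free_alg) ring" where
  "free_ring n = \<lparr>carrier = {p. \<forall>w\<in>Poly_Mapping.keys p. set (letters w) \<subseteq> gens n},
     monoid.mult = (*), one = 1, ring.zero = 0, add = (+)\<rparr>"

text \<open>
  A relation \<open>a = b\<close> is represented by the element \<open>a - b\<close>.  For \<open>n = 0\<close> there are no
  generators and no relations, so the quotient below is the ground field.
\<close>

definition hecke_rels :: "nat \<Rightarrow> 'f::field \<Rightarrow> 'f free_alg set" where
  "hecke_rels n q =
     {(tT i - scalar q) * (tT i + 1) | i. i \<in> {1..<n}}
   \<union> {tT i * tT (i+1) * tT i - tT (i+1) * tT i * tT (i+1) | i. i \<in> {1..<n} \<and> i + 1 \<in> {1..<n}}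
   \<union> {tT i * tT k - tT k * tT i | i k. i \<in> {1..<n} \<and> k \<in> {1..<n} \<and> \<bar>int i - int k\<bar> > 1}
   \<union> {x * y - y * x | x y. x \<in> tX ` {1..n} \<union> tXinv ` {1..n} \<and> y \<in> tX ` {1..n} \<union> tXinv ` {1..n}}
   \<union> {tX k * tXinv k - 1 | k. k \<in> {1..n}}
   \<union> {tXinv k * tX k - 1 | k. k \<in> {1..n}}
   \<union> {tT i * tX k - tX k * tT i | i k. i \<in> {1..<n} \<and> k \<in> {1..n} \<and> k \<noteq> i \<and> k \<noteq> i + 1}
   \<union> {tX (i+1) - scalar (inverse q) * tT i * tX i * tT i | i. i \<in> {1..<n}}"

definition hecke_ideal :: "nat \<Rightarrow> 'f::field \<Rightarrow> 'f free_alg set" where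
  "hecke_ideal n q = genideal (free_ring n) (hecke_rels n q)"

definition hecke :: "nat \<Rightarrow> 'f::field \<Rightarrow> ('f free_alg set) ring" where
  "hecke n q = free_ring n Quot hecke_ideal n q"

definition hecke_class :: "nat \<Rightarrow> 'f::field \<Rightarrow> 'f free_alg \<Rightarrow> 'f free_alg set" where
  "hecke_class n q p = hecke_ideal n q +>\<^bsub>free_ring n\<^esub> p"

text \<open>
  The canonical homomorphism from the algebra of a rank \<open>m \<le> n\<close> to that of rank \<open>n\<close>,
  sending generators to generators (see \<open>hecke_incl_class\<close>).  An element of the former is a
  set of mutually congruent representatives, which all have the same class in rank \<open>n\<close>.
\<close>

definition hecke_incl :: "nat \<Rightarrow> 'f::field \<Rightarrow> 'f free_alg set \<Rightarrow> 'f free_alg set" where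
  "hecke_incl n q a = (\<Union>p\<in>a. hecke_class n q p)"

lemma free_ring_ops:
  "p \<otimes>\<^bsub>free_ring n\<^esub> r = p * r" "p \<oplus>\<^bsub>free_ring n\<^esub> r = p + r"
  "\<one>\<^bsub>free_ring n\<^esub> = 1" "\<zero>\<^bsub>free_ring n\<^esub> = 0"
  by (simp_all add: free_ring_def)

lemma ring_free_ring: "ring (free_ring n :: ('f::field free_alg) ring)"
proof -
  have mult: "p * r \<in> carrier (free_ring n)"
    if "p \<in> carrier (free_ring n)" "r \<in> carrier (free_ring n)" for p r :: "'f free_alg"
    using that keys_mult[of p r] unfolding free_ring_def by (fastforce simp: plus_word_def)
  have add: "p + r \<in> carrier (free_ring n)"
    if "p \<in> carrier (free_ring n)" "r \<in> carrier (free_ring n)" for p r :: "'f free_alg"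
    using that Poly_Mapping.keys_add[of p r] unfolding free_ring_def by fastforce
  have neg: "- p \<in> carrier (free_ring n)"
    if "p \<in> carrier (free_ring n)" for p :: "'f free_alg"
    using that unfolding free_ring_def by simp
  have one: "(1 :: 'f free_alg) \<in> carrier (free_ring n)"
    unfolding free_ring_def by (auto simp: zero_word_def)
  have zero: "(0 :: 'f free_alg) \<in> carrier (free_ring n)"
    unfolding free_ring_def by simp
  show ?thesis
  proof (rule ringI)
    show "abelian_group (free_ring n :: ('f free_alg) ring)"
    proof (rule abelian_groupI; (unfold free_ring_ops)?)
      fix p :: "'f free_alg" assume "p \<in> carrier (free_ring n)"
      then show "\<exists>r\<in>carrier (free_ring n). r + p = 0"
        by (intro bexI[of _ "- p"] neg) simp_all
    qed (simp_all add: add zero add.assoc add.commute)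
    show "monoid (free_ring n :: ('f free_alg) ring)"
      by (rule monoidI; (unfold free_ring_ops)?) (simp_all add: mult one mult.assoc)
  qed (simp_all add: free_ring_ops distrib_left distrib_right)
qed

lemma var_in_carrier: "g \<in> gens n \<Longrightarrow> var g \<in> carrier (free_ring n)"
  by (simp add: var_def free_ring_def)

lemma scalar_in_carrier: "scalar c \<in> carrier (free_ring n)"
  by (simp add: scalar_def free_ring_def zero_word_def)

lemma free_ring_one: "(1 :: 'f::field free_alg) \<in> carrier (free_ring n)"
  by (simp add: free_ring_def zero_word_def)

lemma free_ring_closed:
  fixes p r :: "'f::field free_alg"
  assumes "p \<in> carrier (free_ring n)" "r \<in> carrier (free_ring n)"
  shows "p * r \<in> carrier (free_ring n)" "p + r \<in> carrier (free_ring n)"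
    "p - r \<in> carrier (free_ring n)"
proof -
  interpret ring "free_ring n :: ('f::field free_alg) ring" by (rule ring_free_ring)
  show "p * r \<in> carrier (free_ring n)" "p + r \<in> carrier (free_ring n)"
    using m_closed[OF assms] a_closed[OF assms] by (simp_all add: free_ring_ops)
  have "- r \<in> carrier (free_ring n)" using assms(2) by (simp add: free_ring_def)
  from a_closed[OF assms(1) this] show "p - r \<in> carrier (free_ring n)"
    unfolding free_ring_ops by simp
qed

lemma hecke_rels_subset: "hecke_rels n q \<subseteq> carrier (free_ring n)"
proof -
  have 1: "var (GT i) \<in> carrier (free_ring n)" if "i \<in> {1..<n}" for i
    using that by (intro var_in_carrier) (auto simp: gens_def)
  have 2: "var (GX i) \<in> carrier (free_ring n)" "var (GXinv i) \<in> carrier (free_ring n)"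
    if "i \<in> {1..n}" for i
    using that by (auto intro!: var_in_carrier simp: gens_def)
  show ?thesis
    unfolding hecke_rels_def
    by (auto intro!: free_ring_closed free_ring_one scalar_in_carrier 1 2)
qed

lemma hecke_ideal_ideal: "ideal (hecke_ideal n q) (free_ring n)"
  unfolding hecke_ideal_def by (rule ring.genideal_ideal[OF ring_free_ring hecke_rels_subset])

lemma ring_hecke: "ring (hecke n q)"
  unfolding hecke_def by (rule ideal.quotient_is_ring[OF hecke_ideal_ideal])

lemma hecke_carrier: "carrier (hecke n q) = hecke_class n q ` carrier (free_ring n)"
  unfolding hecke_def FactRing_def A_RCOSETS_def RCOSETS_def hecke_class_def a_r_coset_def
    UNION_singleton_eq_range
  by simp

lemma free_ring_mono: "m \<le> n \<Longrightarrow> carrier (free_ring m) \<subseteq> carrier (free_ring n)"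
proof -
  assume "m \<le> n"
  then have "gens m \<subseteq> gens n" by (auto simp: gens_def)
  then show ?thesis unfolding free_ring_def by (simp add: subset_iff)
qed

lemma hecke_rels_mono:
  assumes "m \<le> n"
  shows "hecke_rels m q \<subseteq> hecke_rels n q"
proof -
  have one: "{f i | i. P i} \<subseteq> {f i | i. Q i}" if "\<And>i. P i \<Longrightarrow> Q i"
    for f :: "nat \<Rightarrow> 'a free_alg" and P Q using that by blast
  have two: "{f i k | i k. P i k} \<subseteq> {f i k | i k. Q i k}" if "\<And>i k. P i k \<Longrightarrow> Q i k"
    for f :: "'b \<Rightarrow> 'b \<Rightarrow> 'a free_alg" and P Q using that by blast
  show ?thesis
    unfolding hecke_rels_def
    by (intro Un_mono one two) (use assms in auto)
qed

lemma hecke_ideal_mono: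
  fixes q :: "'f::field"
  assumes "m \<le> n"
  shows "hecke_ideal m q \<subseteq> hecke_ideal n q"
proof -
  interpret R: ring "free_ring m :: ('f free_alg) ring" by (rule ring_free_ring)
  interpret I: ideal "hecke_ideal n q" "free_ring n" by (rule hecke_ideal_ideal)
  have gen: "hecke_rels n q \<subseteq> hecke_ideal n q"
    unfolding hecke_ideal_def by (rule ring.genideal_self[OF ring_free_ring hecke_rels_subset])
  have mono: "carrier (free_ring m :: ('f free_alg) ring) \<subseteq> carrier (free_ring n)" by (rule free_ring_mono[OF assms])
  let ?J = "hecke_ideal n q \<inter> carrier (free_ring m)"
  have "ideal ?J (free_ring m)"
  proof (rule idealI)
    show "ring (free_ring m)" by (rule ring_free_ring)
    show "subgroup ?J (add_monoid (free_ring m))"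
    proof (rule group.subgroupI)
      show "Group.group (add_monoid (free_ring m :: ('f free_alg) ring))" using R.a_group by simp
      have "\<zero>\<^bsub>free_ring m\<^esub> = (\<zero>\<^bsub>free_ring n\<^esub> :: 'f free_alg)" by (simp add: free_ring_def)
      moreover have "\<zero>\<^bsub>free_ring n\<^esub> \<in> hecke_ideal n q"
        by (rule additive_subgroup.zero_closed[OF I.is_additive_subgroup])
      ultimately have "\<zero>\<^bsub>free_ring m\<^esub> \<in> ?J" using R.zero_closed by simp
      then show "?J \<noteq> {}" by blast
      fix a assume a: "a \<in> ?J"
      have na: "- a \<in> carrier (free_ring k)" if "a \<in> carrier (free_ring k)" for k
        using that by (simp add: free_ring_def)
      have inv: "inv\<^bsub>add_monoid (free_ring k)\<^esub> a = - a" if "a \<in> carrier (free_ring k)" for k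
      proof -
        interpret K: ring "free_ring k :: ('f free_alg) ring" by (rule ring_free_ring)
        show ?thesis
          using K.minus_equality[of "- a" a] that na[OF that]
          by (simp add: a_inv_def free_ring_def)
      qed
      have "\<ominus>\<^bsub>free_ring n\<^esub> a \<in> hecke_ideal n q" using a by (auto intro: additive_subgroup.a_inv_closed[OF I.is_additive_subgroup])
      then show "inv\<^bsub>add_monoid (free_ring m)\<^esub> a \<in> ?J"
        using a mono inv[of m] inv[of n] na[of m] by (auto simp: a_inv_def)
      fix b assume b: "b \<in> ?J"
      have "a \<oplus>\<^bsub>free_ring n\<^esub> b \<in> hecke_ideal n q" using a b by (auto intro: additive_subgroup.a_closed[OF I.is_additive_subgroup])
      moreover have "a \<oplus>\<^bsub>free_ring m\<^esub> b \<in> carrier (free_ring m)" using a b by auto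
      ultimately show "a \<otimes>\<^bsub>add_monoid (free_ring m)\<^esub> b \<in> ?J" by (simp add: free_ring_def)
    qed simp
  next
    fix a x :: "'f free_alg"
    assume ax: "a \<in> ?J" "x \<in> carrier (free_ring m)"
    then have "x \<otimes>\<^bsub>free_ring n\<^esub> a \<in> hecke_ideal n q" "a \<otimes>\<^bsub>free_ring n\<^esub> x \<in> hecke_ideal n q"
      using mono by (auto intro: I.I_l_closed I.I_r_closed)
    moreover have "x \<otimes>\<^bsub>free_ring m\<^esub> a \<in> carrier (free_ring m)" "a \<otimes>\<^bsub>free_ring m\<^esub> x \<in> carrier (free_ring m)"
      using ax by auto
    ultimately show "x \<otimes>\<^bsub>free_ring m\<^esub> a \<in> ?J" "a \<otimes>\<^bsub>free_ring m\<^esub> x \<in> ?J"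
      by (simp_all add: free_ring_def)
  qed
  moreover have "hecke_rels m q \<subseteq> ?J"
    using gen hecke_rels_mono[OF assms, of q] hecke_rels_subset by blast
  ultimately show ?thesis
    unfolding hecke_ideal_def[of m] by (meson R.genideal_minimal Int_lower1 order_trans)
qed

lemma hecke_incl_class:
  assumes "m \<le> n" "p \<in> carrier (free_ring m)"
  shows "hecke_incl n q (hecke_class m q p) = hecke_class n q p"
proof -
  interpret I: ideal "hecke_ideal n q" "free_ring n" by (rule hecke_ideal_ideal)
  interpret J: ideal "hecke_ideal m q" "free_ring m" by (rule hecke_ideal_ideal)
  have p: "p \<in> carrier (free_ring n)" using assms free_ring_mono by blast
  have "hecke_class n q r = hecke_class n q p" if r: "r \<in> hecke_class m q p" for r
  proof -
    have "r \<in> hecke_ideal n q +>\<^bsub>free_ring n\<^esub> p"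
      using r hecke_ideal_mono[OF assms(1), of q]
      by (auto simp: hecke_class_def a_r_coset_def r_coset_def free_ring_def)
    then show ?thesis
      unfolding hecke_class_def by (rule I.a_repr_independence[OF _ p I.a_subgroup, symmetric])
  qed
  moreover have "p \<in> hecke_class m q p"
    unfolding hecke_class_def by (rule J.a_rcos_self[OF assms(2)])
  ultimately show ?thesis unfolding hecke_incl_def by blast
qed


section \<open>Modules over the affine Hecke algebra\<close>

type_synonym ('f, 'v) hecke_mod = "('f free_alg set, 'v) module"

text \<open>The ground field acts on a module through the unit of the algebra.\<close>

definition finite_dim :: "nat \<Rightarrow> 'f::field \<Rightarrow> ('f, 'v) hecke_mod \<Rightarrow> bool" where
  "finite_dim n q M \<longleftrightarrow> (\<exists>B. finite B \<and> B \<subseteq> carrier M \<and>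
     (\<forall>v\<in>carrier M. \<exists>c. v = (\<Oplus>\<^bsub>M\<^esub>b\<in>B. hecke_class n q (scalar (c b)) \<odot>\<^bsub>M\<^esub> b)))"

definition X_eigenvalue :: "nat \<Rightarrow> 'f::field \<Rightarrow> nat \<Rightarrow> ('f, 'v) hecke_mod \<Rightarrow> 'f \<Rightarrow> bool" where
  "X_eigenvalue n q k M c \<longleftrightarrow> (\<exists>v\<in>carrier M. v \<noteq> \<zero>\<^bsub>M\<^esub> \<and>
     hecke_class n q (tX k) \<odot>\<^bsub>M\<^esub> v = hecke_class n q (scalar c) \<odot>\<^bsub>M\<^esub> v)"

definition primitive_root_of_unity :: "nat \<Rightarrow> 'f::field \<Rightarrow> bool" where
  "primitive_root_of_unity r q \<longleftrightarrow> r > 0 \<and> q ^ r = 1 \<and> (\<forall>m. 0 < m \<and> m < r \<longrightarrow> q ^ m \<noteq> 1)"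

text \<open>
  When \<open>q\<close> is a primitive \<open>2 l\<close>-th root of unity, \<open>q powi i\<close> depends only on the class of the
  integer \<open>i\<close> modulo \<open>2 l\<close>, so an element of the index set \<open>I\<close> of integers modulo \<open>2 l\<close> is
  given by any integer representative.
\<close>

definition Rep_I :: "nat \<Rightarrow> 'f::field \<Rightarrow> ('f, 'v) hecke_mod set" where
  "Rep_I n q = {M. left_module (hecke n q) M \<and> finite_dim n q M \<and>
     (\<forall>k\<in>{1..n}. \<forall>c. X_eigenvalue n q k M c \<longrightarrow> c \<in> range (\<lambda>i::int. q powi i))}"

text \<open>
  The generalized \<open>q powi i\<close>-eigenspace of \<open>X\<^sub>n\<close> on a module of rank \<open>n\<close>, as a module of
  rank \<open>n - 1\<close>.
\<close>

definition e_res :: "nat \<Rightarrow> 'f::field \<Rightarrow> int \<Rightarrow> ('f, 'v) hecke_mod \<Rightarrow> ('f, 'v) hecke_mod" where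
  "e_res n q i M =
     (if n = 0 then M\<lparr>carrier := {\<zero>\<^bsub>M\<^esub>}\<rparr>
      else M\<lparr>carrier := {v\<in>carrier M. \<exists>m.
                 ((\<lambda>w. hecke_class n q (tX n - scalar (q powi i)) \<odot>\<^bsub>M\<^esub> w) ^^ m) v = \<zero>\<^bsub>M\<^esub>},
             smult := (\<lambda>a v. hecke_incl n q a \<odot>\<^bsub>M\<^esub> v)\<rparr>)"

text \<open>Used for simple \<open>M\<close> and for \<open>M = 0\<close>; the socle of the zero module is zero.\<close>

definition e_tilde :: "nat \<Rightarrow> 'f::field \<Rightarrow> int \<Rightarrow> ('f, 'v) hecke_mod \<Rightarrow> ('f, 'v) hecke_mod" where
  "e_tilde n q i M = socle (hecke (n - 1) q) (e_res n q i M)"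

text \<open>
  The composite is automatically zero for \<open>n < 2\<close>, since \<open>e_res 0\<close> is.
\<close>

definition e_hat :: "nat \<Rightarrow> nat \<Rightarrow> 'f::field \<Rightarrow> int \<Rightarrow> ('f, 'v) hecke_mod \<Rightarrow> ('f, 'v) hecke_mod" where
  "e_hat l n q i M = e_res (n - 1) q i (e_res n q (i + int l) M)"

fun e_hat_pow ::
  "nat \<Rightarrow> nat \<Rightarrow> nat \<Rightarrow> 'f::field \<Rightarrow> int \<Rightarrow> ('f, 'v) hecke_mod \<Rightarrow> ('f, 'v) hecke_mod" where
  "e_hat_pow 0 l n q i M = M"
| "e_hat_pow (Suc m) l n q i M = e_hat_pow m l (n - 2) q i (e_hat l n q i M)"

text \<open>
  For simple \<open>M\<close> the set is finite, as it is contained in \<open>{..n div 2}\<close>, and contains \<open>0\<close>.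
\<close>

definition eps_hat :: "nat \<Rightarrow> nat \<Rightarrow> 'f::field \<Rightarrow> int \<Rightarrow> ('f, 'v) hecke_mod \<Rightarrow> nat" where
  "eps_hat l n q i M = Max {m. nonzero_module (e_hat_pow m l n q i M)}"

end

theory Submission
  imports Defs "HOL-Library.Function_Algebras"
begin

text \<open>
  A finite-dimensional module is treated as a subspace of one fixed vector space with operators
  \<open>T\<^sub>i\<close> and \<open>X\<^sub>i\<close>, so that restriction, generalised eigenspaces and socles are all subsets of it.
  If \<open>N\<close> is stable under the algebra of rank \<open>k - 1\<close> and under \<open>X\<^sub>k\<close>, it generates the sum of the
  \<open>T\<^sub>j \<cdots> T\<^sub>k\<^sub>-\<^sub>1 N\<close>, a flag on which the \<open>X\<^sub>i\<close> act triangularly by shuffled weights.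

  Let \<open>M\<close> be simple of rank \<open>k\<close> and \<open>m\<close> maximal such that the last \<open>m\<close> of the \<open>X\<^sub>i\<close> have a common generalised
  eigenvector of eigenvalue \<open>a\<close>. The shuffle argument, the centrality of the sum of the last
  \<open>m\<close> of the \<open>X\<^sub>i\<close> and the freeness of the Kato module show that every nonzero submodule of \<open>e\<^sub>a M\<close> contains
  all common eigenvectors of this kind, hence that \<open>e\<^sub>a M\<close> has a simple socle.
  For \<open>b = - a\<close> the weights \<open>a\<close> and \<open>b\<close> are exchanged by invertible intertwiners. Moving \<open>a\<close> past all \<open>b\<close>'s shows
  that a submodule of \<open>e\<^sub>a e\<^sub>b M\<close> meets the socle of \<open>e\<^sub>b M\<close>, so the socle of \<open>e\<^sub>a e\<^sub>b M\<close> is that of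
  \<open>e\<^sub>a (soc e\<^sub>b M)\<close>; it also shows that \<open>(e\<^sub>a e\<^sub>b)\<^sup>m M\<close> is nonzero iff \<open>M\<close> has tails of \<open>m\<close> weights \<open>a\<close> and of \<open>m\<close>
  weights \<open>b\<close>, and passing to the socle shortens both by one.
\<close>

section \<open>Operators satisfying the Hecke relations\<close>

text \<open>No induced module or tensor product is formed: induction is replaced by the span
  \<open>Z k 1 N\<close> inside the given space. A submodule \<open>N\<close> of the
  \<open>a\<close>-eigenspace of \<open>M\<close> generates \<open>M\<close>, so its longest tail is
  at most one shorter than that of \<open>M\<close>. This yields common eigenvectors
  \<open>D\<close> in \<open>N\<close> on which \<open>X k\<close> is so far only generalised, and
  the central sum turns this into an eigenvalue. Then \<open>M\<close> is also generated from
  \<open>D\<close>, which puts all common eigenvectors \<open>E\<close> of \<open>M\<close> into the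
  Kato module over \<open>D\<close>. Freeness over \<open>E\<close> says that this Kato module meets
  \<open>E\<close> in \<open>D\<close> alone, whence \<open>E = D\<close>. The relation
  \<open>b = - a\<close> comes from \<open>q ^ l = - 1\<close>. The square of an intertwiner
  vanishes only where one weight is \<open>q\<close> times the other, which for \<open>a\<close> and
  \<open>- a\<close> would mean \<open>q = - 1\<close>; this is excluded by \<open>l > 1\<close>,
  and \<open>a = - a\<close> by \<open>- 1 \<noteq> 1\<close>. The operators include no inverses of
  the \<open>X i\<close>: on an invariant subspace of a finite-dimensional space an injective
  \<open>X i\<close> is onto.\<close>

locale affine_hecke_rep = vector_space scale
  for scale :: "'f::field \<Rightarrow> 'b::ab_group_add \<Rightarrow> 'b" (infixr \<open>*s\<close> 75) +
  fixes n :: nat and q :: 'f and T X :: "nat \<Rightarrow> 'b \<Rightarrow> 'b"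
  assumes linear_T: "Vector_Spaces.linear scale scale (T i)"
    and linear_X: "Vector_Spaces.linear scale scale (X i)"
    and q_nz: "q \<noteq> 0"
    and T_quad: "1 \<le> i \<Longrightarrow> i < n \<Longrightarrow> T i (T i v) = (q - 1) *s T i v + q *s v"
    and T_braid: "1 \<le> i \<Longrightarrow> Suc i < n \<Longrightarrow> T i (T (Suc i) (T i v)) = T (Suc i) (T i (T (Suc i) v))"
    and T_comm: "Suc i < k \<Longrightarrow> T i (T k v) = T k (T i v)"
    and X_comm: "X i (X j v) = X j (X i v)"
    and TX_comm: "k \<noteq> i \<Longrightarrow> k \<noteq> Suc i \<Longrightarrow> T i (X k v) = X k (T i v)"
    and TXT: "1 \<le> i \<Longrightarrow> i < n \<Longrightarrow> T i (X i (T i v)) = q *s X (Suc i) v"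
begin

abbreviation lin :: "('b \<Rightarrow> 'b) \<Rightarrow> bool" where "lin \<equiv> Vector_Spaces.linear scale scale"

lemma lin_iff: "lin f \<longleftrightarrow> (\<forall>u v. f (u + v) = f u + f v) \<and> (\<forall>c v. f (c *s v) = c *s f v)"
  using vector_space_axioms by (simp add: Vector_Spaces.linear_iff)

lemma lin_add: "lin f \<Longrightarrow> f (u + v) = f u + f v"
  and lin_scale: "lin f \<Longrightarrow> f (c *s v) = c *s f v"
  by (auto simp: lin_iff)

lemma lin_zero: "lin f \<Longrightarrow> f 0 = 0"
  using lin_scale[of f 0 0] by simp

lemma lin_diff: "lin f \<Longrightarrow> f (u - v) = f u - f v"
  using lin_add[of f "u - v" v] by (simp add: algebra_simps)

lemma lin_id: "lin (\<lambda>v. v)"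
  by (simp add: lin_iff)

lemma lin_funpow: "lin f \<Longrightarrow> lin (f ^^ e)"
  by (induction e) (auto simp: lin_iff)

lemma lin_funpow_zero: "lin f \<Longrightarrow> (f ^^ e) 0 = 0"
  by (rule lin_zero[OF lin_funpow])

lemmas T_simps [simp] = lin_add[OF linear_T] lin_scale[OF linear_T] lin_zero[OF linear_T]
  lin_diff[OF linear_T]
lemmas X_simps [simp] = lin_add[OF linear_X] lin_scale[OF linear_X] lin_zero[OF linear_X]
  lin_diff[OF linear_X]

text \<open>This and \<open>X_T\<close> are the two Bernstein relations. Each comes from evaluating
  \<open>TXT\<close> next to a second \<open>T i\<close>, expanding the square by the quadratic
  relation and cancelling \<open>q\<close>.\<close>

lemma X_Suc_T:
  assumes "1 \<le> i" "i < n"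
  shows "X (Suc i) (T i v) = T i (X i v) + (q - 1) *s X (Suc i) v"
proof -
  have "q *s X (Suc i) (T i v) = T i (X i (T i (T i v)))"
    using assms by (simp add: TXT)
  also have "\<dots> = (q - 1) *s T i (X i (T i v)) + q *s T i (X i v)"
    using assms by (simp add: T_quad)
  also have "\<dots> = q *s (T i (X i v) + (q - 1) *s X (Suc i) v)"
    using assms by (simp add: TXT scale_right_distrib mult.commute)
  finally show ?thesis using q_nz by (simp only: scale_cancel_left) auto
qed

lemma X_T:
  assumes "1 \<le> i" "i < n"
  shows "X i (T i v) = T i (X (Suc i) v) - (q - 1) *s X (Suc i) v"
proof -
  have "q *s T i (X (Suc i) v) = T i (T i (X i (T i v)))"
    using assms by (simp add: TXT)
  also have "\<dots> = q *s (X i (T i v) + (q - 1) *s X (Suc i) v)"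
    using assms by (simp only: T_quad) (simp add: TXT scale_right_distrib mult.commute add.commute)
  finally show ?thesis using q_nz by (simp only: scale_cancel_left) (auto simp: algebra_simps)
qed

subsection \<open>Generalised eigenvectors\<close>

definition Xm :: "nat \<Rightarrow> 'f \<Rightarrow> 'b \<Rightarrow> 'b" where
  "Xm i c v = X i v - c *s v"

definition nil :: "'f \<Rightarrow> nat \<Rightarrow> 'b \<Rightarrow> bool" where
  "nil c i v \<longleftrightarrow> (\<exists>e. (Xm i c ^^ e) v = 0)"

lemma linear_Xm: "lin (Xm i c)"
  by (simp add: lin_iff Xm_def scale_right_distrib scale_right_diff_distrib scale_left_commute
      add_diff_add)

lemmas Xm_simps [simp] = lin_add[OF linear_Xm] lin_scale[OF linear_Xm] lin_zero[OF linear_Xm]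
  lin_diff[OF linear_Xm]

lemma Xm_Xm_comm: "Xm i c (Xm j d v) = Xm j d (Xm i c v)"
  by (simp add: Xm_def X_comm[of i j] scale_right_diff_distrib scale_left_commute algebra_simps)

lemma X_Xm_comm: "X i (Xm j d v) = Xm j d (X i v)"
  by (simp add: Xm_def X_comm[of i j])

lemma nil_zero [simp]: "nil c i 0"
  unfolding nil_def by (rule exI[of _ 0]) simp

lemma funpow_zero_mono: "lin f \<Longrightarrow> (f ^^ e) v = 0 \<Longrightarrow> e \<le> e' \<Longrightarrow> (f ^^ e') v = 0"
  using lin_funpow_zero[of f "e' - e"] funpow_add[of "e' - e" e f] by simp

lemma nil_add: assumes "nil c i u" "nil c i v" shows "nil c i (u + v)"
proof -
  obtain e d where "(Xm i c ^^ e) u = 0" "(Xm i c ^^ d) v = 0"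
    using assms by (auto simp: nil_def)
  then have "(Xm i c ^^ max e d) u = 0" "(Xm i c ^^ max e d) v = 0"
    using funpow_zero_mono[OF linear_Xm] by auto
  then show ?thesis
    unfolding nil_def by (intro exI[of _ "max e d"]) (simp add: lin_add[OF lin_funpow[OF linear_Xm]])
qed

lemma nil_scale: "nil c i v \<Longrightarrow> nil c i (a *s v)"
  by (auto simp: nil_def lin_scale[OF lin_funpow[OF linear_Xm]])

lemma nil_diff: "nil c i u \<Longrightarrow> nil c i v \<Longrightarrow> nil c i (u - v)"
  using nil_add[of c i u "(-1) *s v"] nil_scale[of c i v "-1"] by simp

lemma nil_comm:
  assumes f: "lin f" "\<And>v. f (X i v) = X i (f v)" and v: "nil c i v"
  shows "nil c i (f v)"
proof -
  have "f (Xm i c w) = Xm i c (f w)" for w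
    by (simp add: Xm_def f(2) lin_diff[OF f(1)] lin_scale[OF f(1)])
  then have "(Xm i c ^^ e) (f v) = f ((Xm i c ^^ e) v)" for e
    by (induction e) auto
  then show ?thesis using v lin_zero[OF f(1)] by (metis nil_def)
qed

lemma nil_X: "nil c i v \<Longrightarrow> nil c i (X j v)"
  by (rule nil_comm[OF linear_X X_comm])

lemma nil_Xm: "nil c i v \<Longrightarrow> nil c i (Xm j d v)"
  by (rule nil_comm[OF linear_Xm]) (simp_all add: X_Xm_comm)

lemma nil_T: "i \<noteq> j \<Longrightarrow> i \<noteq> Suc j \<Longrightarrow> nil c i v \<Longrightarrow> nil c i (T j v)"
  by (rule nil_comm[OF linear_T]) (simp_all add: TX_comm)

lemma nil_Xm_iff [simp]: "nil c i (Xm i c v) \<longleftrightarrow> nil c i v"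
proof
  assume "nil c i (Xm i c v)"
  then obtain e where "(Xm i c ^^ e) (Xm i c v) = 0" by (auto simp: nil_def)
  then have "(Xm i c ^^ Suc e) v = 0" by (simp add: funpow_swap1)
  then show "nil c i v" unfolding nil_def by blast
qed (rule nil_Xm)

text \<open>Induction on the nilpotency exponent without naming it: passing from \<open>v\<close> to
  \<open>Xm i c v\<close> lowers it by one.\<close>

lemma nil_induct [consumes 1, case_names zero step]:
  assumes "nil c i v" "P 0" "\<And>v. nil c i v \<Longrightarrow> P (Xm i c v) \<Longrightarrow> P v"
  shows "P v"
proof -
  obtain e where "(Xm i c ^^ e) v = 0" using assms(1) by (auto simp: nil_def)
  then show ?thesis
  proof (induction e arbitrary: v)
    case 0
    then show ?case using assms(2) by simp
  next
    case (Suc e)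
    then have "(Xm i c ^^ e) (Xm i c v) = 0" by (simp add: funpow_swap1)
    then have "P (Xm i c v)" by (rule Suc.IH)
    moreover have "nil c i v" using Suc.prems unfolding nil_def by blast
    ultimately show ?case by (rule assms(3)[rotated])
  qed
qed

lemma eigen_nil: "X i v = c *s v \<Longrightarrow> nil c i v"
  unfolding nil_def by (rule exI[of _ 1]) (simp add: Xm_def)

text \<open>\<open>Xm i c\<close> and \<open>Xm i a\<close> differ by a nonzero scalar, so
  nilpotency of \<open>Xm i a\<close> makes \<open>Xm i c\<close> invertible on generalised
  \<open>a\<close>-eigenvectors, also modulo an invariant subspace. Later proofs use this to undo
  any factor whose eigenvalue is not \<open>a\<close>.\<close>

lemma Xm_cancel:
  assumes "nil a i v" "c \<noteq> a" "Xm i c v \<in> S" "subspace S" "\<And>u. u \<in> S \<Longrightarrow> X i u \<in> S"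
  shows "v \<in> S"
  using assms(1,3)
proof (induction rule: nil_induct)
  case zero
  show ?case using assms(4) by (rule subspace_0)
next
  case (step v)
  have "Xm i c (Xm i a v) \<in> S"
    unfolding Xm_Xm_comm[of i c] unfolding Xm_def[of i a]
    using step.prems assms(4,5) by (intro subspace_diff subspace_scale)
  then have "Xm i a v \<in> S" by (rule step.IH)
  then have "Xm i c v - Xm i a v \<in> S" using step.prems assms(4) by (intro subspace_diff)
  moreover have "Xm i c v - Xm i a v = (a - c) *s v"
    by (simp add: Xm_def scale_left_diff_distrib)
  ultimately have "inverse (a - c) *s ((a - c) *s v) \<in> S"
    using assms(4) by (metis subspace_scale)
  then show ?case using assms(2) by simp
qed

lemma subspace_zero_set: "subspace {0}"
  by (auto simp: subspace_def)

lemma nil_unique: "nil a i v \<Longrightarrow> nil c i v \<Longrightarrow> a \<noteq> c \<Longrightarrow> v = 0"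
proof (induction rule: nil_induct)
  case (step v)
  then have "Xm i a v = 0" by (meson nil_Xm)
  then show ?case using Xm_cancel[of c i v a "{0}"] step.prems by (auto simp: subspace_zero_set)
qed simp

text \<open>\<open>T i\<close> exchanges \<open>X i\<close> and \<open>X (Suc i)\<close> up to a
  multiple of \<open>X (Suc i) v\<close>, which is again generalised of weight \<open>c\<close>.
  Since both weights are \<open>c\<close>, the induction on the exponent of one generator closes for
  the other.\<close>

lemma nil_T_pair:
  assumes i: "1 \<le> i" "i < n" and v: "nil c i v" "nil c (Suc i) v"
  shows "nil c i (T i v)" "nil c (Suc i) (T i v)"
proof -
  show "nil c i (T i v)" using v(2,1)
  proof (induction rule: nil_induct)
    case (step v)
    have "Xm i c (T i v) = T i (Xm (Suc i) c v) - (q - 1) *s X (Suc i) v"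
      using i by (simp add: Xm_def X_T)
    moreover have "nil c i (T i (Xm (Suc i) c v))" by (rule step.IH[OF nil_Xm[OF step.prems]])
    moreover have "nil c i ((q - 1) *s X (Suc i) v)"
      by (rule nil_scale[OF nil_X[OF step.prems]])
    ultimately have "nil c i (Xm i c (T i v))" by (simp add: nil_diff)
    then show ?case by simp
  qed simp
  show "nil c (Suc i) (T i v)" using v(1,2)
  proof (induction rule: nil_induct)
    case (step v)
    have "Xm (Suc i) c (T i v) = T i (Xm i c v) + (q - 1) *s X (Suc i) v"
      using i by (simp add: Xm_def X_Suc_T)
    moreover have "nil c (Suc i) (T i (Xm i c v))" by (rule step.IH[OF nil_Xm[OF step.prems]])
    moreover have "nil c (Suc i) ((q - 1) *s X (Suc i) v)"
      by (rule nil_scale[OF nil_X[OF step.prems]])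
    ultimately have "nil c (Suc i) (Xm (Suc i) c (T i v))" by (simp add: nil_add)
    then show ?case by simp
  qed simp
qed

lemma common_eigenvector:
  assumes "finite I" "subspace S" "S \<noteq> {0}"
    and "\<And>i v. i \<in> I \<Longrightarrow> v \<in> S \<Longrightarrow> nil (c i) i v"
    and "\<And>i v. i \<in> I \<Longrightarrow> v \<in> S \<Longrightarrow> X i v \<in> S"
  shows "\<exists>v\<in>S. v \<noteq> 0 \<and> (\<forall>i\<in>I. X i v = c i *s v)"
  using assms
proof (induction I)
  case empty
  then show ?case using subspace_0 by fastforce
next
  case (insert j I)
  then obtain v where v: "v \<in> S" "v \<noteq> 0" "\<forall>i\<in>I. X i v = c i *s v" by auto
  \<comment> \<open>Keep applying \<open>Xm j (c j)\<close>: commutation preserves the eigenvalues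
    for \<open>I\<close>, and the last nonzero iterate is an eigenvector of
    \<open>X j\<close>.\<close>
  have "nil (c j) j v" using insert.prems v(1) by simp
  then have "v \<in> S \<longrightarrow> v \<noteq> 0 \<longrightarrow> (\<forall>i\<in>I. X i v = c i *s v) \<longrightarrow>
      (\<exists>v\<in>S. v \<noteq> 0 \<and> (\<forall>i\<in>insert j I. X i v = c i *s v))"
  proof (induction rule: nil_induct)
    case (step v)
    show ?case
    proof (cases "Xm j (c j) v = 0")
      case True
      then show ?thesis by (auto simp: Xm_def)
    next
      case False
      show ?thesis
      proof (intro impI)
        assume v: "v \<in> S" "\<forall>i\<in>I. X i v = c i *s v"
        have "Xm j (c j) v \<in> S"
          unfolding Xm_def using insert.prems v(1)
          by (intro subspace_diff subspace_scale) auto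
        moreover have "\<forall>i\<in>I. X i (Xm j (c j) v) = c i *s Xm j (c j) v"
          using v(2) by (simp add: X_Xm_comm)
        ultimately show "\<exists>v\<in>S. v \<noteq> 0 \<and> (\<forall>i\<in>insert j I. X i v = c i *s v)"
          using step.IH False by blast
      qed
    qed
  qed simp
  then show ?case using v by blast
qed

subsection \<open>Coset representatives\<close>

text \<open>The product \<open>T j ... T (k - 1)\<close>, empty for \<open>j = k\<close>: these are
  the minimal representatives of the left cosets of the symmetric group on \<open>k - 1\<close>
  letters in the one on \<open>k\<close> letters.\<close>

definition Y :: "nat \<Rightarrow> nat \<Rightarrow> 'b \<Rightarrow> 'b" where
  "Y k j v = foldr T [j..<k] v"

definition Z :: "nat \<Rightarrow> nat \<Rightarrow> 'b set \<Rightarrow> 'b set" where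
  "Z k l N = span (\<Union>j\<in>{l..k}. Y k j ` N)"

lemma Y_self [simp]: "Y k k v = v"
  by (simp add: Y_def)

lemma Y_step: "j < k \<Longrightarrow> Y k j v = T j (Y k (Suc j) v)"
  by (simp add: Y_def upt_conv_Cons)

lemma linear_Y: "lin (Y k j)"
proof -
  have "lin (foldr T js)" for js
    by (induction js) (auto simp: lin_iff)
  then show ?thesis by (simp add: lin_iff Y_def)
qed

lemmas Y_simps [simp] = lin_add[OF linear_Y] lin_scale[OF linear_Y] lin_zero[OF linear_Y]
  lin_diff[OF linear_Y]

lemma Y_commute:
  assumes "\<And>i v. j \<le> i \<Longrightarrow> i < k \<Longrightarrow> f (T i v) = T i (f v)"
  shows "f (Y k j v) = Y k j (f v)"
proof -
  have "f (foldr T js v) = foldr T js (f v)" if "set js \<subseteq> {j..<k}" for js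
    using that by (induction js) (auto simp: assms)
  then show ?thesis by (simp add: Y_def)
qed

lemma T_Y_below: "Suc i < j \<Longrightarrow> T i (Y k j v) = Y k j (T i v)"
  by (rule Y_commute) (simp add: T_comm)

lemma X_Y_outside: "i < j \<or> k < i \<Longrightarrow> X i (Y k j v) = Y k j (X i v)"
  by (rule Y_commute) (auto simp: TX_comm)

text \<open>The braid relation acts once, at \<open>j = i - 1\<close>, and this is where the index
  drops by one; for smaller \<open>j\<close> each extra factor commutes with
  \<open>T i\<close>.\<close>

lemma T_Y_above:
  assumes "1 \<le> j" "j < i" "i < k" "k \<le> n"
  shows "T i (Y k j v) = Y k j (T (i - 1) v)"
  using assms(2,1)
proof (induction j arbitrary: rule: strict_inc_induct)
  case (base j)
  have "T (Suc j) (T j (T (Suc j) w)) = T j (T (Suc j) (T j w))" for w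
    using base assms by (intro T_braid[symmetric]) auto
  then show ?case
    using base assms by (simp add: Y_step T_Y_below)
next
  case (step j)
  then have "T i (Y k (Suc j) v) = Y k (Suc j) (T (i - 1) v)" by simp
  moreover have "T i (T j w) = T j (T i w)" for w using step by (simp add: T_comm)
  ultimately show ?case using step.hyps assms by (simp add: Y_step)
qed

lemma subspace_Z: "subspace (Z k l N)"
  by (simp add: Z_def)

lemma Y_in_Z: "l \<le> j \<Longrightarrow> j \<le> k \<Longrightarrow> u \<in> N \<Longrightarrow> Y k j u \<in> Z k l N"
  unfolding Z_def by (rule span_base) auto

lemma Z_mono: "l \<le> l' \<Longrightarrow> N \<subseteq> N' \<Longrightarrow> Z k l' N \<subseteq> Z k l N'"
  unfolding Z_def by (intro span_mono) fastforce

lemma Z_image: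
  assumes "v \<in> Z k l N" "lin f" "subspace W"
    and "\<And>j u. l \<le> j \<Longrightarrow> j \<le> k \<Longrightarrow> u \<in> N \<Longrightarrow> f (Y k j u) \<in> W"
  shows "f v \<in> W"
proof -
  have "subspace {v. f v \<in> W}"
    using assms(2,3) by (auto simp: subspace_def lin_add lin_scale lin_zero)
  moreover have "(\<Union>j\<in>{l..k}. Y k j ` N) \<subseteq> {v. f v \<in> W}" using assms(4) by auto
  ultimately have "Z k l N \<subseteq> {v. f v \<in> W}" unfolding Z_def by (rule span_minimal[rotated])
  then show ?thesis using assms(1) by auto
qed

lemma Z_subset:
  "subspace W \<Longrightarrow> (\<And>j u. l \<le> j \<Longrightarrow> j \<le> k \<Longrightarrow> u \<in> N \<Longrightarrow> Y k j u \<in> W) \<Longrightarrow> Z k l N \<subseteq> W"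
  using Z_image[OF _ lin_id] by blast

lemma Z_empty: "k < l \<Longrightarrow> Z k l N = {0}"
  by (simp add: Z_def)

lemma Z_split:
  assumes "subspace N" "l \<le> k" "v \<in> Z k l N"
  obtains u z where "u \<in> N" "z \<in> Z k (Suc l) N" "v = Y k l u + z"
proof -
  have "{l..k} = insert l {Suc l..k}" using assms(2) by auto
  then have "Z k l N = span (Y k l ` N \<union> (\<Union>j\<in>{Suc l..k}. Y k j ` N))"
    by (simp add: Z_def)
  moreover have "span (Y k l ` N) = Y k l ` N"
    unfolding span_eq_iff using assms(1) by (auto simp: subspace_def simp flip: Y_simps) (metis Y_simps(3) imageI)
  ultimately show ?thesis
    using assms(3) that by (auto simp: span_Un Z_def)
qed

text \<open>For \<open>i \<le> k\<close> this is the inverse of the cyclic permutation belonging to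
  \<open>Y k j\<close>. To leading order \<open>X i\<close> acts on \<open>Y k j u\<close> through
  \<open>X (shift j k i)\<close> on \<open>u\<close>.\<close>

definition shift :: "nat \<Rightarrow> nat \<Rightarrow> nat \<Rightarrow> nat" where
  "shift j k i = (if i < j then i else if i = j then k else i - 1)"

text \<open>Only generators with index above \<open>s\<close> are considered. The bound on the
  \<open>T i\<close> is strict and that on the \<open>X i\<close> is not, so
  \<open>stable 0 k k\<close> means a module of rank \<open>k\<close>, while
  \<open>stable 0 (k - 1) k\<close> means rank \<open>k - 1\<close> together with
  \<open>X k\<close>, as needed to form \<open>Z\<close>.\<close>

definition stable :: "nat \<Rightarrow> nat \<Rightarrow> nat \<Rightarrow> 'b set \<Rightarrow> bool" where
  "stable s t k S \<longleftrightarrow> subspace S \<and> (\<forall>i v. s < i \<longrightarrow> i < t \<longrightarrow> v \<in> S \<longrightarrow> T i v \<in> S) \<and>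
     (\<forall>i v. s < i \<longrightarrow> i \<le> k \<longrightarrow> v \<in> S \<longrightarrow> X i v \<in> S)"

lemma stable_subspace: "stable s t k S \<Longrightarrow> subspace S"
  and stable_T: "stable s t k S \<Longrightarrow> s < i \<Longrightarrow> i < t \<Longrightarrow> v \<in> S \<Longrightarrow> T i v \<in> S"
  and stable_X: "stable s t k S \<Longrightarrow> s < i \<Longrightarrow> i \<le> k \<Longrightarrow> v \<in> S \<Longrightarrow> X i v \<in> S"
  by (auto simp: stable_def)

lemma stable_mono: "stable s t k S \<Longrightarrow> s \<le> s' \<Longrightarrow> t' \<le> t \<Longrightarrow> k' \<le> k \<Longrightarrow> stable s' t' k' S"
  unfolding stable_def by (meson le_less_trans less_le_trans order_trans)

lemma stable_Int: "stable s t k S \<Longrightarrow> stable s t k S' \<Longrightarrow> stable s t k (S \<inter> S')"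
  by (auto simp: stable_def subspace_inter)

lemma stable_zero: "stable s t k {0}"
  by (auto simp: stable_def subspace_zero_set)

lemma stable_Y:
  assumes "stable s t k' S" "s < j" "k \<le> t" "v \<in> S"
  shows "Y k j v \<in> S"
proof -
  have "foldr T js v \<in> S" if "set js \<subseteq> {j..<k}" for js
    using that
  proof (induction js)
    case (Cons i js)
    then show ?case using assms by (auto intro: stable_T[OF assms(1)])
  qed (use assms(4) in simp)
  then show ?thesis by (simp add: Y_def)
qed

text \<open>Downward induction on \<open>j\<close>, splitting off the leftmost factor
  \<open>T j\<close>. Only \<open>i = j\<close> and \<open>i = Suc j\<close> meet a Bernstein
  correction, and it is a multiple of \<open>X (Suc j) (Y k (Suc j) u)\<close>, which already lies
  in the lower part of the flag.\<close>

lemma X_Y_triangular: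
  assumes N: "stable s (k - 1) k N" and k: "k \<le> n"
    and j: "s < j" "j \<le> k" and i: "s < i" "i \<le> k" and u: "u \<in> N"
  shows "X i (Y k j u) - Y k j (X (shift j k i) u) \<in> Z k (Suc j) N"
  using j(2,1) i u
proof (induction j arbitrary: i u rule: inc_induct)
  case base
  then show ?case using subspace_0[OF subspace_Z] by (simp add: shift_def)
next
  case (step j)
  have lin: "T j z \<in> Z k (Suc (Suc j)) N" if "z \<in> Z k (Suc (Suc j)) N" for z
    using that
  proof (rule Z_image[OF _ linear_T subspace_Z])
    fix l u assume "Suc (Suc j) \<le> l" "l \<le> k" "u \<in> N"
    then show "T j (Y k l u) \<in> Z k (Suc (Suc j)) N"
      using step.prems by (simp add: T_Y_below) (intro Y_in_Z stable_T[OF N]; simp)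
  qed
  have sub: "Z k (Suc (Suc j)) N \<subseteq> Z k (Suc j) N" by (rule Z_mono) auto
  have jn: "1 \<le> j" "j < n" using step.prems step.hyps k by auto
  define w where "w = Y k (Suc j) u"
  define z where "z = X (Suc j) w - Y k (Suc j) (X k u)"
  have z: "z \<in> Z k (Suc (Suc j)) N"
    using step.IH[of "Suc j" u] step.prems step.hyps by (simp add: shift_def w_def z_def)
  have Xw: "X (Suc j) w = Y k (Suc j) (X k u) + z" by (simp add: z_def)
  have XwZ: "X (Suc j) w \<in> Z k (Suc j) N"
    unfolding Xw using z sub step.prems step.hyps
    by (intro subspace_add[OF subspace_Z] Y_in_Z stable_X[OF N]) auto
  consider "i < j" | "i = j" | "i = Suc j" | "Suc j < i" by linarith
  then show ?case
  proof cases
    case 1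
    then show ?thesis using subspace_0[OF subspace_Z] by (simp add: shift_def X_Y_outside)
  next
    case 2
    have "X i (Y k j u) - Y k j (X (shift j k i) u) = T j z - (q - 1) *s X (Suc j) w"
      using 2 jn step.hyps by (simp add: Y_step shift_def X_T Xw flip: w_def)
    then show ?thesis
      using lin[OF z] sub XwZ by (auto intro: subspace_diff subspace_scale subspace_Z)
  next
    case 3
    have "X (Suc j) (T j w) = T j (X j w) + (q - 1) *s X (Suc j) w" using jn by (rule X_Suc_T)
    moreover have "X j w = Y k (Suc j) (X j u)" unfolding w_def by (simp add: X_Y_outside)
    ultimately have "X i (Y k j u) - Y k j (X (shift j k i) u) = (q - 1) *s X (Suc j) w"
      using 3 step.hyps by (simp add: Y_step shift_def flip: w_def)
    then show ?thesis using XwZ by (auto intro: subspace_scale subspace_Z)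
  next
    case 4
    have *: "X i w - Y k (Suc j) (X (i - 1) u) \<in> Z k (Suc (Suc j)) N"
      using step.IH[of i u] step.prems 4 by (simp add: shift_def w_def)
    have "X i (Y k j u) - Y k j (X (shift j k i) u) = T j (X i w - Y k (Suc j) (X (i - 1) u))"
      using 4 step.hyps by (simp add: Y_step shift_def TX_comm flip: w_def)
    then show ?thesis using lin[OF *] sub by auto
  qed
qed

lemma shift_bounds: "s < j \<Longrightarrow> j \<le> k \<Longrightarrow> s < i \<Longrightarrow> i \<le> k \<Longrightarrow> s < shift j k i \<and> shift j k i \<le> k"
  by (auto simp: shift_def)

lemma X_Z:
  assumes "stable s (k - 1) k N" "k \<le> n" "s < l" "s < i" "i \<le> k" "v \<in> Z k l N"
  shows "X i v \<in> Z k l N"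
  using assms(6)
proof (rule Z_image[OF _ linear_X subspace_Z])
  fix j u assume j: "l \<le> j" "j \<le> k" "u \<in> N"
  have "X i (Y k j u) - Y k j (X (shift j k i) u) \<in> Z k l N"
    using X_Y_triangular[OF assms(1,2)] j assms Z_mono[of l "Suc j" N N k] by auto
  moreover have "Y k j (X (shift j k i) u) \<in> Z k l N"
    using j assms shift_bounds[of s j k i] by (intro Y_in_Z stable_X[OF assms(1)]) auto
  ultimately show "X i (Y k j u) \<in> Z k l N"
    using subspace_add[OF subspace_Z] by fastforce
qed

text \<open>The four positions of \<open>i\<close> relative to \<open>j\<close> use commutation,
  absorption of \<open>T i\<close> into the representative, the quadratic relation and the braid
  relation. For \<open>s = 0\<close> the span is thus the rank \<open>k\<close> module generated by
  \<open>N\<close>.\<close>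

lemma stable_Z:
  assumes N: "stable s (k - 1) k N" and k: "k \<le> n"
  shows "stable s k k (Z k (Suc s) N)"
  unfolding stable_def
proof (intro conjI allI impI subspace_Z)
  fix i v assume i: "s < i" "i < k" and v: "v \<in> Z k (Suc s) N"
  show "T i v \<in> Z k (Suc s) N" using v
  proof (rule Z_image[OF _ linear_T subspace_Z])
    fix j u assume j: "Suc s \<le> j" "j \<le> k" "u \<in> N"
    consider "Suc i < j" | "Suc i = j" | "i = j" | "j < i" by linarith
    then show "T i (Y k j u) \<in> Z k (Suc s) N"
    proof cases
      case 1
      then show ?thesis using i j by (simp add: T_Y_below) (intro Y_in_Z stable_T[OF N]; simp)
    next
      case 2
      then have "T i (Y k j u) = Y k i u" using i by (simp add: Y_step)
      then show ?thesis using i j by (auto intro: Y_in_Z)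
    next
      case 3
      then have "T i (Y k j u) = (q - 1) *s Y k i u + q *s Y k (Suc i) u"
        using i j k by (simp add: Y_step T_quad)
      then show ?thesis
        using i j by (auto intro!: subspace_add subspace_scale subspace_Z Y_in_Z)
    next
      case 4
      then show ?thesis using i j k by (simp add: T_Y_above) (intro Y_in_Z stable_T[OF N]; simp)
    qed
  qed
qed (use X_Z[OF assms] in auto)

subsection \<open>Products of shifted generators\<close>

definition Xop :: "(nat \<times> 'f) list \<Rightarrow> 'b \<Rightarrow> 'b" where
  "Xop L v = foldr (\<lambda>(i, c). Xm i c) L v"

lemma Xop_Nil [simp]: "Xop [] v = v"
  and Xop_Cons [simp]: "Xop ((i, c) # L) v = Xm i c (Xop L v)"
  and Xop_append: "Xop (L @ L') v = Xop L (Xop L' v)"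
  by (simp_all add: Xop_def)

lemma linear_Xop: "lin (Xop L)"
  by (induction L) (auto simp: lin_iff Xop_def)

lemmas Xop_simps [simp] = lin_add[OF linear_Xop] lin_scale[OF linear_Xop] lin_zero[OF linear_Xop]
  lin_diff[OF linear_Xop]

lemma Xop_commute:
  assumes "\<And>i c v. (i, c) \<in> set L \<Longrightarrow> f (Xm i c v) = Xm i c (f v)"
  shows "f (Xop L v) = Xop L (f v)"
  using assms by (induction L) auto

lemma X_Xop: "X i (Xop L v) = Xop L (X i v)"
  by (rule Xop_commute) (rule X_Xm_comm)

lemma Xop_Xop: "Xop L (Xop L' v) = Xop L' (Xop L v)"
  by (rule Xop_commute) (rule Xop_commute[symmetric], rule Xm_Xm_comm)

lemma nil_Xop: "nil c i v \<Longrightarrow> nil c i (Xop L v)"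
  by (rule nil_comm[OF linear_Xop]) (simp_all add: X_Xop)

lemma Xop_closed:
  assumes "subspace S" "\<And>i c u. (i, c) \<in> set L \<Longrightarrow> u \<in> S \<Longrightarrow> X i u \<in> S" "v \<in> S"
  shows "Xop L v \<in> S"
  using assms(2)
proof (induction L)
  case (Cons p L)
  obtain i c where "p = (i, c)" by force
  moreover have "Xop L v \<in> S" using Cons by auto
  ultimately show ?case using Cons.prems assms(1)
    by (auto simp: Xm_def intro!: subspace_diff subspace_scale)
qed (use assms(3) in simp)

lemma Xop_cancel:
  assumes "\<And>i c. (i, c) \<in> set L \<Longrightarrow> c \<noteq> a \<and> nil a i v" "Xop L v \<in> S" "subspace S"
    and "\<And>i c u. (i, c) \<in> set L \<Longrightarrow> u \<in> S \<Longrightarrow> X i u \<in> S"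
  shows "v \<in> S"
  using assms(1,2,4)
proof (induction L)
  case (Cons p L)
  obtain i c where p: "p = (i, c)" by force
  have "nil a i (Xop L v)" using Cons.prems p by (intro nil_Xop) auto
  then have "Xop L v \<in> S"
    using Xm_cancel[of a i "Xop L v" c S] Cons.prems p assms(3) by (metis Xop_Cons list.set_intros(1))
  then show ?case by (metis Cons.IH Cons.prems(1,3) list.set_intros(2))
qed simp

lemma Xop_funpow_cancel:
  assumes "\<And>i c. (i, c) \<in> set L \<Longrightarrow> c \<noteq> a \<and> nil a i v" "(Xop L ^^ t) v \<in> S" "subspace S"
    and "\<And>i c u. (i, c) \<in> set L \<Longrightarrow> u \<in> S \<Longrightarrow> X i u \<in> S"
  shows "v \<in> S"
  using assms(1,2)
proof (induction t arbitrary: v)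
  case (Suc t)
  have "(Xop L ^^ t) (Xop L v) \<in> S" using Suc.prems by (simp add: funpow_swap1)
  then have "Xop L v \<in> S" using Suc by (meson nil_Xop)
  then show ?case using Xop_cancel[of L a v S] Suc.prems assms by blast
qed simp

lemma Xop_Y_triangular:
  assumes N: "stable s (k - 1) k N" and k: "k \<le> n" and j: "s < j" "j \<le> k" and u: "u \<in> N"
    and L: "\<And>i c. (i, c) \<in> set L \<Longrightarrow> s < i \<and> i \<le> k"
  shows "Xop L (Y k j u) - Y k j (Xop (map (apfst (shift j k)) L) u) \<in> Z k (Suc j) N"
  using L
proof (induction L)
  case Nil
  then show ?case using subspace_0[OF subspace_Z] by simp
next
  case (Cons p L)
  obtain i c where p: "p = (i, c)" by force
  define w where "w = Xop (map (apfst (shift j k)) L) u"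
  define z where "z = Xop L (Y k j u) - Y k j w"
  have i: "s < i" "i \<le> k" using Cons.prems p by auto
  have z: "z \<in> Z k (Suc j) N" unfolding z_def w_def using Cons.prems by (intro Cons.IH) auto
  have w: "w \<in> N" unfolding w_def
  proof (rule Xop_closed[OF stable_subspace[OF N] _ u])
    fix i' c' v assume "(i', c') \<in> set (map (apfst (shift j k)) L)" "v \<in> N"
    moreover from this obtain m where "i' = shift j k m" "(m, c') \<in> set L" by auto
    ultimately show "X i' v \<in> N"
      using Cons.prems[of m c'] shift_bounds[OF j, of m] by (simp add: stable_X[OF N])
  qed
  have "Xop (p # L) (Y k j u) - Y k j (Xop (map (apfst (shift j k)) (p # L)) u)
      = (X i (Y k j w) - Y k j (X (shift j k i) w)) + (X i z - c *s z)"
    unfolding p by (simp add: z_def Xm_def w_def[symmetric] algebra_simps scale_right_diff_distrib)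
  moreover have "X i (Y k j w) - Y k j (X (shift j k i) w) \<in> Z k (Suc j) N"
    using X_Y_triangular[OF N k j i w] .
  moreover have "X i z - c *s z \<in> Z k (Suc j) N"
    using X_Z[OF N k _ i z] j z by (intro subspace_diff subspace_scale subspace_Z) auto
  ultimately show ?case by (simp only: subspace_add[OF subspace_Z])
qed

text \<open>
  The shuffle argument: \<^term>\<open>Xop L\<close> acts on the \<open>j\<close>-th layer of the flag through the
  operator in \<open>Y\<close>, so its powers push everything down to \<open>Q\<close>, while it acts invertibly
  on the generalised eigenvectors that are to be located.
\<close>

lemma shuffle:
  assumes N: "stable s (k - 1) k N" and k: "k \<le> n" and Q: "subspace Q"
    and L: "\<And>i c. (i, c) \<in> set L \<Longrightarrow> s < i \<and> i \<le> k \<and> c \<noteq> a \<and> nil a i v"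
    and QX: "\<And>i c u. (i, c) \<in> set L \<Longrightarrow> u \<in> Q \<Longrightarrow> X i u \<in> Q"
    and Y: "\<And>j u. s < j \<Longrightarrow> j \<le> k \<Longrightarrow> u \<in> N \<Longrightarrow>
      Y k j (Xop (map (apfst (shift j k)) L) u) \<in> Q"
    and v: "v \<in> Z k (Suc s) N"
  shows "v \<in> Q"
proof (cases "s < k")
  case False
  then show ?thesis using v Q by (simp add: Z_empty subspace_0)
next
  case True
  have QL: "(Xop L ^^ t) u \<in> Q" if "u \<in> Q" for t u
    using that Xop_closed[OF Q, of L] QX by (induction t) auto
  have "\<exists>t. \<forall>v\<in>Z k j N. (Xop L ^^ t) v \<in> Q" if "s < j" "j \<le> Suc k" for j
    using that(2,1)
  proof (induction j rule: inc_induct)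
    case base
    then show ?case using Q by (auto simp: Z_empty subspace_0 intro: exI[of _ 0])
  next
    case (step j)
    then obtain t where t: "\<forall>v\<in>Z k (Suc j) N. (Xop L ^^ t) v \<in> Q" by auto
    have "(Xop L ^^ Suc t) v \<in> Q" if v: "v \<in> Z k j N" for v
    proof -
      obtain u z where u: "u \<in> N" "z \<in> Z k (Suc j) N" and v': "v = Y k j u + z"
        using Z_split[OF stable_subspace[OF N] _ v] step.hyps by auto
      define w where "w = Y k j (Xop (map (apfst (shift j k)) L) u)"
      define z' where "z' = Xop L (Y k j u) - w"
      have w: "w \<in> Q" unfolding w_def using Y step u by auto
      have z': "z' \<in> Z k (Suc j) N"
        unfolding z'_def w_def using Xop_Y_triangular[OF N k] step u L by auto
      have z'': "Xop L z \<in> Z k (Suc j) N"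
        using X_Z[OF N k] step.prems L u(2)
        by (intro Xop_closed[OF subspace_Z]) (auto simp: less_SucI)
      have "Xop L v = w + (z' + Xop L z)" by (simp add: v' z'_def)
      then have "(Xop L ^^ Suc t) v = (Xop L ^^ t) w + (Xop L ^^ t) (z' + Xop L z)"
        by (simp add: funpow_swap1 lin_add[OF lin_funpow[OF linear_Xop]])
      moreover have "z' + Xop L z \<in> Z k (Suc j) N"
        using z' z'' by (rule subspace_add[OF subspace_Z])
      ultimately show ?thesis using QL[OF w] t Q by (simp add: subspace_add)
    qed
    then show ?case by blast
  qed
  then obtain t where "\<forall>v\<in>Z k (Suc s) N. (Xop L ^^ t) v \<in> Q" using True by (meson Suc_leI le_SucI lessI)
  then have "(Xop L ^^ t) v \<in> Q" using v by blast
  then show ?thesis using Xop_funpow_cancel[of L a v t Q] L Q QX by blast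
qed

end

subsection \<open>Finite-dimensional modules\<close>

text \<open>The ambient type may be infinite-dimensional; only the invariant subspace
  \<open>V\<close> is bounded. The field is algebraically closed so that annihilating polynomials
  split, and \<open>q \<noteq> 1\<close> keeps the scalar in \<open>Xm_power_Y\<close>
  nonzero.\<close>

locale affine_hecke_module = affine_hecke_rep scale n q T X
  for scale :: "'f::alg_closed_field \<Rightarrow> 'b::ab_group_add \<Rightarrow> 'b" (infixr \<open>*s\<close> 75)
    and n q T X +
  fixes V :: "'b set"
  assumes stable_V: "stable 0 n n V"
    and finite_dim_V: "\<exists>B. finite B \<and> V \<subseteq> span B"
    and q_ne_1: "q \<noteq> 1"
begin

lemma independent_subset_V:
  assumes "independent C" "C \<subseteq> V"
  shows "finite C"
  using assms finite_dim_V independent_span_bound by (meson order_trans)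

lemma dim_strict_mono:
  assumes N: "subspace N" "N \<subset> S" and S: "S \<subseteq> V"
  shows "dim N < dim S"
proof -
  obtain B where B: "B \<subseteq> N" "independent B" "N \<subseteq> span B" "card B = dim N"
    by (rule basis_exists)
  obtain x where x: "x \<in> S" "x \<notin> N" using N by auto
  have "span B = N" using B N(1) by (simp add: span_minimal subset_antisym)
  then have ind: "independent (insert x B)"
    using x B by (simp add: independent_insertI)
  obtain C where C: "insert x B \<subseteq> C" "C \<subseteq> S" "independent C" "S \<subseteq> span C"
    using maximal_independent_subset_extend[of "insert x B" S] ind x B N by blast
  have fin: "finite C" using independent_subset_V C S by blast
  have "x \<notin> B" using x B by auto
  then have "card B < card C"
    using card_mono[OF fin C(1)] finite_subset[OF C(1) fin] by simp
  then show ?thesis using B basis_card_eq_dim[OF C(2,4,3)] by simp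
qed

definition sub :: "nat \<Rightarrow> 'b set \<Rightarrow> bool" where
  "sub k S \<longleftrightarrow> stable 0 k k S \<and> S \<subseteq> V"

definition simple :: "nat \<Rightarrow> 'b set \<Rightarrow> bool" where
  "simple k S \<longleftrightarrow> sub k S \<and> S \<noteq> {0} \<and> (\<forall>N. sub k N \<longrightarrow> N \<subseteq> S \<longrightarrow> N = {0} \<or> N = S)"

lemma sub_stable: "sub k S \<Longrightarrow> stable 0 k k S"
  and sub_V: "sub k S \<Longrightarrow> S \<subseteq> V"
  and sub_subspace: "sub k S \<Longrightarrow> subspace S"
  by (auto simp: sub_def stable_subspace)

lemma sub_mono: "sub k S \<Longrightarrow> k' \<le> k \<Longrightarrow> sub k' S"
  by (auto simp: sub_def intro: stable_mono)

lemma sub_Int: "sub k S \<Longrightarrow> sub k S' \<Longrightarrow> sub k (S \<inter> S')"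
  by (auto simp: sub_def stable_Int)

lemma sub_zero_mem: "sub k S \<Longrightarrow> 0 \<in> S"
  using sub_subspace subspace_0 by blast

lemma simple_sub: "simple k S \<Longrightarrow> sub k S"
  and simple_nonzero: "simple k S \<Longrightarrow> S \<noteq> {0}"
  and simple_minimal: "simple k S \<Longrightarrow> sub k N \<Longrightarrow> N \<subseteq> S \<Longrightarrow> N \<noteq> {0} \<Longrightarrow> N = S"
  by (auto simp: simple_def)

lemma simple_subset:
  assumes "simple k N" "sub k S" "v \<in> N" "v \<in> S" "v \<noteq> 0"
  shows "N \<subseteq> S"
  using simple_minimal[OF assms(1) sub_Int[OF simple_sub[OF assms(1)] assms(2)]] assms(3-5)
  by blast

lemma simple_exists:
  assumes "sub k S" "S \<noteq> {0}"
  obtains N where "simple k N" "N \<subseteq> S"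
proof -
  have "\<exists>N. simple k N \<and> N \<subseteq> S" using assms
  proof (induction "dim S" arbitrary: S rule: less_induct)
    case less
    show ?case
    proof (cases "simple k S")
      case False
      then obtain N where N: "sub k N" "N \<subseteq> S" "N \<noteq> {0}" "N \<noteq> S"
        using less.prems by (auto simp: simple_def)
      then have "dim N < dim S"
        using dim_strict_mono[OF sub_subspace[OF N(1)]] less.prems sub_V by blast
      then show ?thesis using less.hyps N by blast
    qed blast
  qed
  then show ?thesis using that by blast
qed

lemma X_V: "1 \<le> i \<Longrightarrow> i \<le> n \<Longrightarrow> v \<in> V \<Longrightarrow> X i v \<in> V"
  using stable_X[OF stable_V] by auto

section \<open>Annihilating polynomials of the \<open>X i\<close>\<close>

definition peval :: "nat \<Rightarrow> 'f poly \<Rightarrow> 'b \<Rightarrow> 'b" where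
  "peval i p v = fold_coeffs (\<lambda>c w. c *s v + X i w) p 0"

lemma peval_0 [simp]: "peval i 0 v = 0"
  by (simp add: peval_def)

lemma peval_pCons [simp]: "peval i (pCons c p) v = c *s v + X i (peval i p v)"
  by (cases "p = 0 \<and> c = 0") (auto simp: peval_def)

lemma peval_add: "peval i (p + r) v = peval i p v + peval i r v"
  by (induction p r rule: poly_induct2) (simp_all add: scale_left_distrib algebra_simps)

lemma peval_smult: "peval i (smult c p) v = c *s peval i p v"
  by (induction p) (simp_all add: scale_right_distrib)

lemma peval_diff: "peval i (p - r) v = peval i p v - peval i r v"
  using peval_add[of i "p - r" r v] by simp

lemma peval_monom: "peval i (monom 1 t) v = (X i ^^ t) v"
  by (induction t) (simp_all add: monom_0 monom_Suc)

lemma peval_Xm: "peval i p (Xm i c v) = Xm i c (peval i p v)"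
  by (induction p) (simp_all add: X_Xm_comm)

lemma peval_annihilated:
  "peval i p v = 0 \<Longrightarrow> p \<noteq> 0 \<Longrightarrow> \<exists>cs. Xop (map (Pair i) cs) v = 0"
proof (induction "degree p" arbitrary: p v)
  case 0
  then obtain c where "p = [:c:]" by (metis degree_eq_zeroE)
  then have "v = 0" using 0 by auto
  then show ?case by simp
next
  case (Suc d)
  obtain x where "poly p x = 0"
    using alg_closed_imp_poly_has_root[of p] Suc.hyps by auto
  then obtain r where r: "p = [:-x, 1:] * r" by (auto simp: poly_eq_0_iff_dvd elim: dvdE)
  have "r \<noteq> 0" using r Suc.prems by auto
  have "p = pCons 0 r - smult x r" by (simp add: r)
  then have "peval i r (Xm i x v) = peval i p v"
    by (simp only: peval_Xm peval_diff peval_smult peval_pCons) (simp add: Xm_def)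
  moreover have "d = degree r"
    using Suc.hyps(2) degree_mult_eq[of "[:-x, 1:]" r] \<open>r \<noteq> 0\<close> unfolding r by simp
  ultimately obtain cs where "Xop (map (Pair i) cs) (Xm i x v) = 0"
    using Suc.hyps(1)[of r "Xm i x v"] Suc.prems \<open>r \<noteq> 0\<close> by auto
  then have "Xop (map (Pair i) (cs @ [x])) v = 0" by (simp add: Xop_append)
  then show ?case by blast
qed

lemma annihilator_exists:
  assumes i: "1 \<le> i" "i \<le> n" and v: "v \<in> V"
  shows "\<exists>cs. Xop (map (Pair i) cs) v = 0"
proof -
  define w where "w t = (X i ^^ t) v" for t
  have wV: "w t \<in> V" for t
    unfolding w_def by (induction t) (simp_all add: v X_V[OF i])
  have "\<exists>t. w t \<in> span (w ` {..<t})"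
  proof (rule ccontr)
    assume *: "\<nexists>t. w t \<in> span (w ` {..<t})"
    have ind: "independent (w ` {..<t}) \<and> card (w ` {..<t}) = t" for t
    proof (induction t)
      case (Suc t)
      have "w t \<notin> w ` {..<t}" using * by (meson span_base)
      then show ?case using Suc * by (simp add: lessThan_Suc independent_insertI)
    qed (simp add: independent_empty)
    obtain B where "finite B" "V \<subseteq> span B" using finite_dim_V by blast
    then have "card (w ` {..<Suc (card B)}) \<le> card B"
      using independent_span_bound[of B "w ` {..<Suc (card B)}"] ind wV by blast
    then show False using ind by (metis Suc_n_not_le_n)
  qed
  then obtain t where t: "w t \<in> span (w ` {..<t})" by blast
  \<comment> \<open>The alternative \<open>p = 0\<close> covers \<open>t = 0\<close>, where no
    polynomial has degree below \<open>t\<close>.\<close>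
  let ?P = "{peval i p v | p. degree p < t \<or> p = 0}"
  have "subspace ?P"
  proof (rule subspaceI)
    show "0 \<in> ?P" by (metis (mono_tags, lifting) mem_Collect_eq peval_0)
  next
    fix x y assume "x \<in> ?P" "y \<in> ?P"
    then obtain p r where pr: "x = peval i p v" "y = peval i r v" "degree p < t \<or> p = 0" "degree r < t \<or> r = 0"
      by blast
    then have "degree (p + r) < t \<or> p + r = 0" by (auto intro: degree_add_less)
    then show "x + y \<in> ?P" using pr by (auto simp flip: peval_add)
  next
    fix c x assume "x \<in> ?P"
    then obtain p where p: "x = peval i p v" "degree p < t \<or> p = 0" by blast
    then have "degree (smult c p) < t \<or> smult c p = 0" by auto
    then show "c *s x \<in> ?P" using p by (auto simp flip: peval_smult)
  qed
  moreover have "w s \<in> ?P" if "s < t" for s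
    using that unfolding w_def
    by (intro CollectI exI[of _ "monom 1 s"]) (auto simp: peval_monom degree_monom_eq)
  ultimately have "span (w ` {..<t}) \<subseteq> ?P" by (intro span_minimal) auto
  then obtain p where p: "w t = peval i p v" "degree p < t \<or> p = 0" using t by blast
  have "monom 1 t - p \<noteq> 0"
    using p(2) by (metis degree_monom_eq eq_iff_diff_eq_0 less_irrefl monom_eq_0_iff zero_neq_one)
  moreover have "peval i (monom 1 t - p) v = 0"
    using p(1) by (simp add: peval_diff peval_monom w_def)
  ultimately show ?thesis by (rule peval_annihilated[rotated])
qed

lemma nil_Xop_filter:
  "nil a i (Xop (map (Pair i) cs) v) \<Longrightarrow> nil a i (Xop (map (Pair i) (filter (\<lambda>c. c \<noteq> a) cs)) v)"
proof (induction cs arbitrary: v)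
  case (Cons c cs)
  have eq: "Xop (map (Pair i) (c # cs)) v = Xop (map (Pair i) cs) (Xm i c v)" for cs
    using Xop_Xop[of "[(i, c)]" "map (Pair i) cs" v] by simp
  show ?case
  proof (cases "c = a")
    case True
    have "nil a i (Xop (map (Pair i) cs) v)" using Cons.prems True by simp
    then show ?thesis using Cons.IH True by simp
  next
    case False
    have "nil a i (Xop (map (Pair i) (filter (\<lambda>c. c \<noteq> a) cs)) (Xm i c v))"
      using Cons.prems unfolding eq by (rule Cons.IH)
    then show ?thesis using False by (simp only: filter.simps if_True simp_thms eq)
  qed
qed simp

lemma nil_Xop_append:
  assumes "nil c i (Xop L v) \<or> nil c i (Xop L' v)"
  shows "nil c i (Xop (L @ L') v)"
  using assms by (metis Xop_append Xop_Xop nil_Xop)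

text \<open>The operator given by \<open>hs\<close> replaces the projection onto the generalised
  \<open>a\<close>-eigenspace of \<open>X i\<close>: it maps \<open>V\<close> into it, and it is
  invertible there because \<open>a\<close> is not in \<open>hs\<close>. One list serves all
  \<open>i\<close>, found by treating the finitely many pairs of an index and a basis vector in
  turn.\<close>

lemma complement_annihilator:
  obtains hs where "a \<notin> set hs"
    "\<And>i v. 1 \<le> i \<Longrightarrow> i \<le> n \<Longrightarrow> v \<in> V \<Longrightarrow> nil a i (Xop (map (Pair i) hs) v)"
proof -
  obtain B where B: "B \<subseteq> V" "independent B" "V \<subseteq> span B" "card B = dim V"
    by (rule basis_exists)
  have "finite ({1..n} \<times> B)" using independent_subset_V B by auto
  moreover have "\<exists>hs. a \<notin> set hs \<and> (\<forall>(i, b)\<in>A. nil a i (Xop (map (Pair i) hs) b))"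
    if "finite A" "A \<subseteq> {1..n} \<times> B" for A
    using that
  proof (induction A)
    case (insert x A)
    obtain j b where x: "x = (j, b)" by force
    obtain hs where hs: "a \<notin> set hs" "\<forall>(i, b)\<in>A. nil a i (Xop (map (Pair i) hs) b)"
      using insert by auto
    obtain cs where "Xop (map (Pair j) cs) b = 0"
      using annihilator_exists[of j b] insert.prems x B by auto
    then have cs: "nil a j (Xop (map (Pair j) (filter (\<lambda>c. c \<noteq> a) cs)) b)"
      by (intro nil_Xop_filter) simp
    let ?cs = "hs @ filter (\<lambda>c. c \<noteq> a) cs"
    have "nil a i (Xop (map (Pair i) ?cs) b')" if "(i, b') \<in> insert x A" for i b'
    proof (cases "(i, b') = x")
      case True
      then show ?thesis using nil_Xop_append[OF disjI2[OF cs]] x by simp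
    next
      case False
      then have "nil a i (Xop (map (Pair i) hs) b')" using that hs by auto
      then show ?thesis unfolding map_append by (intro nil_Xop_append disjI1)
    qed
    then show ?case using hs(1) by (intro exI[of _ ?cs]) auto
  qed (auto intro: exI[of _ "[]"])
  ultimately obtain hs where hs: "a \<notin> set hs"
    "\<forall>(i, b)\<in>{1..n} \<times> B. nil a i (Xop (map (Pair i) hs) b)" by blast
  have "nil a i (Xop (map (Pair i) hs) v)" if i: "1 \<le> i" "i \<le> n" and v: "v \<in> V" for i v
  proof -
    have "subspace {v. nil a i (Xop (map (Pair i) hs) v)}"
      by (auto simp: subspace_def nil_add nil_scale)
    then have "span B \<subseteq> {v. nil a i (Xop (map (Pair i) hs) v)}"
      using hs i by (intro span_minimal) auto
    then show ?thesis using v B by auto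
  qed
  then show ?thesis using that hs(1) by blast
qed

lemma nil_Xop_product:
  assumes hs: "\<And>v. v \<in> V \<Longrightarrow> nil a i (Xop (map (Pair i) hs) v)"
    and "i \<in> set I" "v \<in> V"
  shows "nil a i (Xop (List.product I hs) v)"
  using assms(2)
proof (induction I)
  case (Cons j I)
  show ?case
  proof (cases "i = j")
    case True
    then show ?thesis using hs[OF assms(3)] by (simp add: nil_Xop_append)
  next
    case False
    then show ?thesis using Cons by (simp add: nil_Xop_append)
  qed
qed simp

lemma map_apfst_product: "map (apfst f) (List.product I hs) = List.product (map f I) hs"
  by (induction I) auto

subsection \<open>Tails of weights\<close>

text \<open>The tail has length \<open>k - s\<close>; for \<open>s = k\<close> it is empty and all
  of \<open>S\<close> qualifies.\<close>

definition Tail :: "'f \<Rightarrow> nat \<Rightarrow> nat \<Rightarrow> 'b set \<Rightarrow> 'b set" where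
  "Tail c s k S = {v\<in>S. \<forall>i. s < i \<longrightarrow> i \<le> k \<longrightarrow> nil c i v}"

lemma Tail_mono: "S \<subseteq> S' \<Longrightarrow> s \<le> s' \<Longrightarrow> k' \<le> k \<Longrightarrow> Tail c s k S \<subseteq> Tail c s' k' S'"
  by (auto simp: Tail_def)

lemma subspace_Tail: "subspace S \<Longrightarrow> subspace (Tail c s k S)"
  by (auto simp: subspace_def Tail_def nil_add nil_scale)

text \<open>The shuffle argument with a list over all indices of the tail. In a layer with
  \<open>j > s\<close> the shift permutes them among \<open>s + 1, ..., k\<close>, and
  \<open>YQ\<close> applies. In a layer with \<open>j \<le> s\<close> it carries them to
  \<open>s, ..., k - 1\<close>; the coefficient then has a tail that \<open>low\<close> excludes, so
  it vanishes.\<close>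

lemma Tail_generated:
  assumes N: "stable 0 (k - 1) k N" "N \<subseteq> V" and k: "k \<le> n"
    and low: "s = 0 \<or> Tail a (s - 1) (k - 1) N \<subseteq> {0}"
    and Q: "subspace Q" "\<And>i u. s < i \<Longrightarrow> i \<le> k \<Longrightarrow> u \<in> Q \<Longrightarrow> X i u \<in> Q"
    and YQ: "\<And>j u. s < j \<Longrightarrow> j \<le> k \<Longrightarrow> u \<in> Tail a s (k - 1) N \<Longrightarrow> nil a k u \<Longrightarrow> Y k j u \<in> Q"
  shows "Tail a s k (Z k 1 N) \<subseteq> Q"
proof
  fix v assume v: "v \<in> Tail a s k (Z k 1 N)"
  obtain hs where hs: "a \<notin> set hs"
    "\<And>i v. 1 \<le> i \<Longrightarrow> i \<le> n \<Longrightarrow> v \<in> V \<Longrightarrow> nil a i (Xop (map (Pair i) hs) v)"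
    using complement_annihilator[of a] by auto
  define L where "L = List.product [Suc s..<Suc k] hs"
  have L: "0 < i \<and> s < i \<and> i \<le> k \<and> c \<noteq> a" if "(i, c) \<in> set L" for i c
    using that hs(1) by (auto simp: L_def)
  show "v \<in> Q"
  proof (rule shuffle[OF N(1) k Q(1)])
    fix j u assume j: "0 < j" "j \<le> k" and u: "u \<in> N"
    define w where "w = Xop (map (apfst (shift j k)) L) u"
    have wN: "w \<in> N" unfolding w_def
    proof (rule Xop_closed[OF stable_subspace[OF N(1)] _ u])
      fix i c v assume "(i, c) \<in> set (map (apfst (shift j k)) L)" "v \<in> N"
      moreover from this obtain m where "i = shift j k m" "(m, c) \<in> set L" by auto
      ultimately show "X i v \<in> N"
        using L[of m c] shift_bounds[OF j, of m] by (simp add: stable_X[OF N(1)])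
    qed
    have nil: "nil a (shift j k i) w" if i: "s < i" "i \<le> k" for i
    proof -
      have "shift j k i \<in> set (map (shift j k) [Suc s..<Suc k])"
        using i by (auto simp del: upt_Suc)
      then show ?thesis
        unfolding w_def L_def map_apfst_product
        using i j k u N(2) shift_bounds[of 0 j k i] by (intro nil_Xop_product hs) auto
    qed
    show "Y k j w \<in> Q"
    proof (cases "s < j")
      case True
      have "nil a i w" if "s < i" "i \<le> k - 1" for i
        using nil[of i] nil[of "Suc i"] that j by (cases "i < j") (auto simp: shift_def)
      moreover have "nil a k w" using nil[of j] True j by (simp add: shift_def)
      ultimately show ?thesis using YQ True j wN by (simp add: Tail_def)
    next
      case False
      have "nil a i w" if "s - 1 < i" "i \<le> k - 1" for i
        using nil[of "Suc i"] that j False by (auto simp: shift_def)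
      then have "w \<in> Tail a (s - 1) (k - 1) N" using wN by (simp add: Tail_def)
      then have "w = 0" using low False j by auto
      then show ?thesis using Q(1) by (simp add: subspace_0)
    qed
  qed (use v L Q in \<open>auto simp: Tail_def\<close>)
qed

section \<open>Modules generated by a module of rank one lower\<close>

definition hat :: "nat \<Rightarrow> 'b set \<Rightarrow> 'b set" where
  "hat k N = span (\<Union>t. (X k ^^ t) ` N)"

lemma hat_minimal:
  assumes "subspace W" "\<And>v. v \<in> W \<Longrightarrow> X k v \<in> W" "N \<subseteq> W"
  shows "hat k N \<subseteq> W"
proof -
  have "(X k ^^ t) v \<in> W" if "v \<in> N" for t v
    using that assms by (induction t) auto
  then show ?thesis unfolding hat_def using assms(1) by (intro span_minimal) auto
qed

lemma subset_hat: "N \<subseteq> hat k N"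
proof
  fix v assume "v \<in> N"
  then have "(X k ^^ 0) v \<in> hat k N" unfolding hat_def by (intro span_base) blast
  then show "v \<in> hat k N" by simp
qed

lemma hat_closed:
  assumes f: "lin f" "\<And>v. f (X k v) = X k (f v)" "\<And>v. v \<in> N \<Longrightarrow> f v \<in> N" and v: "v \<in> hat k N"
  shows "f v \<in> hat k N"
proof -
  have comm: "f ((X k ^^ t) u) = (X k ^^ t) (f u)" for t u by (induction t) (auto simp: f(2))
  have "subspace {v. f v \<in> hat k N}"
    by (auto simp: subspace_def lin_add[OF f(1)] lin_scale[OF f(1)] lin_zero[OF f(1)] hat_def
        span_add span_scale span_zero)
  moreover have "(X k ^^ t) u \<in> {v. f v \<in> hat k N}" if "u \<in> N" for t u
    using that f(3) unfolding comm mem_Collect_eq hat_def by (intro span_base) auto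
  ultimately have "hat k N \<subseteq> {v. f v \<in> hat k N}"
    unfolding hat_def by (intro span_minimal) auto
  then show ?thesis using v by auto
qed

text \<open>\<open>N\<close> is a module of rank \<open>k - 1\<close> only and need not be closed
  under \<open>X k\<close>. The powers of \<open>X k\<close> commute with that algebra, so adjoining
  them preserves its action and gives the input that \<open>Z\<close> requires.\<close>

lemma stable_hat:
  assumes "sub (k - 1) N"
  shows "stable 0 (k - 1) k (hat k N)"
  unfolding stable_def
proof (intro conjI allI impI)
  fix i v assume i: "0 < i" "i < k - 1" "v \<in> hat k N"
  show "T i v \<in> hat k N"
    by (rule hat_closed[OF linear_T _ _ i(3)])
      (use i stable_T[OF sub_stable[OF assms]] in \<open>auto simp: TX_comm\<close>)
next
  fix i v assume i: "0 < i" "i \<le> k" "v \<in> hat k N"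
  show "X i v \<in> hat k N"
  proof (cases "i = k")
    case True
    have *: "X k ((X k ^^ t) u) = (X k ^^ Suc t) u" for t u by simp
    have "subspace {v. X k v \<in> hat k N}"
      by (auto simp: subspace_def hat_def span_add span_scale span_zero)
    moreover have "(X k ^^ t) u \<in> {v. X k v \<in> hat k N}" if "u \<in> N" for t u
      using that unfolding mem_Collect_eq * hat_def by (intro span_base) blast
    ultimately have "hat k N \<subseteq> {v. X k v \<in> hat k N}"
      unfolding hat_def by (intro span_minimal) auto
    then show ?thesis using i True by auto
  next
    case False
    show ?thesis
      by (rule hat_closed[OF linear_X X_comm _ i(3)])
        (use i False stable_X[OF sub_stable[OF assms]] in auto)
  qed
qed (simp add: hat_def)

lemma hat_V: "1 \<le> k \<Longrightarrow> k \<le> n \<Longrightarrow> N \<subseteq> V \<Longrightarrow> hat k N \<subseteq> V"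
  using hat_minimal[OF stable_subspace[OF stable_V] X_V] by blast

text \<open>\<open>Xop L\<close> maps \<open>N\<close> into its tail, which is zero. It commutes
  with \<open>X k\<close> and therefore kills \<open>hat k N\<close> as well; on a tail it is
  injective, so no nonzero tail can appear in \<open>hat k N\<close>.\<close>

lemma Tail_hat:
  assumes k: "k \<le> n" and N: "sub (k - 1) N" and "Tail a s (k - 1) N \<subseteq> {0}"
  shows "Tail a s (k - 1) (hat k N) \<subseteq> {0}"
proof
  fix v assume v: "v \<in> Tail a s (k - 1) (hat k N)"
  obtain hs where hs: "a \<notin> set hs"
    "\<And>i v. 1 \<le> i \<Longrightarrow> i \<le> n \<Longrightarrow> v \<in> V \<Longrightarrow> nil a i (Xop (map (Pair i) hs) v)"
    using complement_annihilator[of a] by auto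
  define L where "L = List.product [Suc s..<k] hs"
  have L: "0 < i \<and> s < i \<and> i \<le> k - 1 \<and> c \<noteq> a" if "(i, c) \<in> set L" for i c
    using that hs(1) by (auto simp: L_def)
  have "Xop L u = 0" if u: "u \<in> N" for u
  proof -
    have "nil a i (Xop L u)" if "s < i" "i \<le> k - 1" for i
      unfolding L_def using that k u sub_V[OF N] by (intro nil_Xop_product hs) auto
    moreover have "Xop L u \<in> N"
      using u L stable_X[OF sub_stable[OF N]]
      by (intro Xop_closed[OF sub_subspace[OF N]]) auto
    ultimately show ?thesis using assms(3) by (auto simp: Tail_def)
  qed
  then have "hat k N \<subseteq> {v. Xop L v = 0}"
    by (intro hat_minimal) (auto simp: subspace_def simp flip: X_Xop)
  then have "Xop L v = 0" using v by (auto simp: Tail_def)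
  then have "v \<in> {0}"
    using L v by (intro Xop_cancel[of L a v "{0}"]) (auto simp: subspace_zero_set Tail_def)
  then show "v \<in> {0}" .
qed

definition gen :: "nat \<Rightarrow> 'b set \<Rightarrow> 'b set" where
  "gen k N = Z k 1 (hat k N)"

lemma subset_gen: "1 \<le> k \<Longrightarrow> N \<subseteq> gen k N"
  unfolding gen_def using Y_in_Z[of 1 k k _ "hat k N"] subset_hat by auto

lemma gen_minimal:
  assumes "1 \<le> k" "N \<subseteq> S" "stable 0 k k S"
  shows "gen k N \<subseteq> S"
  unfolding gen_def
proof (rule Z_subset[OF stable_subspace[OF assms(3)]])
  have "hat k N \<subseteq> S"
    using assms stable_X[OF assms(3)] by (intro hat_minimal stable_subspace[OF assms(3)]) auto
  then show "Y k j u \<in> S" if "1 \<le> j" "j \<le> k" "u \<in> hat k N" for j u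
    using that by (intro stable_Y[OF assms(3)]) auto
qed

lemma sub_gen:
  assumes "sub (k - 1) N" "1 \<le> k" "k \<le> n"
  shows "sub k (gen k N)"
  unfolding sub_def
proof
  show "stable 0 k k (gen k N)"
    unfolding gen_def using stable_Z[OF stable_hat[OF assms(1)] assms(3)] by simp
  show "gen k N \<subseteq> V"
    using assms sub_V[OF assms(1)] stable_mono[OF stable_V] by (intro gen_minimal) auto
qed

lemma gen_simple:
  assumes "simple k S" "sub (k - 1) N" "N \<subseteq> S" "N \<noteq> {0}" "1 \<le> k" "k \<le> n"
  shows "gen k N = S"
proof (rule simple_minimal[OF assms(1)])
  show "gen k N \<noteq> {0}"
    using subset_gen[OF assms(5), of N] assms(2,4) sub_zero_mem by blast
qed (use assms sub_gen gen_minimal sub_stable simple_sub in auto)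

text \<open>A layer of the flag adds at most one index to the tail of its coefficient. So if
  \<open>N\<close> has nothing nonzero with the tail \<open>s + 1, ..., k - 1\<close>, all
  coefficients in \<open>Tail_generated\<close> vanish.\<close>

lemma Tail_gen_same:
  assumes "1 \<le> k" "k \<le> n" "sub (k - 1) N" "Tail a s k (gen k N) \<noteq> {0}"
  shows "Tail a s (k - 1) N \<noteq> {0}"
proof
  assume "Tail a s (k - 1) N = {0}"
  then have *: "Tail a s (k - 1) (hat k N) \<subseteq> {0}" using Tail_hat assms by blast
  have "Tail a s k (gen k N) \<subseteq> {0}"
    unfolding gen_def
  proof (rule Tail_generated[OF stable_hat[OF assms(3)]])
    show "s = 0 \<or> Tail a (s - 1) (k - 1) (hat k N) \<subseteq> {0}"
      using * Tail_mono[of "hat k N" "hat k N" "s - 1" s] by force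
  qed (use assms hat_V sub_V * subspace_zero_set in auto)
  moreover have "0 \<in> Tail a s k (gen k N)"
    using subspace_0[OF subspace_Tail[OF sub_subspace[OF sub_gen]]] assms by auto
  ultimately show False using assms(4) by auto
qed

text \<open>Here \<open>X k\<close> has the single weight \<open>c \<noteq> a\<close> on
  \<open>hat k N\<close>, so the layers \<open>j > s\<close>, whose coefficients would need weight
  \<open>a\<close> at \<open>k\<close>, contribute nothing. The tail must come from layers
  \<open>j \<le> s\<close>, which keep its length and lower its indices by one.\<close>

lemma Tail_gen_other:
  assumes "1 \<le> k" "k \<le> n" "sub (k - 1) N" "Tail a s k (gen k N) \<noteq> {0}"
    and c: "c \<noteq> a" "\<And>v. v \<in> N \<Longrightarrow> nil c k v" and s: "s < k"
  shows "1 \<le> s \<and> Tail a (s - 1) (k - 1) N \<noteq> {0}"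
proof (rule ccontr)
  assume "\<not> (1 \<le> s \<and> Tail a (s - 1) (k - 1) N \<noteq> {0})"
  then have *: "s = 0 \<or> Tail a (s - 1) (k - 1) (hat k N) \<subseteq> {0}"
    using Tail_hat[OF assms(2,3), of a "s - 1"] by fastforce
  have nil: "nil c k v" if "v \<in> hat k N" for v
  proof -
    have "hat k N \<subseteq> {v. nil c k v}"
      using c(2) by (intro hat_minimal) (auto simp: subspace_def nil_add nil_scale nil_X)
    then show ?thesis using that by auto
  qed
  have "Tail a s k (gen k N) \<subseteq> {0}"
    unfolding gen_def
  proof (rule Tail_generated[OF stable_hat[OF assms(3)] _ _ *])
    fix j u assume "u \<in> Tail a s (k - 1) (hat k N)" "nil a k u"
    then have "u = 0" using nil_unique[of a k u c] nil c(1) by (auto simp: Tail_def)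
    then show "Y k j u \<in> {0}" by simp
  qed (use assms hat_V sub_V subspace_zero_set in auto)
  moreover have "0 \<in> Tail a s k (gen k N)"
    using subspace_0[OF subspace_Tail[OF sub_subspace[OF sub_gen]]] assms by auto
  ultimately show False using assms(4) by auto
qed

subsection \<open>Kato modules\<close>

definition Exact :: "'f \<Rightarrow> nat \<Rightarrow> nat \<Rightarrow> 'b set \<Rightarrow> 'b set" where
  "Exact c s k S = {v\<in>S. \<forall>i. s < i \<longrightarrow> i \<le> k \<longrightarrow> X i v = c *s v}"

text \<open>
  \<open>kato r s j P\<close> is generated from \<open>P\<close> by the \<^term>\<open>T i\<close> with \<open>r < i < s + j\<close>.
\<close>

fun kato :: "nat \<Rightarrow> nat \<Rightarrow> nat \<Rightarrow> 'b set \<Rightarrow> 'b set" where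
  "kato r s 0 P = P"
| "kato r s (Suc j) P = Z (Suc (s + j)) (Suc r) (kato r s j P)"

lemma kato_mono: "P \<subseteq> P' \<Longrightarrow> kato r s j P \<subseteq> kato r s j P'"
  by (induction j) (auto dest: Z_mono[OF order_refl])

lemma kato_Suc: "r \<le> s \<Longrightarrow> kato r s j P \<subseteq> kato r s (Suc j) P"
  using Y_in_Z[of "Suc r" "Suc (s + j)" "Suc (s + j)" _ "kato r s j P"] by auto

lemma kato_base: "r \<le> s \<Longrightarrow> P \<subseteq> kato r s j P"
  using kato_Suc by (induction j) (simp, blast)

lemma kato_subset:
  assumes "stable r k k' S" "s + j \<le> k" "P \<subseteq> S"
  shows "kato r s j P \<subseteq> S"
  using assms(2)
proof (induction j)
  case (Suc j)
  then have sub: "kato r s j P \<subseteq> S" by simp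
  show ?case
    unfolding kato.simps
  proof (rule Z_subset[OF stable_subspace[OF assms(1)]])
    fix l u assume "Suc r \<le> l" "u \<in> kato r s j P"
    then show "Y (Suc (s + j)) l u \<in> S"
      using Suc.prems sub by (intro stable_Y[OF assms(1)]) auto
  qed
qed (use assms(3) in simp)

lemma kato_exact:
  assumes "\<And>u. u \<in> P \<Longrightarrow> X i u = a *s u" "s + j < i" "u \<in> kato r s j P"
  shows "X i u = a *s u"
  using assms(2,3)
proof (induction j arbitrary: u)
  case (Suc j)
  have "Xm i a u \<in> {0}"
  proof (rule Z_image[OF _ linear_Xm subspace_zero_set])
    show "u \<in> Z (Suc (s + j)) (Suc r) (kato r s j P)" using Suc.prems by simp
    fix l w assume "w \<in> kato r s j P"
    then show "Xm i a (Y (Suc (s + j)) l w) \<in> {0}"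
      using Suc by (simp add: Xm_def X_Y_outside)
  qed
  then show ?case by (simp add: Xm_def)
qed (use assms(1) in simp)

lemma stable_kato:
  assumes P: "stable r s s P" and r: "r \<le> s" and k: "s + j \<le> k" "k \<le> n"
    and exact: "\<And>u i. u \<in> P \<Longrightarrow> s < i \<Longrightarrow> i \<le> k \<Longrightarrow> X i u = a *s u"
  shows "stable r (s + j) k (kato r s j P)"
  using k(1)
proof (induction j)
  case 0
  then show ?case using P exact unfolding stable_def
    by (metis add_0_right kato.simps(1) not_le subspace_scale)
next
  case (Suc j)
  then have IH: "stable r (s + j) k (kato r s j P)" by simp
  have st: "stable r (Suc (s + j)) (Suc (s + j)) (kato r s (Suc j) P)"
    using stable_Z[of r "Suc (s + j)" "kato r s j P"] stable_mono[OF IH] Suc.prems k by simp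
  have "X i v = a *s v" if "Suc (s + j) < i" "i \<le> k" "v \<in> kato r s (Suc j) P" for i v
    using kato_exact[of P i a s "Suc j" v r] exact that by auto
  then show ?case using st unfolding stable_def
    by (metis add_Suc_right not_le subspace_scale)
qed

text \<open>Since \<open>S\<close> is simple, the common eigenvectors \<open>P\<close> generate it
  through all the \<open>T i\<close>. One rank at a time, the tail is shown to need only those with
  index above \<open>s\<close>: by \<open>low\<close> no longer tail exists, and this excludes the
  layers starting at or below \<open>s\<close>.\<close>

lemma Tail_subset_kato:
  assumes S: "simple k S" and k: "s \<le> k" "k \<le> n"
    and low: "s = 0 \<or> Tail a (s - 1) k S \<subseteq> {0}"
    and P: "sub s P" "P \<subseteq> Exact a s k S" "P \<noteq> {0}"
  shows "Tail a s k S \<subseteq> kato s s (k - s) P"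
proof -
  have exact: "X i u = a *s u" if "u \<in> P" "s < i" "i \<le> k" for u i
    using P(2) that by (auto simp: Exact_def)
  have PS: "P \<subseteq> S" using P(2) by (auto simp: Exact_def)
  have st: "stable 0 (s + j) k (kato 0 s j P)" if "s + j \<le> k" for j
    using stable_kato[OF sub_stable[OF P(1)] _ that k(2)] exact by auto
  have sub: "kato 0 s j P \<subseteq> S" if "s + j \<le> k" for j
    using kato_subset[OF sub_stable[OF simple_sub[OF S]] that PS] .
  have SV: "S \<subseteq> V" using sub_V[OF simple_sub[OF S]] .
  have *: "Tail a s (s + j) (kato 0 s j P) \<subseteq> kato s s j P" if "s + j \<le> k" for j
    using that
  proof (induction j)
    case 0
    then show ?case by (auto simp: Tail_def)
  next
    case (Suc j)
    let ?N = "kato 0 s j P" and ?Q = "kato s s (Suc j) P"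
    have "stable s s s P"
      using sub_subspace[OF P(1)] by (simp add: stable_def)
    then have stQ: "stable s (s + Suc j) k ?Q"
      using stable_kato[of s s P "Suc j" k a] Suc.prems k exact by auto
    have "Tail a s (Suc (s + j)) (Z (Suc (s + j)) 1 ?N) \<subseteq> ?Q"
    proof (rule Tail_generated)
      show "stable 0 (Suc (s + j) - 1) (Suc (s + j)) ?N"
        using stable_mono[OF st[of j]] Suc.prems by auto
      show "?N \<subseteq> V" using sub[of j] SV Suc.prems by auto
      show "Suc (s + j) \<le> n" using Suc.prems k by simp
      show "subspace ?Q" using stable_subspace[OF stQ] .
      show "X i u \<in> ?Q" if "s < i" "i \<le> Suc (s + j)" "u \<in> ?Q" for i u
        using stable_X[OF stQ] that Suc.prems by auto
      show "Y (Suc (s + j)) l u \<in> ?Q"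
        if "s < l" "l \<le> Suc (s + j)" "u \<in> Tail a s (Suc (s + j) - 1) ?N" for l u
        using that Suc by (auto intro!: Y_in_Z)
      \<comment> \<open>The generators above \<open>s + j\<close> still act on \<open>?N\<close> by
        the scalar \<open>a\<close>, so a tail ending at \<open>s + j\<close> extends to
        \<open>k\<close> and is excluded by the hypothesis on \<open>S\<close>.\<close>
      show "s = 0 \<or> Tail a (s - 1) (Suc (s + j) - 1) ?N \<subseteq> {0}"
      proof (cases "s = 0")
        case False
        have "v \<in> Tail a (s - 1) k S" if v: "v \<in> Tail a (s - 1) (s + j) ?N" for v
        proof -
          have "nil a i v" if i: "s - 1 < i" "i \<le> k" for i
          proof (cases "i \<le> s + j")
            case True
            then show ?thesis using v i by (auto simp: Tail_def)
          next
            case False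
            then have "X i v = a *s v"
              using kato_exact[of P i a s j v 0] exact i v by (auto simp: Tail_def)
            then show ?thesis by (rule eigen_nil)
          qed
          then show ?thesis using v sub[of j] Suc.prems by (auto simp: Tail_def)
        qed
        then show ?thesis using low False by auto
      qed simp
    qed
    then show ?case by simp
  qed
  have "kato 0 s (k - s) P = S"
  proof (rule simple_minimal[OF S])
    show "sub k (kato 0 s (k - s) P)"
      using st[of "k - s"] sub[of "k - s"] SV k by (auto simp: sub_def)
    show "kato 0 s (k - s) P \<noteq> {0}"
      using kato_base[of 0 s P "k - s"] P(1,3) sub_zero_mem by blast
  qed (use sub[of "k - s"] k in auto)
  then show ?thesis using *[of "k - s"] k by simp
qed

text \<open>The Bernstein corrections in \<open>X i (T i v)\<close> and
  \<open>X (Suc i) (T i v)\<close> cancel, so \<open>T i\<close> commutes with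
  \<open>X i + X (Suc i)\<close>, and with the remaining summands one by one.\<close>

lemma sum_X_T:
  assumes "s < i" "i < k" "k \<le> n"
  shows "(\<Sum>m = Suc s..k. X m (T i v)) = T i (\<Sum>m = Suc s..k. X m v)"
proof -
  let ?A = "{Suc s..k} - {i, Suc i}"
  have split: "(\<Sum>m = Suc s..k. f m) = f i + (f (Suc i) + sum f ?A)" for f :: "nat \<Rightarrow> 'b"
  proof -
    have "{Suc s..k} = insert i (insert (Suc i) ?A)" using assms by auto
    then show ?thesis by (metis (no_types, lifting) Diff_iff finite_Diff finite_atLeastAtMost
          finite_insert insertCI insertE n_not_Suc_n sum.insert)
  qed
  have "(\<Sum>m\<in>?A. X m (T i v)) = T i (\<Sum>m\<in>?A. X m v)"
  proof -
    have "T i (sum g A) = (\<Sum>m\<in>A. T i (g m))" for g and A :: "nat set"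
      by (induction A rule: infinite_finite_induct) auto
    then show ?thesis by (simp add: TX_comm)
  qed
  then show ?thesis
    using assms by (simp add: split X_T X_Suc_T)
qed

lemma sum_X_kato:
  assumes "s + j \<le> k" "k \<le> n" "u \<in> kato s s j P"
    and exact: "\<And>u i. u \<in> P \<Longrightarrow> s < i \<Longrightarrow> i \<le> k \<Longrightarrow> X i u = a *s u"
  shows "(\<Sum>i = Suc s..k. X i u) = (\<Sum>i = Suc s..k. a *s u)"
  using assms(1,3)
proof (induction j arbitrary: u)
  case 0
  then show ?case using exact by (intro sum.cong) auto
next
  case (Suc j)
  define f where "f v = (\<Sum>i = Suc s..k. X i v) - (\<Sum>i = Suc s..k. a *s v)" for v
  have lin: "lin f"
    by (simp add: lin_iff f_def sum.distrib scale_right_distrib scale_sum_right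
        scale_right_diff_distrib mult.commute)
  have comm: "f (T i v) = T i (f v)" if "s < i" "i < k" for i v
    using that assms(2) by (simp add: f_def sum_X_T flip: scale_sum_left)
  have "f u \<in> {0}"
  proof (rule Z_image[OF _ lin subspace_zero_set])
    show "u \<in> Z (Suc (s + j)) (Suc s) (kato s s j P)" using Suc.prems by simp
    fix l w assume l: "Suc s \<le> l" "w \<in> kato s s j P"
    have "f (Y (Suc (s + j)) l w) = Y (Suc (s + j)) l (f w)"
      using l Suc.prems by (intro Y_commute comm) auto
    also have "f w = 0" using Suc l by (simp add: f_def)
    finally show "f (Y (Suc (s + j)) l w) \<in> {0}" by simp
  qed
  then show ?case by (simp add: f_def)
qed

text \<open>
  The sum of the last \<^term>\<open>X i\<close> commutes with the last \<^term>\<open>T i\<close>, so it acts on \<open>v\<close> as on \<open>P\<close>.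
\<close>

lemma kato_last_exact:
  assumes "s < k" "k \<le> n" "v \<in> kato s s (k - s) P"
    and exact: "\<And>u i. u \<in> P \<Longrightarrow> s < i \<Longrightarrow> i \<le> k \<Longrightarrow> X i u = a *s u"
    and v: "\<And>i. s < i \<Longrightarrow> i < k \<Longrightarrow> X i v = a *s v"
  shows "X k v = a *s v"
proof -
  have I: "{Suc s..k} = insert k {Suc s..<k}" using assms(1) by auto
  have "(\<Sum>i = Suc s..k. X i v) = (\<Sum>i = Suc s..k. a *s v)"
    using sum_X_kato[of s "k - s" k v P a] assms by auto
  then show ?thesis using v unfolding I by simp
qed

lemma nil_kato:
  assumes "s + j \<le> k" "k \<le> n" "u \<in> kato s s j P" "s < i" "i \<le> k"
    and exact: "\<And>u i. u \<in> P \<Longrightarrow> s < i \<Longrightarrow> i \<le> k \<Longrightarrow> X i u = a *s u"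
  shows "nil a i u"
proof -
  let ?G = "{v. \<forall>i. s < i \<longrightarrow> i \<le> k \<longrightarrow> nil a i v}"
  have "nil a i (T m v)" if "v \<in> ?G" "s < m" "m < k" "s < i" "i \<le> k" for v m i
  proof -
    consider "i = m" | "i = Suc m" | "i \<noteq> m" "i \<noteq> Suc m" by blast
    then show ?thesis using that assms(2) by cases (auto simp: nil_T nil_T_pair)
  qed
  then have "stable s k 0 ?G"
    by (auto simp: stable_def subspace_def nil_add nil_scale)
  then have "kato s s j P \<subseteq> ?G"
    using exact assms(1) by (intro kato_subset) (auto intro: eigen_nil)
  then show ?thesis using assms by blast
qed

section \<open>Freeness of the Kato module\<close>

lemma Xm_power_T:
  assumes i: "1 \<le> i" "i < n" and w: "Xm i a w = 0"
  shows "(Xm i a ^^ Suc e) (T i w)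
    = T i ((Xm (Suc i) a ^^ Suc e) w) - (q - 1) *s X (Suc i) ((Xm (Suc i) a ^^ e) w)"
proof (induction e)
  case 0
  show ?case using i by (simp add: Xm_def X_T)
next
  case (Suc e)
  have comm: "Xm i a ((Xm (Suc i) a ^^ e) w) = (Xm (Suc i) a ^^ e) (Xm i a w)" for e
    by (induction e) (auto simp: Xm_Xm_comm[of i])
  \<comment> \<open>The correction produced by one step is killed by the next \<open>Xm i a\<close>,
    so only the last one survives.\<close>
  then have 0: "Xm i a (X (Suc i) ((Xm (Suc i) a ^^ e) w)) = 0"
    by (simp add: w lin_funpow_zero[OF linear_Xm] flip: X_Xm_comm)
  have "Xm i a (T i u) = T i (Xm (Suc i) a u) - (q - 1) *s X (Suc i) u" for u
    using i by (simp add: Xm_def X_T)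
  then show ?case
    unfolding funpow.simps(2)[of "Suc e" "Xm i a"] comp_def Suc.IH using 0 by simp
qed

text \<open>Each factor of the representative is removed by one power of \<open>Xm\<close>: the term
  with \<open>T (Suc s)\<close> vanishes because one power more kills \<open>u\<close>, and the
  Bernstein correction leaves the factor \<open>- (q - 1) * a\<close>. For
  \<open>q \<noteq> 1\<close> and \<open>a \<noteq> 0\<close> this is nonzero, which makes the Kato
  module free.\<close>

lemma Xm_power_Y:
  assumes "Suc (s + j) \<le> n"
    and "\<And>i. s < i \<Longrightarrow> i \<le> Suc (s + j) \<Longrightarrow> X i u = a *s u"
  shows "(Xm (Suc s) a ^^ j) (Y (Suc (s + j)) (Suc s) u) = (- (q - 1) * a) ^ j *s u"
  using assms
proof (induction j arbitrary: s)
  case (Suc j)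
  define w where "w = Y (Suc (s + Suc j)) (Suc (Suc s)) u"
  have "Xm (Suc s) a w = Y (Suc (s + Suc j)) (Suc (Suc s)) (Xm (Suc s) a u)"
    unfolding w_def by (simp add: Xm_def X_Y_outside)
  then have w: "Xm (Suc s) a w = 0" using Suc.prems(2)[of "Suc s"] by (simp add: Xm_def)
  have IH: "(Xm (Suc (Suc s)) a ^^ j) w = (- (q - 1) * a) ^ j *s u"
    using Suc.IH[of "Suc s"] Suc.prems by (simp add: w_def)
  have X: "X (Suc (Suc s)) u = a *s u" using Suc.prems(2) by simp
  have "(Xm (Suc s) a ^^ Suc j) (T (Suc s) w)
      = T (Suc s) ((Xm (Suc (Suc s)) a ^^ Suc j) w)
        - (q - 1) *s X (Suc (Suc s)) ((Xm (Suc (Suc s)) a ^^ j) w)"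
    using Suc.prems(1) w by (intro Xm_power_T) auto
  also have "\<dots> = (- (q - 1) * a) ^ Suc j *s u"
    using X by (simp add: IH Xm_def) (simp add: algebra_simps flip: scale_minus_left)
  finally show ?case by (simp add: Y_step w_def)
qed simp

text \<open>In the first layer \<open>X (Suc s)\<close> acts on the coefficient as the last
  generator, by the scalar \<open>a\<close>, up to the other layers; on those it commutes with the
  representative and the induction hypothesis applies. So each rank costs one further power.\<close>

lemma Xm_kato_nilpotent:
  assumes k: "Suc (s + j) \<le> n"
    and exact: "\<And>u i. u \<in> P \<Longrightarrow> s < i \<Longrightarrow> i \<le> n' \<Longrightarrow> X i u = a *s u"
    and P: "subspace P" and n': "Suc (s + j) \<le> n'" "n' \<le> n"
    and u: "u \<in> kato s s (Suc j) P"
  shows "(Xm (Suc s) a ^^ Suc j) u = 0"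
  using k u n'(1)
proof (induction j arbitrary: u)
  case 0
  have "subspace {u. Xm (Suc s) a u = 0}" by (auto simp: subspace_def)
  then have "Z (Suc s) (Suc s) P \<subseteq> {u. Xm (Suc s) a u = 0}"
    using exact 0 by (intro Z_subset) (auto simp: Xm_def)
  then show ?case using 0 by auto
next
  case (Suc j)
  let ?k = "Suc (s + Suc j)" and ?N = "kato s s (Suc j) P"
  have "stable s s s P" using P by (simp add: stable_def)
  then have st: "stable s (s + Suc j) ?k ?N"
    using stable_kato[of s s P "Suc j" ?k a] exact Suc.prems by auto
  have ze: "(Xm (Suc s) a ^^ Suc j) z = 0" if z: "z \<in> Z ?k (Suc (Suc s)) ?N" for z
  proof -
    have "(Xm (Suc s) a ^^ Suc j) z \<in> {0}"
    proof (rule Z_image[OF z lin_funpow[OF linear_Xm] subspace_zero_set])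
      fix l w assume l: "Suc (Suc s) \<le> l" "l \<le> ?k" "w \<in> ?N"
      have "(Xm (Suc s) a ^^ e) (Y ?k l w) = Y ?k l ((Xm (Suc s) a ^^ e) w)" for e
        using l by (induction e) (auto simp: Xm_def X_Y_outside)
      then show "(Xm (Suc s) a ^^ Suc j) (Y ?k l w) \<in> {0}"
        using Suc.IH[of w] Suc.prems l by (simp del: funpow.simps kato.simps)
    qed
    then show ?thesis by simp
  qed
  obtain u0 z where u0: "u0 \<in> ?N" and z: "z \<in> Z ?k (Suc (Suc s)) ?N"
    and u: "u = Y ?k (Suc s) u0 + z"
    using Z_split[of ?N "Suc s" ?k u] Suc.prems stable_subspace[OF st] by auto
  have "X ?k u0 = a *s u0"
    using kato_exact[of P ?k a s "Suc j" u0 s] exact u0 Suc.prems by auto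
  moreover have "X (Suc s) (Y ?k (Suc s) u0) - Y ?k (Suc s) (X (shift (Suc s) ?k (Suc s)) u0)
      \<in> Z ?k (Suc (Suc s)) ?N"
    using X_Y_triangular[of s ?k ?N "Suc s" "Suc s" u0] st u0 Suc.prems by auto
  ultimately have "Xm (Suc s) a (Y ?k (Suc s) u0) \<in> Z ?k (Suc (Suc s)) ?N"
    by (simp add: shift_def Xm_def)
  then have "(Xm (Suc s) a ^^ Suc (Suc j)) (Y ?k (Suc s) u0) = 0"
    using ze by (simp only: funpow_Suc_right comp_def)
  moreover have "(Xm (Suc s) a ^^ Suc (Suc j)) z = 0"
    using ze[OF z] by simp
  ultimately show ?case unfolding u by (simp only: lin_add[OF lin_funpow[OF linear_Xm]]) simp
qed

text \<open>
  Freeness: a relation in the Kato module gives one with a common eigenvector \<open>u\<close> as leading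
  coefficient, and a power of \<^term>\<open>Xm (Suc s) a\<close> turns it into a multiple of \<open>u\<close> being zero.
\<close>

lemma kato_free_first:
  assumes P: "subspace P" and k: "Suc (s + j) \<le> n" "1 \<le> j" and a: "a \<noteq> 0"
    and exact: "\<And>u i. u \<in> P \<Longrightarrow> s < i \<Longrightarrow> i \<le> Suc (s + j) \<Longrightarrow> X i u = a *s u"
    and u: "u \<in> kato s s j P"
      "Y (Suc (s + j)) (Suc s) u \<in> Z (Suc (s + j)) (Suc (Suc s)) (kato s s j P)"
  shows "u = 0"
proof (rule ccontr)
  assume "u \<noteq> 0"
  let ?k = "Suc (s + j)" and ?N = "kato s s j P"
  \<comment> \<open>The leading coefficients of relations that start in the first layer. To contain
    a common eigenvector, \<open>B\<close> must be closed under the \<open>X i\<close>; on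
    \<open>B\<close> the action of \<open>X i\<close> is read off from that of
    \<open>X (Suc i)\<close> on the relation.\<close>
  define B where "B = {u\<in>?N. Y ?k (Suc s) u \<in> Z ?k (Suc (Suc s)) ?N}"
  have "stable s s s P" using P by (simp add: stable_def)
  then have st: "stable s (s + j) ?k ?N"
    using stable_kato[of s s P j ?k a] exact k by auto
  have Xk: "X ?k v = a *s v" if "v \<in> ?N" for v
    using kato_exact[of P ?k a s j v s] exact that by auto
  have subB: "subspace B"
    using subspace_Z[of ?k "Suc (Suc s)" ?N] stable_subspace[OF st] by (auto simp: subspace_def B_def)
  have XB: "X i v \<in> B" if i: "s < i" "i \<le> ?k" and v: "v \<in> B" for i v
  proof (cases "i = ?k")
    case True
    then show ?thesis using v Xk subspace_scale[OF subB] by (auto simp: B_def)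
  next
    case False
    have vN: "v \<in> ?N" "Y ?k (Suc s) v \<in> Z ?k (Suc (Suc s)) ?N" using v by (auto simp: B_def)
    have "X (Suc i) (Y ?k (Suc s) v) - Y ?k (Suc s) (X (shift (Suc s) ?k (Suc i)) v)
      \<in> Z ?k (Suc (Suc s)) ?N"
      using i False vN st k by (intro X_Y_triangular) auto
    moreover have "X (Suc i) (Y ?k (Suc s) v) \<in> Z ?k (Suc (Suc s)) ?N"
      using i False vN st k by (intro X_Z[of s]) auto
    ultimately have "X (Suc i) (Y ?k (Suc s) v)
        - (X (Suc i) (Y ?k (Suc s) v) - Y ?k (Suc s) (X (shift (Suc s) ?k (Suc i)) v))
        \<in> Z ?k (Suc (Suc s)) ?N"
      by (rule subspace_diff[OF subspace_Z, rotated])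
    then have "Y ?k (Suc s) (X i v) \<in> Z ?k (Suc (Suc s)) ?N"
      using i by (simp add: shift_def)
    moreover have "X i v \<in> ?N" using stable_X[OF st] i vN by auto
    ultimately show ?thesis by (simp add: B_def)
  qed
  have nilB: "nil a i v" if "s < i" "i \<le> ?k" "v \<in> B" for i v
    using that nil_kato[of s j ?k v P i a] exact k by (auto simp: B_def)
  have "\<exists>v\<in>B. v \<noteq> 0 \<and> (\<forall>i\<in>{s<..?k}. X i v = a *s v)"
  proof (rule common_eigenvector)
    show "B \<noteq> {0}" using u \<open>u \<noteq> 0\<close> by (auto simp: B_def)
  qed (use subB XB nilB in auto)
  then obtain v where v: "v \<in> B" "v \<noteq> 0" "\<forall>i\<in>{s<..?k}. X i v = a *s v" by blast
  have "(Xm (Suc s) a ^^ j) (Y ?k (Suc s) v) = (- (q - 1) * a) ^ j *s v"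
    using k v(3) by (intro Xm_power_Y) auto
  \<comment> \<open>The same power kills the other layers: it passes through their representatives
    and annihilates \<open>?N\<close>, where the nilpotency exponent is only
    \<open>j\<close>.\<close>
  moreover have "(Xm (Suc s) a ^^ j) (Y ?k (Suc s) v) \<in> {0}"
  proof (rule Z_image[OF _ lin_funpow[OF linear_Xm] subspace_zero_set])
    show "Y ?k (Suc s) v \<in> Z ?k (Suc (Suc s)) ?N" using v by (simp add: B_def)
    fix l w assume l: "Suc (Suc s) \<le> l" "l \<le> ?k" "w \<in> ?N"
    obtain j' where j': "j = Suc j'" using k by (cases j) auto
    have "(Xm (Suc s) a ^^ e) (Y ?k l w) = Y ?k l ((Xm (Suc s) a ^^ e) w)" for e
      using l by (induction e) (auto simp: Xm_def X_Y_outside)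
    moreover have "(Xm (Suc s) a ^^ j) w = 0"
      using Xm_kato_nilpotent[of s j' P ?k a w] exact l P k j' by auto
    ultimately show "(Xm (Suc s) a ^^ j) (Y ?k l w) \<in> {0}" by simp
  qed
  ultimately show False using v(2) a q_ne_1 by simp
qed

lemma Y_append: "j \<le> l \<Longrightarrow> l \<le> k \<Longrightarrow> Y l j (Y k l v) = Y k j v"
  unfolding Y_def by (metis foldr_append comp_apply upt_add_eq_append le_add_diff_inverse)

text \<open>Multiplying a relation with leading layer \<open>l\<close> on the left by
  \<open>T (Suc s) ... T (l - 1)\<close> gives one with leading layer \<open>Suc s\<close>: these
  letters complete the representative of layer \<open>l\<close> to that of layer
  \<open>Suc s\<close> and commute with the representatives of all later layers.\<close>

lemma kato_free:
  assumes P: "subspace P" and k: "Suc (s + j) \<le> n" and a: "a \<noteq> 0"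
    and exact: "\<And>u i. u \<in> P \<Longrightarrow> s < i \<Longrightarrow> i \<le> Suc (s + j) \<Longrightarrow> X i u = a *s u"
    and l: "s < l" "l \<le> s + j"
    and u: "u \<in> kato s s j P" "Y (Suc (s + j)) l u \<in> Z (Suc (s + j)) (Suc l) (kato s s j P)"
  shows "u = 0"
proof (rule kato_free_first[OF P k _ a exact u(1)])
  let ?k = "Suc (s + j)" and ?N = "kato s s j P"
  have "stable s s s P" using P by (simp add: stable_def)
  then have st: "stable s (s + j) ?k ?N"
    using stable_kato[of s s P j ?k a] exact k by auto
  have "Y ?k (Suc s) u = Y l (Suc s) (Y ?k l u)"
    using l by (simp add: Y_append)
  moreover have "Y l (Suc s) (Y ?k l u) \<in> Z ?k (Suc l) ?N"
  proof (rule Z_image[OF u(2) linear_Y subspace_Z])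
    fix l' w assume l': "Suc l \<le> l'" "l' \<le> ?k" "w \<in> ?N"
    have "Y l (Suc s) (Y ?k l' w) = Y ?k l' (Y l (Suc s) w)"
      by (rule Y_commute[symmetric]) (use l' in \<open>auto simp: T_Y_below\<close>)
    moreover have "Y l (Suc s) w \<in> ?N" using l l' by (intro stable_Y[OF st]) auto
    ultimately show "Y l (Suc s) (Y ?k l' w) \<in> Z ?k (Suc l) ?N" using l' by (auto intro: Y_in_Z)
  qed
  ultimately show "Y ?k (Suc s) u \<in> Z ?k (Suc (Suc s)) ?N"
    using Z_mono[of "Suc (Suc s)" "Suc l" ?N ?N ?k] l by auto
qed (use l in auto)

text \<open>Seen in the Kato module over \<open>E\<close>, the vector \<open>v\<close> lies in the
  last layer, whose representative is the identity. Freeness over \<open>E\<close> makes its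
  coefficients over \<open>P\<close> in all earlier layers vanish, and this lowers the rank until
  only \<open>P\<close> is left.\<close>

lemma kato_Int_exact:
  assumes E: "subspace E" and k: "s \<le> k" "k \<le> n" and a: "a \<noteq> 0"
    and exact: "\<And>u i. u \<in> E \<Longrightarrow> s < i \<Longrightarrow> i \<le> k \<Longrightarrow> X i u = a *s u"
    and P: "subspace P" "P \<subseteq> E" and v: "v \<in> E" "v \<in> kato s s (k - s) P"
  shows "v \<in> P"
proof -
  have "v \<in> kato s s j P \<Longrightarrow> v \<in> P" if "s + j \<le> k" for j
    using that
  proof (induction j)
    case (Suc j)
    let ?k = "Suc (s + j)" and ?N = "kato s s j P" and ?M = "kato s s j E"
    have "stable s s s P" using P by (simp add: stable_def)
    then have subN: "subspace ?N"
      using stable_kato[of s s P j ?k a] exact k P Suc.prems stable_subspace by fastforce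
    have vM: "v \<in> Z ?k l ?M" if "l \<le> ?k" for l
      using Y_in_Z[OF that order_refl, of v ?M] kato_base[of s s E j] v(1) by auto
    have "v \<in> Z ?k l ?N" if "Suc s \<le> l" "l \<le> ?k" for l
      using that
    proof (induction l rule: dec_induct)
      case base
      show ?case using Suc.prems by simp
    next
      case (step l)
      have l: "s < l" "l \<le> s + j" using step by auto
      obtain u z where u: "u \<in> ?N" "z \<in> Z ?k (Suc l) ?N" "v = Y ?k l u + z"
        using Z_split[OF subN, of l ?k v] step by auto
      have NM: "?N \<subseteq> ?M" using kato_mono P(2) by blast
      have "Y ?k l u = v - z" using u by simp
      also have "v - z \<in> Z ?k (Suc l) ?M"
        using vM[of "Suc l"] u(2) l Z_mono[OF order_refl NM, of ?k "Suc l"]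
        by (intro subspace_diff[OF subspace_Z]) auto
      finally have "u = 0"
        using kato_free[of E s j a l u] E Suc.prems k a exact l u(1) NM by auto
      then show ?case using u by simp
    qed
    then have "v \<in> Z ?k ?k ?N" by simp
    moreover have "Z ?k ?k ?N \<subseteq> ?N" using subN by (intro Z_subset) auto
    ultimately show ?case using Suc by auto
  qed simp
  from this[of "k - s"] show ?thesis using v(2) k by simp
qed

subsection \<open>The socle of the generalised eigenspace\<close>

lemma subspace_Exact: "subspace S \<Longrightarrow> subspace (Exact c s k S)"
  by (auto simp: subspace_def Exact_def scale_right_distrib scale_left_commute)

lemma sub_Exact:
  assumes "sub k S" "s \<le> k" "k \<le> k'"
  shows "sub s (Exact c s k' S)"
  unfolding sub_def stable_def
proof (intro conjI allI impI)
  show "subspace (Exact c s k' S)" using subspace_Exact sub_subspace assms by blast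
  show "Exact c s k' S \<subseteq> V" using sub_V[OF assms(1)] by (auto simp: Exact_def)
  fix i :: nat and v assume i: "0 < i"
  show "T i v \<in> Exact c s k' S" if "i < s" "v \<in> Exact c s k' S"
    using i that assms stable_T[OF sub_stable[OF assms(1)]] by (auto simp: Exact_def simp flip: TX_comm)
  show "X i v \<in> Exact c s k' S" if "i \<le> s" "v \<in> Exact c s k' S"
    using i that assms stable_X[OF sub_stable[OF assms(1)]] by (auto simp: Exact_def X_comm[of _ i])
qed

lemma Exact_nonzero:
  assumes S: "sub k S" and T: "Tail c s k S \<noteq> {0}"
  shows "Exact c s k S \<noteq> {0}"
proof -
  have "\<exists>v\<in>Tail c s k S. v \<noteq> 0 \<and> (\<forall>i\<in>{s<..k}. X i v = c *s v)"
  proof (rule common_eigenvector)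
    show "X i v \<in> Tail c s k S" if "i \<in> {s<..k}" "v \<in> Tail c s k S" for i v
      using that stable_X[OF sub_stable[OF S]] by (auto simp: Tail_def nil_X)
  qed (use T subspace_Tail[OF sub_subspace[OF S]] in \<open>auto simp: Tail_def\<close>)
  then show ?thesis by (auto simp: Tail_def Exact_def)
qed

text \<open>The least \<open>s\<close> gives the longest tail. The conclusion with
  \<open>nil a k v\<close> asks only for a generalised eigenvalue at \<open>k\<close>, which is all
  that a vector of the eigenspace offers. The last conclusion forces any two nonzero submodules of
  the eigenspace to intersect.\<close>

theorem simple_core:
  assumes S: "simple k S" and k: "1 \<le> k" "k \<le> n" and a: "a \<noteq> 0"
    and T: "Tail a (k - 1) k S \<noteq> {0}"
  obtains s where "s < k" "Tail a s k S \<noteq> {0}" "Exact a s k S \<noteq> {0}"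
    and "\<And>v. v \<in> S \<Longrightarrow> (\<And>i. s < i \<Longrightarrow> i < k \<Longrightarrow> X i v = a *s v) \<Longrightarrow> nil a k v \<Longrightarrow> v \<in> Exact a s k S"
    and "\<And>N. sub (k - 1) N \<Longrightarrow> N \<noteq> {0} \<Longrightarrow> N \<subseteq> S \<Longrightarrow> (\<And>v. v \<in> N \<Longrightarrow> nil a k v) \<Longrightarrow> Exact a s k S \<subseteq> N"
proof -
  define s where "s = (LEAST s. Tail a s k S \<noteq> {0})"
  have Ts: "Tail a s k S \<noteq> {0}" unfolding s_def by (rule LeastI[of _ "k - 1"]) (rule T)
  have "s \<le> k - 1" unfolding s_def by (rule Least_le) (rule T)
  then have s: "s < k" using k by simp
  have low: "s = 0 \<or> Tail a (s - 1) k S \<subseteq> {0}"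
    using not_less_Least[of "s - 1" "\<lambda>s. Tail a s k S \<noteq> {0}"] by (auto simp flip: s_def)
  note Ssub = simple_sub[OF S]
  define E where "E = Exact a s k S"
  have Esub: "sub s E" unfolding E_def using sub_Exact[OF Ssub] s by simp
  have E0: "E \<noteq> {0}" unfolding E_def by (rule Exact_nonzero[OF Ssub Ts])
  have exact: "X i u = a *s u" if "u \<in> E" "s < i" "i \<le> k" for u i
    using that by (auto simp: E_def Exact_def)
  have core: "v \<in> E" if v: "v \<in> S" "\<And>i. s < i \<Longrightarrow> i < k \<Longrightarrow> X i v = a *s v" "nil a k v" for v
  proof -
    have "v \<in> Tail a s k S"
      using v by (auto simp: Tail_def le_less intro: eigen_nil)
    then have "v \<in> kato s s (k - s) E"
      using Tail_subset_kato[OF S _ k(2) low Esub] E0 s by (auto simp: E_def)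
    then have "X k v = a *s v" using kato_last_exact[OF s k(2)] exact v(2) by blast
    then show ?thesis using v by (auto simp: E_def Exact_def le_less)
  qed
  have "E \<subseteq> N" if N: "sub (k - 1) N" "N \<noteq> {0}" "N \<subseteq> S" "\<And>v. v \<in> N \<Longrightarrow> nil a k v" for N
  proof
    fix v assume v: "v \<in> E"
    \<comment> \<open>Rank \<open>k - 1\<close> sees only the generators up to \<open>k - 1\<close>;
      \<open>core\<close> supplies the eigenvalue of \<open>X k\<close>.\<close>
    define D where "D = Exact a s (k - 1) N"
    have "Tail a s (k - 1) N \<noteq> {0}"
      using Tail_gen_same[OF k N(1)] Ts gen_simple[OF S N(1,3,2) k] by simp
    then have D0: "D \<noteq> {0}" unfolding D_def by (rule Exact_nonzero[OF N(1)])
    have Dsub: "sub s D" unfolding D_def using sub_Exact[OF N(1)] s by simp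
    have DE: "D \<subseteq> E" using N core s by (auto simp: D_def Exact_def)
    have "v \<in> Tail a s k S" using v by (auto simp: E_def Exact_def Tail_def intro: eigen_nil)
    then have "v \<in> kato s s (k - s) D"
      using Tail_subset_kato[OF S _ k(2) low Dsub] DE D0 s by (auto simp: E_def)
    then have "v \<in> D"
      using exact kato_Int_exact[OF sub_subspace[OF Esub] less_imp_le[OF s] k(2) a _
          sub_subspace[OF Dsub] DE v] by blast
    then show "v \<in> N" by (simp add: D_def Exact_def)
  qed
  then show ?thesis using that[of s] s Ts E0 core unfolding E_def by blast
qed

subsection \<open>Intertwiners\<close>

text \<open>The usual intertwining element with denominators cleared. The second summand cancels the
  Bernstein corrections, so that \<open>Phi i\<close> exchanges \<open>X i\<close> and
  \<open>X (Suc i)\<close> exactly.\<close>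

definition Phi :: "nat \<Rightarrow> 'b \<Rightarrow> 'b" where
  "Phi i v = T i (X i v - X (Suc i) v) + (q - 1) *s X (Suc i) v"

lemma linear_Phi: "lin (Phi i)"
  by (simp add: lin_iff Phi_def scale_right_distrib scale_right_diff_distrib mult.commute
      algebra_simps)

lemmas Phi_simps [simp] = lin_add[OF linear_Phi] lin_scale[OF linear_Phi] lin_zero[OF linear_Phi]
  lin_diff[OF linear_Phi]

lemma X_Suc_Phi: "1 \<le> i \<Longrightarrow> i < n \<Longrightarrow> X (Suc i) (Phi i v) = Phi i (X i v)"
  by (simp add: Phi_def X_Suc_T scale_right_diff_distrib X_comm[of i "Suc i"])

lemma X_Phi: "1 \<le> i \<Longrightarrow> i < n \<Longrightarrow> X i (Phi i v) = Phi i (X (Suc i) v)"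
  by (simp add: Phi_def X_T scale_right_diff_distrib X_comm[of i "Suc i"])

lemma X_Phi_other: "j \<noteq> i \<Longrightarrow> j \<noteq> Suc i \<Longrightarrow> X j (Phi i v) = Phi i (X j v)"
  by (simp add: Phi_def X_comm[of j] flip: TX_comm)

text \<open>Before \<open>X i\<close> is specialised to \<open>b\<close>, the square is the product
  of q X_(i+1) - X_i and q X_i - X_(i+1). Hence the roots \<open>q * b\<close> and
  \<open>b / q\<close>, the two weights at which the intertwiner degenerates.\<close>

lemma Phi_Phi:
  assumes i: "1 \<le> i" "i < n" and v: "X i v = b *s v"
  shows "Phi i (Phi i v) = (- q) *s Xm (Suc i) (q * b) (Xm (Suc i) (b / q) v)"
proof -
  define x where "x = X (Suc i)"
  have xs: "x (u + w) = x u + x w" "x (c *s u) = c *s x u" "x (u - w) = x u - x w" for c u w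
    by (simp_all add: x_def)
  have Xi: "X i (x v) = b *s x v" "X i (x (x v)) = b *s x (x v)"
    by (simp_all add: x_def X_comm[of i "Suc i"] v)
  have T2: "T i (T i w) = (q - 1) *s T i w + q *s w" for w using i by (rule T_quad)
  have XT: "X i (T i w) = T i (x w) - (q - 1) *s x w" "x (T i w) = T i (X i w) + (q - 1) *s x w" for w
    using i by (simp_all add: X_T X_Suc_T x_def)
  have "Phi i (Phi i v) = ((q - 1) * (q - 1) * b) *s x v
      - q *s ((b * b) *s v - (2 * b) *s x v + x (x v))"
    unfolding Phi_def x_def[symmetric]
    by (simp add: xs XT Xi v T2 scale_right_distrib scale_right_diff_distrib
        scale_left_diff_distrib scale_left_distrib algebra_simps)
  also have "\<dots> = (- q) *s Xm (Suc i) (q * b) (Xm (Suc i) (b / q) v)"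
  proof -
    have "((q - 1) * (q - 1) * b) *s x v = (q * q * b + b) *s x v - (2 * q * b) *s x v"
      unfolding scale_left_diff_distrib[symmetric]
      by (rule arg_cong[where f = "\<lambda>c. c *s x v"]) (simp add: algebra_simps)
    then show ?thesis
      using q_nz unfolding Xm_def x_def[symmetric]
      by (simp add: xs scale_right_distrib scale_right_diff_distrib scale_left_distrib
          scale_minus_left algebra_simps)
  qed
  finally show ?thesis .
qed

lemma Phi_closed:
  assumes "sub (Suc i) S" "1 \<le> i" "v \<in> S"
  shows "Phi i v \<in> S"
  unfolding Phi_def using assms stable_X[OF sub_stable[OF assms(1)]]
  by (intro subspace_add subspace_scale sub_subspace[OF assms(1)] subspace_diff
      stable_T[OF sub_stable[OF assms(1)]]) auto

lemma nil_Phi: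
  assumes "1 \<le> i" "i < n" "nil a (Suc i) v"
  shows "nil a i (Phi i v)"
  using assms(3)
proof (induction rule: nil_induct)
  case (step v)
  have "Xm i a (Phi i v) = Phi i (Xm (Suc i) a v)"
    using assms by (simp add: Xm_def X_Phi)
  then show ?case using step.IH by (metis nil_Xm_iff)
qed simp

text \<open>The last two alternatives are the zeros in \<open>Phi_Phi\<close>; equality is included
  so that unlinked weights are distinct.\<close>

definition linked :: "'f \<Rightarrow> 'f \<Rightarrow> bool" where
  "linked a b \<longleftrightarrow> a = b \<or> a = q * b \<or> b = q * a"

lemma linked_sym: "linked a b \<longleftrightarrow> linked b a"
  by (auto simp: linked_def)

text \<open>A chain of \<open>p\<close> intertwiners carries the weight \<open>a\<close> down from
  \<open>Suc t\<close> past the \<open>b\<close>'s. The \<open>b\<close>'s have to be exact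
  eigenvalues for \<open>Phi_Phi\<close>, whereas \<open>a\<close> may be generalised. Invertibility
  is recorded as an equivalence of membership; taking the zero module for \<open>S\<close> shows
  that \<open>w\<close> vanishes only with \<open>v\<close>.\<close>

lemma move_weight:
  assumes ab: "\<not> linked a b"
  shows "p \<le> t \<Longrightarrow> Suc t \<le> n \<Longrightarrow> nil a (Suc t) v \<Longrightarrow>
    (\<And>i. t - p < i \<Longrightarrow> i \<le> t \<Longrightarrow> X i v = b *s v) \<Longrightarrow>
    \<exists>w. (\<forall>i. Suc (t - p) < i \<longrightarrow> i \<le> Suc t \<longrightarrow> X i w = b *s w) \<and>
      (\<forall>i c. Suc t < i \<longrightarrow> (X i v = c *s v \<longrightarrow> X i w = c *s w) \<and> (nil c i v \<longrightarrow> nil c i w)) \<and>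
      (\<forall>S. sub (Suc t) S \<longrightarrow> (w \<in> S \<longleftrightarrow> v \<in> S))"
proof (induction p arbitrary: t v)
  case 0
  then show ?case by (intro exI[of _ v]) auto
next
  case (Suc p)
  then obtain t' where t: "t = Suc t'" by (cases t) auto
  have tn: "1 \<le> t" "t < n" using Suc.prems t by auto
  define u where "u = Phi t v"
  have Xt: "X t v = b *s v" using Suc.prems by simp
  have u_above: "X i u = c *s u" if "Suc t < i" "X i v = c *s v" for i c
    using that by (simp add: u_def X_Phi_other)
  have nil_above: "nil c i u" if "Suc t < i" "nil c i v" for i c
    unfolding u_def using that by (intro nil_comm[OF linear_Phi]) (auto simp: X_Phi_other)
  have Xu: "X (Suc t) u = b *s u" using tn Xt by (simp add: u_def X_Suc_Phi)
  have "\<exists>w. (\<forall>i. Suc (t' - p) < i \<longrightarrow> i \<le> Suc t' \<longrightarrow> X i w = b *s w) \<and>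
      (\<forall>i c. Suc t' < i \<longrightarrow> (X i u = c *s u \<longrightarrow> X i w = c *s w) \<and> (nil c i u \<longrightarrow> nil c i w)) \<and>
      (\<forall>S. sub (Suc t') S \<longrightarrow> (w \<in> S \<longleftrightarrow> u \<in> S))"
  proof (rule Suc.IH)
    show "nil a (Suc t') u" using nil_Phi[OF tn] Suc.prems t by (simp add: u_def)
    show "X i u = b *s u" if "t' - p < i" "i \<le> t'" for i
      using that Suc.prems(4)[of i] t by (simp add: u_def X_Phi_other)
  qed (use Suc.prems t in auto)
  then obtain w where w: "\<forall>i. Suc (t' - p) < i \<longrightarrow> i \<le> Suc t' \<longrightarrow> X i w = b *s w"
    "\<forall>i c. Suc t' < i \<longrightarrow> (X i u = c *s u \<longrightarrow> X i w = c *s w) \<and> (nil c i u \<longrightarrow> nil c i w)"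
    "\<forall>S. sub (Suc t') S \<longrightarrow> (w \<in> S \<longleftrightarrow> u \<in> S)" by blast
  have "w \<in> S \<longleftrightarrow> v \<in> S" if S: "sub (Suc t) S" for S
  proof -
    have "w \<in> S \<longleftrightarrow> u \<in> S" using w(3) sub_mono[OF S, of "Suc t'"] t by auto
    also have "u \<in> S \<longleftrightarrow> v \<in> S"
    proof
      assume "u \<in> S"
      then have "Phi t u \<in> S" using Phi_closed[OF S] tn by simp
      then have "(- inverse q) *s Phi t u \<in> S" using subspace_scale[OF sub_subspace[OF S]] by blast
      then have *: "Xm (Suc t) (q * b) (Xm (Suc t) (b / q) v) \<in> S"
        unfolding u_def Phi_Phi[OF tn Xt] using q_nz by simp
      \<comment> \<open>Both roots differ from \<open>a\<close> because the weights are unlinked, so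
        the two factors can be cancelled in turn.\<close>
      have ne: "q * b \<noteq> a" "b / q \<noteq> a" using ab q_nz by (auto simp: linked_def field_simps)
      have X: "X (Suc t) y \<in> S" if "y \<in> S" for y
        using stable_X[OF sub_stable[OF S]] that by auto
      have "Xm (Suc t) (b / q) v \<in> S"
        using Xm_cancel[OF _ ne(1) * sub_subspace[OF S] X] nil_Xm Suc.prems(3) by blast
      then show "v \<in> S"
        using Xm_cancel[OF _ ne(2) _ sub_subspace[OF S] X] Suc.prems(3) by blast
    qed (use Phi_closed[OF S] tn in \<open>simp add: u_def\<close>)
    finally show ?thesis .
  qed
  moreover have "X i w = b *s w" if "Suc (t - Suc p) < i" "i \<le> Suc t" for i
    using that w(1,2) Xu t by (cases "i = Suc t") auto
  ultimately show ?case using w(2) u_above nil_above t by (intro exI[of _ w]) auto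
qed

text \<open>
  Moving the weight \<open>a\<close> down past all \<open>b\<close>'s lands among the common eigenvectors that every
  nonzero submodule of \<open>e\<^sub>b M\<close>, in particular \<open>R\<close>, contains.
\<close>

lemma meets_socle:
  assumes M: "simple k M" and k: "2 \<le> k" "k \<le> n" and ab: "\<not> linked a b" and b: "b \<noteq> 0"
    and R: "simple (k - 1) R" "R \<subseteq> M" "\<And>v. v \<in> R \<Longrightarrow> nil b k v"
    and N: "sub (k - 2) N" "N \<noteq> {0}" "N \<subseteq> M"
    and nilN: "\<And>v. v \<in> N \<Longrightarrow> nil a (k - 1) v" "\<And>v. v \<in> N \<Longrightarrow> nil b k v"
  shows "\<exists>v\<in>N. v \<in> R \<and> v \<noteq> 0"
proof -
  note Msub = simple_sub[OF M]
  have k1: "1 \<le> k" using k by simp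
  have kk: "k - 1 - 1 = k - 2" "1 \<le> k - 1" "k - 1 \<le> n" using k by auto
  obtain r where r: "r \<in> R" "r \<noteq> 0"
    using simple_nonzero[OF R(1)] sub_zero_mem[OF simple_sub[OF R(1)]] by blast
  have "r \<in> Tail b (k - 1) k M" using r R k by (auto simp: Tail_def le_Suc_eq dest: le_antisym)
  then have T: "Tail b (k - 1) k M \<noteq> {0}" using r by auto
  obtain s where s: "s < k" "Tail b s k M \<noteq> {0}"
    and core: "\<And>v. v \<in> M \<Longrightarrow> (\<And>i. s < i \<Longrightarrow> i < k \<Longrightarrow> X i v = b *s v) \<Longrightarrow> nil b k v \<Longrightarrow> v \<in> Exact b s k M"
    and least: "\<And>N. sub (k - 1) N \<Longrightarrow> N \<noteq> {0} \<Longrightarrow> N \<subseteq> M \<Longrightarrow> (\<And>v. v \<in> N \<Longrightarrow> nil b k v) \<Longrightarrow> Exact b s k M \<subseteq> N"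
    using simple_core[OF M k1 k(2) b T] by metis
  have ER: "Exact b s k M \<subseteq> R" using least[OF simple_sub[OF R(1)] simple_nonzero[OF R(1)] R(2,3)] .
  define N1 where "N1 = gen (k - 1) N"
  have N1: "sub (k - 1) N1" unfolding N1_def using sub_gen[of "k - 1" N] N(1) kk by simp
  have NN1: "N \<subseteq> N1" unfolding N1_def using subset_gen kk by simp
  have N1M: "N1 \<subseteq> M"
    unfolding N1_def using N(3) stable_mono[OF sub_stable[OF Msub]] kk by (intro gen_minimal) auto
  have N10: "N1 \<noteq> {0}" using NN1 N(1,2) sub_zero_mem by blast
  \<comment> \<open>The tail on \<open>s + 1, ..., k\<close> in \<open>M\<close> loses one index on
    passing to \<open>N1\<close> and none on passing to \<open>N\<close>, where
    \<open>X (k - 1)\<close> has weight \<open>a\<close>. In \<open>N\<close> it occupies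
    \<open>s, ..., k - 2\<close>, which makes \<open>p\<close> weights \<open>b\<close>; for
    \<open>s = k - 1\<close> there are none.\<close>
  define p where "p = k - 1 - s"
  obtain v where v: "v \<in> N" "v \<noteq> 0" "\<And>i. k - 2 - p < i \<Longrightarrow> i \<le> k - 2 \<Longrightarrow> X i v = b *s v"
    and p: "p \<le> k - 2"
  proof (cases "s = k - 1")
    case True
    obtain v where "v \<in> N" "v \<noteq> 0" using N(1,2) sub_zero_mem by blast
    then show ?thesis using True that by (simp add: p_def)
  next
    case False
    have "Tail b s (k - 1) N1 \<noteq> {0}"
      using Tail_gen_same[OF k1 k(2) N1] s(2) gen_simple[OF M N1 N1M N10 k1 k(2)] by simp
    then have *: "1 \<le> s \<and> Tail b (s - 1) (k - 2) N \<noteq> {0}"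
      using Tail_gen_other[OF kk(2,3), of N b s a] N(1) nilN(1) s(1) False ab
      unfolding N1_def kk(1) by (auto simp: linked_def)
    then have "Exact b (s - 1) (k - 2) N \<noteq> {0}" using Exact_nonzero[OF N(1)] by blast
    then obtain v where "v \<in> Exact b (s - 1) (k - 2) N" "v \<noteq> 0"
      using subspace_0[OF subspace_Exact[OF sub_subspace[OF N(1)]]] by blast
    moreover have "k - 2 - p = s - 1" "p \<le> k - 2" using * s(1) False by (auto simp: p_def)
    ultimately show ?thesis using that[of v] by (auto simp: Exact_def)
  qed
  have t: "Suc (k - 2) = k - 1" "Suc (k - 2) \<le> n" using k by auto
  have "nil a (Suc (k - 2)) v" using nilN v(1) t by simp
  \<comment> \<open>Moving \<open>a\<close> down raises the \<open>b\<close>'s by one, to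
    \<open>s + 1, ..., k - 1\<close>; with the generalised weight \<open>b\<close> at
    \<open>k\<close> this is what \<open>core\<close> asks for.\<close>
  from move_weight[OF ab p t(2) this v(3)] obtain w
    where w: "\<forall>i. Suc (k - 2 - p) < i \<longrightarrow> i \<le> k - 1 \<longrightarrow> X i w = b *s w"
      "\<forall>i c. k - 1 < i \<longrightarrow> nil c i v \<longrightarrow> nil c i w" "\<forall>S. sub (k - 1) S \<longrightarrow> (w \<in> S \<longleftrightarrow> v \<in> S)"
    unfolding t by blast
  have "w \<in> M" using w(3) sub_mono[OF Msub, of "k - 1"] v(1) N(3) by auto
  moreover have "X i w = b *s w" if "s < i" "i < k" for i
    using w(1) that p s(1) by (simp add: p_def)
  moreover have "nil b k w" using w(2) nilN(2)[OF v(1)] k by simp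
  ultimately have "w \<in> R" using core ER by blast
  then show ?thesis using w(3) simple_sub[OF R(1)] v by blast
qed

subsection \<open>Iterated generalised eigenspaces\<close>

definition ef :: "nat \<Rightarrow> 'f \<Rightarrow> 'b set \<Rightarrow> 'b set" where
  "ef k c S = (if k = 0 then {0} else {v\<in>S. nil c k v})"

lemma ef_mono: "S \<subseteq> S' \<Longrightarrow> ef k c S \<subseteq> ef k c S'"
  by (auto simp: ef_def)

lemma ef_subset: "sub k S \<Longrightarrow> ef k c S \<subseteq> S"
  using sub_zero_mem by (auto simp: ef_def)

lemma ef_eq_Tail: "1 \<le> k \<Longrightarrow> ef k c S = Tail c (k - 1) k S"
  by (auto simp: ef_def Tail_def dest: le_antisym)

lemma sub_ef:
  assumes "sub k S"
  shows "sub (k - 1) (ef k c S)"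
proof (cases "k = 0")
  case True
  then show ?thesis using sub_zero_mem[OF assms] sub_V[OF assms]
    by (auto simp: ef_def sub_def stable_zero)
next
  case False
  have "stable 0 (k - 1) (k - 1) (ef k c S)"
    unfolding stable_def
  proof (intro conjI allI impI)
    show "subspace (ef k c S)"
      using False sub_subspace[OF assms] by (auto simp: ef_def subspace_def nil_add nil_scale)
    fix i :: nat and v assume i: "0 < i" and v: "v \<in> ef k c S"
    show "T i v \<in> ef k c S" if "i < k - 1"
      using that i v stable_T[OF sub_stable[OF assms], of i v] by (auto simp: ef_def nil_T)
    show "X i v \<in> ef k c S" if "i \<le> k - 1"
      using that i v stable_X[OF sub_stable[OF assms], of i v] by (auto simp: ef_def nil_X)
  qed
  then show ?thesis using ef_subset[OF assms] sub_V[OF assms] by (auto simp: sub_def)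
qed

fun ef_pow :: "nat \<Rightarrow> nat \<Rightarrow> 'f \<Rightarrow> 'f \<Rightarrow> 'b set \<Rightarrow> 'b set" where
  "ef_pow 0 k a b S = S"
| "ef_pow (Suc m) k a b S = ef_pow m (k - 2) a b (ef (k - 1) a (ef k b S))"

lemma ef_pow_mono: "S \<subseteq> S' \<Longrightarrow> ef_pow m k a b S \<subseteq> ef_pow m k a b S'"
proof (induction m arbitrary: k S S')
  case (Suc m)
  show ?case using Suc.IH[OF ef_mono[OF ef_mono[OF Suc.prems]]] by simp
qed simp

lemma sub_ef_ef: "sub k S \<Longrightarrow> sub (k - 2) (ef (k - 1) a (ef k b S))"
  using sub_ef[OF sub_ef, of k S] by (simp add: numeral_2_eq_2)

lemma sub_ef_pow: "sub k S \<Longrightarrow> sub (k - 2 * m) (ef_pow m k a b S)"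
proof (induction m arbitrary: k S)
  case (Suc m)
  show ?case using Suc.IH[OF sub_ef_ef[OF Suc.prems]] by simp
qed simp

lemma ef_pow_weights:
  assumes "v \<in> ef_pow m k a b S" "v \<noteq> 0"
  shows "2 * m \<le> k \<and> v \<in> S \<and> (\<forall>j<2 * m. nil (if even j then b else a) (k - j) v)"
  using assms(1)
proof (induction m arbitrary: k S)
  case (Suc m)
  then have "v \<in> ef_pow m (k - 2) a b (ef (k - 1) a (ef k b S))" by simp
  from Suc.IH[OF this] have IH: "2 * m \<le> k - 2" "v \<in> ef (k - 1) a (ef k b S)"
    "\<And>j. j < 2 * m \<Longrightarrow> nil (if even j then b else a) (k - 2 - j) v" by blast+
  have k: "k \<noteq> 0" "k - 1 \<noteq> 0" using IH(2) assms(2) by (auto simp: ef_def split: if_splits)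
  have v: "v \<in> S" "nil b k v" "nil a (k - 1) v" using IH(2) k by (auto simp: ef_def)
  have "nil (if even j then b else a) (k - j) v" if "j < 2 * Suc m" for j
  proof -
    consider "j = 0" | "j = 1" | j' where "j = j' + 2"
      by (metis One_nat_def add_2_eq_Suc' not0_implies_Suc)
    then show ?thesis
    proof cases
      case 3
      then show ?thesis using IH(3)[of j'] that by simp
    qed (use v in auto)
  qed
  then show ?case using IH(1) k v by auto
qed simp

text \<open>\<open>us\<close> lists a weight from the last generator \<^term>\<open>X k\<close> downwards.\<close>

definition has_weight :: "nat \<Rightarrow> 'f list \<Rightarrow> 'b set \<Rightarrow> bool" where
  "has_weight k us S \<longleftrightarrow>
    (\<exists>v\<in>S. v \<noteq> 0 \<and> (\<forall>j<length us. j < k \<and> X (k - j) v = us ! j *s v))"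

text \<open>The square of the intertwiner acts on the weight vector by a nonzero scalar, so its
  image is a nonzero weight vector with the two entries exchanged.\<close>

lemma has_weight_swap:
  assumes S: "sub k S" "k \<le> n" and W: "has_weight k (us @ [x, y] @ ws) S"
    and xy: "x = y \<or> \<not> linked x y"
  shows "has_weight k (us @ [y, x] @ ws) S"
proof (cases "x = y")
  case True
  then show ?thesis using W by simp
next
  case False
  obtain v where v: "v \<in> S" "v \<noteq> 0"
    and w: "\<And>j. j < length (us @ [x, y] @ ws) \<Longrightarrow> j < k \<and> X (k - j) v = (us @ [x, y] @ ws) ! j *s v"
    using W unfolding has_weight_def by blast
  let ?l = "length us"
  define i where "i = k - Suc ?l"
  have lk: "Suc ?l < k" using w[of "Suc ?l"] by simp
  then have i: "1 \<le> i" "i < n" "k - ?l = Suc i" using S(2) by (auto simp: i_def)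
  have Xi: "X i v = y *s v" "X (Suc i) v = x *s v"
    using w[of "Suc ?l"] w[of ?l] i(3) by (auto simp: nth_append i_def)
  have "Phi i (Phi i v) = (- q * ((x - q * y) * (x - y / q))) *s v"
    unfolding Phi_Phi[OF i(1,2) Xi(1)]
    by (simp add: Xm_def Xi flip: scale_left_diff_distrib) (simp add: algebra_simps)
  moreover have "x - q * y \<noteq> 0" "x - y / q \<noteq> 0"
    using xy False q_nz by (auto simp: linked_def field_simps)
  then have "- q * ((x - q * y) * (x - y / q)) \<noteq> 0" using q_nz by simp
  ultimately have "Phi i v \<noteq> 0" using v(2) by auto
  moreover have "Phi i v \<in> S" using sub_mono[OF S(1), of "Suc i"] i(1,3) v(1) by (intro Phi_closed) auto
  moreover have "j < k \<and> X (k - j) (Phi i v) = (us @ [y, x] @ ws) ! j *s Phi i v"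
    if j: "j < length (us @ [y, x] @ ws)" for j
  proof -
    have jk: "j < k" "X (k - j) v = (us @ [x, y] @ ws) ! j *s v" using w[of j] j by auto
    consider "j = ?l" | "j = Suc ?l" | "j < ?l" | "Suc ?l < j" by linarith
    then show ?thesis
    proof cases
      case 1
      then show ?thesis using jk i Xi by (simp add: X_Suc_Phi nth_append)
    next
      case 2
      then have "k - j = i" by (simp add: i_def)
      then show ?thesis using 2 jk i Xi by (simp add: X_Phi nth_append)
    next
      case 3
      then have "k - j \<noteq> i" "k - j \<noteq> Suc i" using i lk by auto
      then show ?thesis using 3 jk by (simp add: X_Phi_other nth_append)
    next
      case 4
      then have "k - j \<noteq> i" "k - j \<noteq> Suc i" using i lk jk by (auto simp: i_def)
      moreover have "(us @ [x, y] @ ws) ! j = (us @ [y, x] @ ws) ! j"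
        using 4 by (auto simp: nth_append nth_Cons split: nat.splits)
      ultimately show ?thesis using jk by (simp add: X_Phi_other)
    qed
  qed
  ultimately show ?thesis unfolding has_weight_def by blast
qed

lemma has_weight_permute:
  assumes S: "sub k S" "k \<le> n"
    and A: "\<And>x y. x \<in> A \<Longrightarrow> y \<in> A \<Longrightarrow> x = y \<or> \<not> linked x y"
  shows "has_weight k (ps @ us) S \<Longrightarrow> mset us = mset ws \<Longrightarrow> set us \<subseteq> A \<Longrightarrow> has_weight k (ps @ ws) S"
proof (induction ws arbitrary: ps us)
  case (Cons y ws)
  have y: "y \<in> set us" using Cons.prems(2) by (metis list.set_intros(1) mset_eq_setD)
  then obtain us1 us2 where us: "us = us1 @ y # us2" by (meson split_list)
  have yA: "y \<in> A" using y Cons.prems(3) by auto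
  have bubble: "has_weight k (ps @ us1 @ y # us2) S \<Longrightarrow> set us1 \<subseteq> A \<Longrightarrow>
      has_weight k (ps @ y # us1 @ us2) S" for us1 us2
  proof (induction us1 arbitrary: us2 rule: rev_induct)
    case (snoc x us1)
    have xy: "x = y \<or> \<not> linked x y" using snoc.prems(2) A[of x y] yA by simp
    have "has_weight k ((ps @ us1) @ [x, y] @ us2) S" using snoc.prems(1) by simp
    then have "has_weight k ((ps @ us1) @ [y, x] @ us2) S"
      using xy by (rule has_weight_swap[OF S])
    then show ?case using snoc.IH[of "x # us2"] snoc.prems(2) by simp
  qed simp
  have "has_weight k (ps @ y # us1 @ us2) S"
    using Cons.prems(1,3) us by (intro bubble) auto
  then have "has_weight k ((ps @ [y]) @ us1 @ us2) S" by simp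
  moreover have "mset (us1 @ us2) = mset ws" "set (us1 @ us2) \<subseteq> A"
    using Cons.prems(2,3) us by auto
  ultimately show ?case using Cons.IH[of "ps @ [y]" "us1 @ us2"] by simp
qed simp

text \<open>A nonzero vector of the iterated eigenspace carries the generalised weights
  \<open>b, a, b, a, ...\<close> read from \<open>X k\<close> downwards. Equal or unlinked weights
  may be permuted freely, so all \<open>a\<close>'s or all \<open>b\<close>'s can be brought next to
  \<open>X k\<close>.\<close>

lemma ef_pow_Tail:
  assumes S: "sub k S" "k \<le> n" and ab: "\<not> linked a b" and ne: "ef_pow m k a b S \<noteq> {0}"
  shows "Tail a (k - m) k S \<noteq> {0}" "Tail b (k - m) k S \<noteq> {0}" "m \<le> k"
proof -
  let ?f = "\<lambda>j. if even j then b else a"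
  let ?D = "{v\<in>S. \<forall>j<2 * m. nil (?f j) (k - j) v}"
  obtain v where v: "v \<in> ef_pow m k a b S" "v \<noteq> 0"
    using ne sub_zero_mem[OF sub_ef_pow[OF S(1)]] by blast
  then have m: "2 * m \<le> k" and vD: "v \<in> ?D" using ef_pow_weights[OF v] by auto
  then show "m \<le> k" by simp
  have inj: "k - (k - i) = i" if "i \<le> k" for i using that by simp
  have "\<exists>v\<in>?D. v \<noteq> 0 \<and> (\<forall>i\<in>(\<lambda>j. k - j) ` {..<2 * m}. X i v = ?f (k - i) *s v)"
  proof (rule common_eigenvector)
    show "subspace ?D"
      using sub_subspace[OF S(1)] by (auto simp: subspace_def nil_add nil_scale)
    show "?D \<noteq> {0}" using v vD by blast
    show "nil (?f (k - i)) i v" if "i \<in> (\<lambda>j. k - j) ` {..<2 * m}" "v \<in> ?D" for i v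
      using that m by auto
    show "X i v \<in> ?D" if "i \<in> (\<lambda>j. k - j) ` {..<2 * m}" "v \<in> ?D" for i v
      using that m stable_X[OF sub_stable[OF S(1)]] by (auto simp: nil_X)
  qed simp
  then obtain w where w: "w \<in> S" "w \<noteq> 0" "\<And>j. j < 2 * m \<Longrightarrow> X (k - j) w = ?f j *s w"
    using m by fastforce
  have "has_weight k ([] @ map ?f [0..<2 * m]) S"
    unfolding has_weight_def using w m by (intro bexI[of _ w]) auto
  moreover have mset: "mset (map ?f [0..<2 * m]) = mset (replicate m a @ replicate m b)"
    by (induction m) auto
  moreover have A: "x = y \<or> \<not> linked x y" if "x \<in> {a, b}" "y \<in> {a, b}" for x y
    using that ab linked_sym[of a b] by auto
  moreover have "set (map ?f [0..<2 * m]) \<subseteq> {a, b}" by auto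
  ultimately have "has_weight k ([] @ ws) S"
    if "mset ws = mset (replicate m a @ replicate m b)" for ws
    using has_weight_permute[OF S, of "{a, b}" "[]" "map ?f [0..<2 * m]" ws] that by metis
  from this[of "replicate m a @ replicate m b"] this[of "replicate m b @ replicate m a"]
  have "has_weight k (replicate m a @ replicate m b) S"
    "has_weight k (replicate m b @ replicate m a) S"
    by (simp_all add: union_commute)
  moreover have "Tail c (k - m) k S \<noteq> {0}" if hw: "has_weight k (replicate m c @ ws) S" for c ws
  proof -
    obtain w where w: "w \<in> S" "w \<noteq> 0" "\<And>j. j < m \<Longrightarrow> j < k \<and> X (k - j) w = c *s w"
      using hw unfolding has_weight_def by (auto simp: nth_append)
    have "nil c i w" if "k - m < i" "i \<le> k" for i
      using w(3)[of "k - i"] that by (intro eigen_nil) auto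
    then show ?thesis using w by (auto simp: Tail_def)
  qed
  ultimately show "Tail a (k - m) k S \<noteq> {0}" "Tail b (k - m) k S \<noteq> {0}" by auto
qed

section \<open>Tails of simple submodules of the eigenspaces\<close>

lemma Tail_socle:
  assumes M: "simple k M" and k: "1 \<le> k" "k \<le> n"
    and R: "sub (k - 1) R" "R \<noteq> {0}" "R \<subseteq> ef k b M"
  shows "Tail b s k M \<noteq> {0} \<Longrightarrow> Tail b s (k - 1) R \<noteq> {0}"
    and "a \<noteq> b \<Longrightarrow> s < k \<Longrightarrow> Tail a s k M \<noteq> {0} \<Longrightarrow> 1 \<le> s \<and> Tail a (s - 1) (k - 1) R \<noteq> {0}"
proof -
  have RM: "R \<subseteq> M" "\<And>v. v \<in> R \<Longrightarrow> nil b k v" using R(3) k by (auto simp: ef_def)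
  have gen: "gen k R = M" using gen_simple[OF M R(1) RM(1) R(2) k] .
  show "Tail b s k M \<noteq> {0} \<Longrightarrow> Tail b s (k - 1) R \<noteq> {0}"
    using Tail_gen_same[OF k R(1)] gen by simp
  show "a \<noteq> b \<Longrightarrow> s < k \<Longrightarrow> Tail a s k M \<noteq> {0} \<Longrightarrow> 1 \<le> s \<and> Tail a (s - 1) (k - 1) R \<noteq> {0}"
    using Tail_gen_other[OF k R(1), of a s b] RM(2) gen by simp
qed

text \<open>Each of the two restrictions shortens the tail of its own weight by one and shifts that
  of the other weight without loss: \<open>b\<close> is removed first, then
  \<open>a\<close>.\<close>

lemma Tail_socle2:
  assumes M: "simple k M" and k: "2 \<le> k" "k \<le> n" and ab: "a \<noteq> b" and m: "Suc m \<le> k"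
    and R: "simple (k - 1) R" "R \<subseteq> ef k b M"
    and N: "simple (k - 2) N" "N \<subseteq> ef (k - 1) a R"
    and T: "Tail a (k - Suc m) k M \<noteq> {0}" "Tail b (k - Suc m) k M \<noteq> {0}"
  shows "m \<le> k - 2" "Tail a (k - 2 - m) (k - 2) N \<noteq> {0}" "Tail b (k - 2 - m) (k - 2) N \<noteq> {0}"
proof -
  have kk: "1 \<le> k" "1 \<le> k - 1" "k - 1 \<le> n" "k - 1 - 1 = k - 2" using k by auto
  note socR = Tail_socle[OF M kk(1) k(2) simple_sub[OF R(1)] simple_nonzero[OF R(1)] R(2)]
  have subN: "sub (k - 1 - 1) N" using simple_sub[OF N(1)] kk by simp
  note socN = Tail_socle[OF R(1) kk(2,3) subN simple_nonzero[OF N(1)] N(2), unfolded kk(4)]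
  have a: "1 \<le> k - Suc m \<and> Tail a (k - Suc m - 1) (k - 1) R \<noteq> {0}"
    using socR(2)[of a "k - Suc m"] ab m T by auto
  then show "m \<le> k - 2" by auto
  show "Tail a (k - 2 - m) (k - 2) N \<noteq> {0}"
    using socN(1)[of "k - Suc m - 1"] a by (simp add: numeral_2_eq_2)
  have b: "Tail b (k - Suc m) (k - 1) R \<noteq> {0}" using socR(1) T(2) by blast
  show "Tail b (k - 2 - m) (k - 2) N \<noteq> {0}"
  \<comment> \<open>For \<open>m = 0\<close> the tail to be shifted is empty, outside the range
    where \<open>Tail_socle\<close> shifts tails, and the claim reduces to
    \<open>N \<noteq> {0}\<close>.\<close>
  proof (cases "m = 0")
    case True
    have "Tail b (k - 2) (k - 2) N = N" by (auto simp: Tail_def)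
    then show ?thesis using True simple_nonzero[OF N(1)] by simp
  next
    case False
    then have "Tail b (k - Suc m - 1) (k - 2) N \<noteq> {0}"
      using socN(2)[of b "k - Suc m"] ab m b by auto
    then show ?thesis by (simp add: numeral_2_eq_2)
  qed
qed

lemma Tail_ef:
  assumes "sub k S" "Tail c s k S \<noteq> {0}" "s < k"
  shows "ef k c S \<noteq> {0}"
proof -
  have "Tail c s k S \<subseteq> ef k c S" using assms(3) by (auto simp: Tail_def ef_def)
  moreover have "0 \<in> Tail c s k S" using subspace_0[OF subspace_Tail[OF sub_subspace]] assms by blast
  ultimately show ?thesis using assms(2) by auto
qed

lemma ef_pow_nonzero:
  assumes ab: "a \<noteq> b"
  shows "simple k M \<Longrightarrow> k \<le> n \<Longrightarrow> m \<le> k \<Longrightarrow> Tail a (k - m) k M \<noteq> {0} \<Longrightarrow>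
    Tail b (k - m) k M \<noteq> {0} \<Longrightarrow> ef_pow m k a b M \<noteq> {0}"
proof (induction m arbitrary: k M)
  case 0
  then show ?case using simple_nonzero by simp
next
  case (Suc m)
  note M = simple_sub[OF Suc.prems(1)]
  have k1: "1 \<le> k" using Suc.prems by simp
  have "ef k b M \<noteq> {0}" using Tail_ef[OF M Suc.prems(5)] Suc.prems(3) by simp
  then obtain R where R: "simple (k - 1) R" "R \<subseteq> ef k b M"
    using simple_exists[OF sub_ef[OF M]] by blast
  have a: "1 \<le> k - Suc m \<and> Tail a (k - Suc m - 1) (k - 1) R \<noteq> {0}"
    by (rule Tail_socle(2)[OF Suc.prems(1) k1 Suc.prems(2) simple_sub[OF R(1)]
          simple_nonzero[OF R(1)] R(2) ab _ Suc.prems(4)]) (use Suc.prems(3) in simp)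
  then have k2: "2 \<le> k" by auto
  have "ef (k - 1) a R \<noteq> {0}" using Tail_ef[OF simple_sub[OF R(1)] conjunct2[OF a]] a k2 by simp
  then obtain N where N: "simple (k - 2) N" "N \<subseteq> ef (k - 1) a R"
    using simple_exists[OF sub_ef[OF simple_sub[OF R(1)]]] by (auto simp: numeral_2_eq_2)
  have "ef_pow m (k - 2) a b N \<noteq> {0}"
    using Tail_socle2[OF Suc.prems(1) k2 Suc.prems(2) ab Suc.prems(3) R N Suc.prems(4,5)] Suc.prems(2) N(1)
    by (intro Suc.IH) auto
  moreover have "ef_pow m (k - 2) a b N \<subseteq> ef_pow (Suc m) k a b M"
    using ef_pow_mono N(2) ef_mono[OF R(2), of "k - 1" a] by simp
  moreover have "0 \<in> ef_pow m (k - 2) a b N"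
    using sub_zero_mem[OF sub_ef_pow[OF simple_sub[OF N(1)]]] .
  ultimately show ?case by auto
qed

text \<open>A simple submodule of the double eigenspace meets \<open>R\<close> by
  \<open>meets_socle\<close>, hence lies in \<open>R\<close> and in its \<open>a\<close>-eigenspace,
  whose simple submodule is unique. In the last clause one direction is monotonicity; the other goes
  through the tails, since \<open>N\<close> is much smaller than the eigenspace from which the
  powers of \<open>M\<close> are formed.\<close>

theorem socle_structure:
  assumes M: "simple k M" "k \<le> n" and ab: "\<not> linked a b" "a \<noteq> 0" "b \<noteq> 0"
    and ne: "ef (k - 1) a (ef k b M) \<noteq> {0}"
  obtains N R where "simple (k - 1) R" "R \<subseteq> ef k b M"
    and "\<And>R'. simple (k - 1) R' \<Longrightarrow> R' \<subseteq> ef k b M \<Longrightarrow> R' = R"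
    and "simple (k - 2) N" "N \<subseteq> ef (k - 1) a R"
    and "\<And>N'. simple (k - 2) N' \<Longrightarrow> N' \<subseteq> ef (k - 1) a (ef k b M) \<Longrightarrow> N' = N"
    and "\<And>m. ef_pow m (k - 2) a b N \<noteq> {0} \<longleftrightarrow> ef_pow (Suc m) k a b M \<noteq> {0}"
proof -
  note Msub = simple_sub[OF M(1)]
  have ane: "a \<noteq> b" using ab(1) by (auto simp: linked_def)
  have k: "2 \<le> k" using ne by (auto simp: ef_def split: if_splits)
  then have kk: "1 \<le> k" "1 \<le> k - 1" "k - 1 \<le> n" "k - 1 - 1 = k - 2" using M(2) by auto
  \<comment> \<open>Both submodules contain the nonzero common eigenvectors provided by
    \<open>simple_core\<close>, so they meet. It is used for \<open>M\<close> with weight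
    \<open>b\<close> and for \<open>R\<close> with weight \<open>a\<close>.\<close>
  have unique: "S = S'"
    if L: "simple k' L" "1 \<le> k'" "k' \<le> n" "c \<noteq> 0" and S: "simple (k' - 1) S" "S \<subseteq> ef k' c L"
      and S': "simple (k' - 1) S'" "S' \<subseteq> ef k' c L" for k' L c S S'
  proof -
    have "ef k' c L \<noteq> {0}"
      using S simple_nonzero[OF S(1)] sub_zero_mem[OF simple_sub[OF S(1)]] by blast
    then have "Tail c (k' - 1) k' L \<noteq> {0}" using L(2) by (simp add: ef_eq_Tail)
    then obtain s where E: "Exact c s k' L \<noteq> {0}"
      and least: "\<And>N. sub (k' - 1) N \<Longrightarrow> N \<noteq> {0} \<Longrightarrow> N \<subseteq> L \<Longrightarrow> (\<And>v. v \<in> N \<Longrightarrow> nil c k' v) \<Longrightarrow> Exact c s k' L \<subseteq> N"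
      using simple_core[OF L] by metis
    obtain v where v: "v \<in> Exact c s k' L" "v \<noteq> 0"
      using E subspace_0[OF subspace_Exact[OF sub_subspace[OF simple_sub[OF L(1)]]]] by blast
    have "v \<in> S" "v \<in> S'"
      using least[OF simple_sub[OF S(1)] simple_nonzero[OF S(1)]] S(2)
        least[OF simple_sub[OF S'(1)] simple_nonzero[OF S'(1)]] S'(2) v(1) L(2)
      by (auto simp: ef_def)
    then show ?thesis
      using simple_subset[OF S(1) simple_sub[OF S'(1)]] simple_subset[OF S'(1) simple_sub[OF S(1)]]
        v(2) by blast
  qed
  have "ef k b M \<noteq> {0}"
    using ne ef_subset[OF sub_ef[OF Msub], of a b] sub_zero_mem[OF sub_ef_ef[OF Msub], of a b] by blast
  then obtain R where R: "simple (k - 1) R" "R \<subseteq> ef k b M"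
    using simple_exists[OF sub_ef[OF Msub]] by blast
  have RM: "R \<subseteq> M" "\<And>v. v \<in> R \<Longrightarrow> nil b k v" using R(2) kk by (auto simp: ef_def)
  have in_R: "N' \<subseteq> ef (k - 1) a R" if N': "simple (k - 2) N'" "N' \<subseteq> ef (k - 1) a (ef k b M)" for N'
  proof -
    have nilN: "\<And>v. v \<in> N' \<Longrightarrow> nil a (k - 1) v" "\<And>v. v \<in> N' \<Longrightarrow> nil b k v" "N' \<subseteq> M"
      using N'(2) k by (auto simp: ef_def)
    obtain v where v: "v \<in> N'" "v \<in> R" "v \<noteq> 0"
      using meets_socle[OF M(1) k M(2) ab(1,3) R(1) RM simple_sub[OF N'(1)] simple_nonzero[OF N'(1)]
          nilN(3,1,2)] by blast
    have "sub (k - 2) R" using sub_mono[OF simple_sub[OF R(1)]] by simp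
    then have "N' \<subseteq> R" using simple_subset[OF N'(1)] v by blast
    then show ?thesis using nilN(1) k by (auto simp: ef_def)
  qed
  obtain N where N: "simple (k - 2) N" "N \<subseteq> ef (k - 1) a (ef k b M)"
    using simple_exists[OF sub_ef_ef[OF Msub] ne] by blast
  have NR: "N \<subseteq> ef (k - 1) a R" using in_R N by blast
  have uN: "N' = N" if "simple (k - 2) N'" "N' \<subseteq> ef (k - 1) a (ef k b M)" for N'
    using unique[OF R(1) kk(2,3) ab(2), unfolded kk(4)] that in_R N NR by blast
  have pow: "ef_pow m (k - 2) a b N \<noteq> {0} \<longleftrightarrow> ef_pow (Suc m) k a b M \<noteq> {0}" for m
  proof
    assume "ef_pow m (k - 2) a b N \<noteq> {0}"
    moreover have "ef_pow m (k - 2) a b N \<subseteq> ef_pow (Suc m) k a b M"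
      using ef_pow_mono N(2) by simp
    moreover have "0 \<in> ef_pow m (k - 2) a b N"
      using sub_zero_mem[OF sub_ef_pow[OF simple_sub[OF N(1)]]] .
    ultimately show "ef_pow (Suc m) k a b M \<noteq> {0}" by auto
  next
    assume "ef_pow (Suc m) k a b M \<noteq> {0}"
    from ef_pow_Tail[OF Msub M(2) ab(1) this]
    show "ef_pow m (k - 2) a b N \<noteq> {0}"
      using Tail_socle2[OF M(1) k M(2) ane _ R N(1) NR] M(2) N(1)
      by (intro ef_pow_nonzero[OF ane]) auto
  qed
  show ?thesis
  proof (rule that[OF R _ N(1) NR uN pow])
    show "R' = R" if "simple (k - 1) R'" "R' \<subseteq> ef k b M" for R'
      by (rule unique[OF M(1) kk(1) M(2) ab(3) that R])
  qed
qed

end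

lemma (in affine_hecke_module) X_surj_on:
  assumes inj: "\<And>u. u \<in> V \<Longrightarrow> X i u = 0 \<Longrightarrow> u = 0" and i: "1 \<le> i" "i \<le> n"
    and W: "subspace W" "W \<subseteq> V" "\<And>u. u \<in> W \<Longrightarrow> X i u \<in> W" and v: "v \<in> W"
  shows "\<exists>u\<in>W. X i u = v"
proof -
  have Xm_W: "Xm i c u \<in> W" if "u \<in> W" for c u
    unfolding Xm_def using W that by (intro subspace_diff subspace_scale) auto
  have "\<exists>u\<in>W. X i u = v" if "Xop (map (Pair i) cs) v = 0" "v \<in> W" for cs v
    using that
  proof (induction cs arbitrary: v)
    case Nil
    then show ?case using subspace_0[OF W(1)] by (intro bexI[of _ 0]) auto
  next
    case (Cons c cs)
    let ?L = "map (Pair i) cs"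
    show ?case
    proof (cases "c = 0")
      case True
      have "Xop ?L v \<in> W" by (rule Xop_closed[OF W(1) _ Cons.prems(2)]) (use W in auto)
      moreover have "X i (Xop ?L v) = 0" using Cons.prems True by (simp add: Xm_def)
      ultimately have "Xop ?L v = 0" using inj W(2) by blast
      then show ?thesis using Cons by blast
    next
      case False
      have "Xop ?L (Xm i c v) = 0"
        using Cons.prems(1) Xop_Xop[of "[(i, c)]" ?L v] by simp
      then obtain u where u: "u \<in> W" "X i u = Xm i c v" using Cons.IH Xm_W Cons.prems(2) by blast
      have "X i (inverse c *s (v - u)) = v" using u(2) False by (simp add: Xm_def)
      moreover have "inverse c *s (v - u) \<in> W"
        using u Cons.prems W by (intro subspace_scale subspace_diff) auto
      ultimately show ?thesis by blast
    qed
  qed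
  then show ?thesis using annihilator_exists[OF i] v W(2) by blast
qed

section \<open>Coordinates\<close>

lemma scalar_add: "scalar (c + d) = scalar c + scalar d"
  and scalar_mult: "scalar (c * d) = scalar c * scalar d"
  and scalar_one: "scalar 1 = 1"
  and scalar_zero: "scalar 0 = 0"
  and scalar_diff: "scalar (c - d) = scalar c - scalar d"
  by (simp_all add: scalar_def single_add mult_single single_diff)

lemma var_scalar_comm: "var g * scalar c = scalar c * var g"
  by (simp add: var_def scalar_def mult_single)

lemma hecke_class_hom:
  assumes "p \<in> carrier (free_ring n)" "r \<in> carrier (free_ring n)"
  shows "hecke_class n q (p * r) = hecke_class n q p \<otimes>\<^bsub>hecke n q\<^esub> hecke_class n q r"
    and "hecke_class n q (p + r) = hecke_class n q p \<oplus>\<^bsub>hecke n q\<^esub> hecke_class n q r"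
  using ring_hom_mult[OF ideal.rcos_ring_hom[OF hecke_ideal_ideal] assms, of q]
    ring_hom_add[OF ideal.rcos_ring_hom[OF hecke_ideal_ideal] assms, of q]
  unfolding hecke_class_def hecke_def by (simp_all add: free_ring_ops)

lemma hecke_class_one: "hecke_class n q 1 = \<one>\<^bsub>hecke n q\<^esub>"
  using ring_hom_one[OF ideal.rcos_ring_hom[OF hecke_ideal_ideal], of n q]
  unfolding hecke_class_def hecke_def by (simp add: free_ring_ops)

lemma hecke_class_carrier: "p \<in> carrier (free_ring n) \<Longrightarrow> hecke_class n q p \<in> carrier (hecke n q)"
  by (simp add: hecke_carrier)

lemma hecke_class_rel:
  assumes "r \<in> hecke_rels n q"
  shows "hecke_class n q r = hecke_class n q 0"
proof -
  interpret I: ideal "hecke_ideal n q" "free_ring n" by (rule hecke_ideal_ideal)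
  have "r \<in> hecke_ideal n q"
    using ring.genideal_self[OF ring_free_ring hecke_rels_subset] assms
    unfolding hecke_ideal_def by blast
  moreover have "0 \<in> hecke_ideal n q"
    using additive_subgroup.zero_closed[OF I.is_additive_subgroup] by (simp add: free_ring_ops)
  ultimately show ?thesis
    unfolding hecke_class_def by (simp add: I.a_rcos_const)
qed

lemma hecke_relsI:
  "i \<in> {1..<n} \<Longrightarrow> (var (GT i) - scalar q) * (var (GT i) + 1) \<in> hecke_rels n q"
  "i \<in> {1..<n} \<Longrightarrow> i + 1 \<in> {1..<n} \<Longrightarrow> var (GT i) * var (GT (i + 1)) * var (GT i)
    - var (GT (i + 1)) * var (GT i) * var (GT (i + 1)) \<in> hecke_rels n q"
  "i \<in> {1..<n} \<Longrightarrow> k \<in> {1..<n} \<Longrightarrow> \<bar>int i - int k\<bar> > 1 \<Longrightarrow>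
    var (GT i) * var (GT k) - var (GT k) * var (GT i) \<in> hecke_rels n q"
  "i \<in> {1..n} \<Longrightarrow> k \<in> {1..n} \<Longrightarrow>
    var (GX i) * var (GX k) - var (GX k) * var (GX i) \<in> hecke_rels n q"
  "k \<in> {1..n} \<Longrightarrow> var (GXinv k) * var (GX k) - 1 \<in> hecke_rels n q"
  "i \<in> {1..<n} \<Longrightarrow> k \<in> {1..n} \<Longrightarrow> k \<noteq> i \<Longrightarrow> k \<noteq> i + 1 \<Longrightarrow>
    var (GT i) * var (GX k) - var (GX k) * var (GT i) \<in> hecke_rels n q"
  "i \<in> {1..<n} \<Longrightarrow>
    var (GX (i + 1)) - scalar (inverse q) * var (GT i) * var (GX i) * var (GT i) \<in> hecke_rels n q"
  unfolding hecke_rels_def by blast+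

lemma free_ring_zero: "(0 :: 'f::field free_alg) \<in> carrier (free_ring n)"
  by (simp add: free_ring_def)

lemma var_carriers:
  "1 \<le> i \<Longrightarrow> i < n \<Longrightarrow> var (GT i) \<in> carrier (free_ring n)"
  "1 \<le> i \<Longrightarrow> i \<le> n \<Longrightarrow> var (GX i) \<in> carrier (free_ring n)"
  "1 \<le> i \<Longrightarrow> i \<le> n \<Longrightarrow> var (GXinv i) \<in> carrier (free_ring n)"
  by (auto intro!: var_in_carrier simp: gens_def)

lemmas free_ring_intros = free_ring_closed free_ring_one free_ring_zero scalar_in_carrier var_carriers

lemma free_ring_induct [consumes 1, case_names zero add scalar one var]:
  assumes "p \<in> carrier (free_ring k)"
    and "P 0" "\<And>p r. P p \<Longrightarrow> P r \<Longrightarrow> P (p + r)" "\<And>c p. P p \<Longrightarrow> P (scalar c * p)" "P 1"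
    and "\<And>g p. g \<in> gens k \<Longrightarrow> p \<in> carrier (free_ring k) \<Longrightarrow> P p \<Longrightarrow> P (var g * p)"
  shows "P p"
proof -
  have word: "P (Poly_Mapping.single (Word gs) 1) \<and>
      Poly_Mapping.single (Word gs) (1 :: 'a) \<in> carrier (free_ring k)" if "set gs \<subseteq> gens k" for gs
    using that
  proof (induction gs)
    case Nil
    have "Poly_Mapping.single (Word []) (1 :: 'a) = 1" by (simp flip: zero_word_def)
    then show ?case using assms(5) free_ring_one by simp
  next
    case (Cons g gs)
    have "Poly_Mapping.single (Word (g # gs)) (1 :: 'a) = var g * Poly_Mapping.single (Word gs) 1"
      by (simp add: var_def mult_single plus_word_def)
    then show ?case using Cons assms(6) var_in_carrier[of g k] by (auto intro: free_ring_closed)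
  qed
  show ?thesis using assms(1)
  proof (induction p rule: update_induct)
    case const
    then show ?case using assms(2) by simp
  next
    case (update p w c)
    have eq: "Poly_Mapping.update w c p = scalar c * Poly_Mapping.single w 1 + p"
      using update(1) by (intro poly_mapping_eqI)
        (auto simp: scalar_def mult_single lookup_update lookup_add lookup_single when_def
          in_keys_iff)
    have keys: "Poly_Mapping.keys (Poly_Mapping.update w c p) = insert w (Poly_Mapping.keys p)"
      using update(2) by (auto simp: in_keys_iff lookup_update split: if_splits)
    then have "set (letters w) \<subseteq> gens k" "p \<in> carrier (free_ring k)"
      using update.prems by (auto simp: free_ring_def)
    then show ?case unfolding eq using word[of "letters w"] update.IH assms(3,4) by simp
  qed
qed

text \<open>The coordinate space consists of functions on the whole type of vectors, since the basis
  is found only later and no type can depend on it.\<close>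

definition fscale :: "'f::field \<Rightarrow> ('v \<Rightarrow> 'f) \<Rightarrow> 'v \<Rightarrow> 'f" where
  "fscale c f = (\<lambda>x. c * f x)"

lemma fscale_apply: "fscale c f x = c * f x"
  by (simp add: fscale_def)

interpretation fs: vector_space "fscale :: 'f::field \<Rightarrow> ('v \<Rightarrow> 'f) \<Rightarrow> 'v \<Rightarrow> 'f"
  by unfold_locales (auto simp: fscale_def fun_eq_iff algebra_simps)

section \<open>Linear combinations and bases in a module over the quotient algebra\<close>

locale hecke_left_module =
  fixes n :: nat and q :: "'f::alg_closed_field" and M :: "('f, 'v) hecke_mod"
  assumes left: "left_module (hecke n q) M"
begin

sublocale M: abelian_group M
  using left by (simp add: left_module_def)

definition act :: "'f free_alg \<Rightarrow> 'v \<Rightarrow> 'v" where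
  "act p v = hecke_class n q p \<odot>\<^bsub>M\<^esub> v"

lemma act_closed [simp]: "p \<in> carrier (free_ring n) \<Longrightarrow> v \<in> carrier M \<Longrightarrow> act p v \<in> carrier M"
  and act_add: "p \<in> carrier (free_ring n) \<Longrightarrow> r \<in> carrier (free_ring n) \<Longrightarrow> v \<in> carrier M \<Longrightarrow>
    act (p + r) v = act p v \<oplus>\<^bsub>M\<^esub> act r v"
  and act_add_right: "p \<in> carrier (free_ring n) \<Longrightarrow> u \<in> carrier M \<Longrightarrow> v \<in> carrier M \<Longrightarrow>
    act p (u \<oplus>\<^bsub>M\<^esub> v) = act p u \<oplus>\<^bsub>M\<^esub> act p v"
  and act_mult: "p \<in> carrier (free_ring n) \<Longrightarrow> r \<in> carrier (free_ring n) \<Longrightarrow> v \<in> carrier M \<Longrightarrow>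
    act (p * r) v = act p (act r v)"
  and act_one [simp]: "v \<in> carrier M \<Longrightarrow> act 1 v = v"
  using left unfolding left_module_def module_axioms_def act_def
  by (simp_all add: hecke_class_hom hecke_class_carrier hecke_class_one)

lemma act_zero [simp]: "v \<in> carrier M \<Longrightarrow> act 0 v = \<zero>\<^bsub>M\<^esub>"
  using act_add[of 0 0 v] M.add.r_cancel_one'[of "act 0 v" "act 0 v"] by (simp add: free_ring_zero)

lemma act_zero_right [simp]: "p \<in> carrier (free_ring n) \<Longrightarrow> act p \<zero>\<^bsub>M\<^esub> = \<zero>\<^bsub>M\<^esub>"
  using act_add_right[of p "\<zero>\<^bsub>M\<^esub>" "\<zero>\<^bsub>M\<^esub>"] M.add.r_cancel_one'[of "act p \<zero>\<^bsub>M\<^esub>" "act p \<zero>\<^bsub>M\<^esub>"] by simp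

lemma act_cong_rel:
  assumes "p - r \<in> hecke_rels n q" "r \<in> carrier (free_ring n)" "v \<in> carrier M"
  shows "act p v = act r v"
proof -
  have "p - r \<in> carrier (free_ring n)" using assms(1) hecke_rels_subset by blast
  then have "act ((p - r) + r) v = act (p - r) v \<oplus>\<^bsub>M\<^esub> act r v" using assms by (intro act_add)
  moreover have "act (p - r) v = \<zero>\<^bsub>M\<^esub>"
    using hecke_class_rel[OF assms(1)] act_zero[OF assms(3)] by (simp add: act_def)
  ultimately show ?thesis using assms by simp
qed

lemma act_T_quad:
  assumes "1 \<le> i" "i < n" "v \<in> carrier M"
  shows "act (var (GT i)) (act (var (GT i)) v)
    = act (scalar (q - 1)) (act (var (GT i)) v) \<oplus>\<^bsub>M\<^esub> act (scalar q) v"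
proof -
  let ?t = "var (GT i) :: 'f free_alg"
  have "?t * ?t - (scalar (q - 1) * ?t + scalar q) = (?t - scalar q) * (?t + 1)"
    by (simp add: scalar_diff scalar_one algebra_simps)
  also have "\<dots> \<in> hecke_rels n q" using assms by (intro hecke_relsI) simp
  finally have "act (?t * ?t) v = act (scalar (q - 1) * ?t + scalar q) v"
    using assms by (intro act_cong_rel) (auto intro!: free_ring_intros)
  then show ?thesis using assms by (simp add: act_mult act_add free_ring_intros)
qed

lemma act_T_braid:
  assumes "1 \<le> i" "Suc i < n" "v \<in> carrier M"
  shows "act (var (GT i)) (act (var (GT (Suc i))) (act (var (GT i)) v))
    = act (var (GT (Suc i))) (act (var (GT i)) (act (var (GT (Suc i))) v))"
proof -
  let ?t = "var (GT i) :: 'f free_alg" and ?s = "var (GT (Suc i)) :: 'f free_alg"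
  have "?t * ?s * ?t - ?s * ?t * ?s \<in> hecke_rels n q"
    using assms hecke_relsI(2)[of i n q] by simp
  then have "act (?t * ?s * ?t) v = act (?s * ?t * ?s) v"
    using assms by (intro act_cong_rel) (auto intro!: free_ring_intros)
  then show ?thesis using assms by (simp add: act_mult free_ring_intros)
qed

lemma act_commute:
  assumes "x * y - y * x \<in> hecke_rels n q" "x \<in> carrier (free_ring n)" "y \<in> carrier (free_ring n)"
    and "v \<in> carrier M"
  shows "act x (act y v) = act y (act x v)"
  using act_cong_rel[OF assms(1) _ assms(4)] assms by (simp add: act_mult free_ring_closed)

lemma act_TT:
  "1 \<le> i \<Longrightarrow> i < n \<Longrightarrow> Suc i < k \<Longrightarrow> k < n \<Longrightarrow> v \<in> carrier M \<Longrightarrow>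
    act (var (GT i)) (act (var (GT k)) v) = act (var (GT k)) (act (var (GT i)) v)"
  by (rule act_commute) (auto intro!: hecke_relsI(3) free_ring_intros)

lemma act_XX:
  "1 \<le> i \<Longrightarrow> i \<le> n \<Longrightarrow> 1 \<le> k \<Longrightarrow> k \<le> n \<Longrightarrow> v \<in> carrier M \<Longrightarrow>
    act (var (GX i)) (act (var (GX k)) v) = act (var (GX k)) (act (var (GX i)) v)"
  by (rule act_commute) (auto intro!: hecke_relsI(4) free_ring_intros)

lemma act_TX:
  "1 \<le> i \<Longrightarrow> i < n \<Longrightarrow> 1 \<le> k \<Longrightarrow> k \<le> n \<Longrightarrow> k \<noteq> i \<Longrightarrow> k \<noteq> Suc i \<Longrightarrow> v \<in> carrier M \<Longrightarrow>
    act (var (GT i)) (act (var (GX k)) v) = act (var (GX k)) (act (var (GT i)) v)"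
  by (rule act_commute) (auto intro!: hecke_relsI(6) free_ring_intros)

lemma act_Xinv_X:
  assumes "1 \<le> i" "i \<le> n" "v \<in> carrier M"
  shows "act (var (GXinv i)) (act (var (GX i)) v) = v"
proof -
  have "act (var (GXinv i) * var (GX i)) v = act 1 v"
    using assms by (intro act_cong_rel hecke_relsI(5) free_ring_intros) auto
  then show ?thesis using assms by (simp add: act_mult free_ring_intros)
qed

lemma act_TXT:
  assumes "1 \<le> i" "i < n" "v \<in> carrier M" "q \<noteq> 0"
  shows "act (var (GT i)) (act (var (GX i)) (act (var (GT i)) v))
    = act (scalar q) (act (var (GX (Suc i))) v)"
proof -
  let ?t = "var (GT i) :: 'f free_alg" and ?x = "var (GX i) :: 'f free_alg"
  have "act (var (GX (Suc i))) v = act (scalar (inverse q) * ?t * ?x * ?t) v"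
    using assms hecke_relsI(7)[of i n q] by (intro act_cong_rel free_ring_intros) auto
  then have "act (scalar q) (act (var (GX (Suc i))) v)
      = act (scalar q * (scalar (inverse q) * ?t * ?x * ?t)) v"
    using assms by (subst act_mult) (auto intro!: free_ring_intros)
  also have "scalar q * (scalar (inverse q) * ?t * ?x * ?t) = ?t * ?x * ?t"
    using assms(4) by (simp add: mult.assoc[symmetric] scalar_one flip: scalar_mult)
  finally show ?thesis using assms by (simp add: act_mult free_ring_intros)
qed

definition lc :: "'v set \<Rightarrow> ('v \<Rightarrow> 'f) \<Rightarrow> 'v" where
  "lc B f = (\<Oplus>\<^bsub>M\<^esub>b\<in>B. act (scalar (f b)) b)"

lemma lc_closed: "B \<subseteq> carrier M \<Longrightarrow> lc B f \<in> carrier M"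
  unfolding lc_def by (intro M.finsum_closed) (auto simp: scalar_in_carrier)

lemma lc_cong: "(\<And>b. b \<in> B \<Longrightarrow> f b = g b) \<Longrightarrow> B \<subseteq> carrier M \<Longrightarrow> lc B f = lc B g"
  unfolding lc_def by (rule M.finsum_cong') (auto simp: scalar_in_carrier)

lemma lc_add:
  assumes "B \<subseteq> carrier M"
  shows "lc B (\<lambda>x. f x + g x) = lc B f \<oplus>\<^bsub>M\<^esub> lc B g"
proof -
  have C: "(\<lambda>b. act (scalar (h b)) b) \<in> B \<rightarrow> carrier M" for h
    using assms by (auto simp: scalar_in_carrier)
  have "lc B (\<lambda>x. f x + g x) = (\<Oplus>\<^bsub>M\<^esub>b\<in>B. act (scalar (f b)) b \<oplus>\<^bsub>M\<^esub> act (scalar (g b)) b)"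
    unfolding lc_def
    using assms by (intro M.finsum_cong') (auto simp: scalar_in_carrier scalar_add act_add)
  also have "\<dots> = lc B f \<oplus>\<^bsub>M\<^esub> lc B g" unfolding lc_def by (rule M.finsum_addf[OF C C])
  finally show ?thesis .
qed

lemma lc_scale:
  assumes "finite B" "B \<subseteq> carrier M"
  shows "lc B (\<lambda>x. c * f x) = act (scalar c) (lc B f)"
  using assms
proof (induction B)
  case empty
  then show ?case by (simp add: lc_def scalar_in_carrier)
next
  case (insert b B)
  then have "lc (insert b B) g = act (scalar (g b)) b \<oplus>\<^bsub>M\<^esub> lc B g" for g
    unfolding lc_def by (intro M.finsum_insert) (auto simp: scalar_in_carrier)
  then show ?case
    using insert lc_closed[of B f]
    by (simp add: act_add_right scalar_mult act_mult scalar_in_carrier)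
qed

text \<open>A spanning set of least cardinality is independent: a relation involving
  \<open>b\<close> would allow \<open>b\<close> to be removed.\<close>

lemma basis_exists:
  assumes "finite_dim n q M"
  obtains B where "finite B" "B \<subseteq> carrier M" "\<And>v. v \<in> carrier M \<Longrightarrow> \<exists>f. lc B f = v"
    and "\<And>f b. lc B f = \<zero>\<^bsub>M\<^esub> \<Longrightarrow> b \<in> B \<Longrightarrow> f b = 0"
proof -
  let ?P = "\<lambda>B. finite B \<and> B \<subseteq> carrier M \<and> (\<forall>v\<in>carrier M. \<exists>f. lc B f = v)"
  obtain B0 where B0: "finite B0 \<and> B0 \<subseteq> carrier M \<and> (\<forall>v\<in>carrier M. \<exists>c.
      v = (\<Oplus>\<^bsub>M\<^esub>b\<in>B0. hecke_class n q (scalar (c b)) \<odot>\<^bsub>M\<^esub> b))"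
    using assms unfolding finite_dim_def ..
  have "\<exists>f. lc B0 f = v" if "v \<in> carrier M" for v
    using bspec[OF conjunct2[OF conjunct2[OF B0]] that] by (auto simp: lc_def act_def)
  then have "?P B0" using B0 by simp
  from ex_has_least_nat[of ?P, OF this, of card]
  obtain B where "?P B \<and> (\<forall>B'. ?P B' \<longrightarrow> card B \<le> card B')" ..
  then have B: "?P B" and min: "\<forall>B'. ?P B' \<longrightarrow> card B \<le> card B'" by (rule conjunct1, rule conjunct2)
  have "f b = 0" if f: "lc B f = \<zero>\<^bsub>M\<^esub>" and b: "b \<in> B" for f b
  proof (rule ccontr)
    assume fb: "f b \<noteq> 0"
    have "\<exists>h. lc (B - {b}) h = v" if v: "v \<in> carrier M" for v
    proof -
      obtain g where g: "lc B g = v" using B v by blast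
      define h where "h x = g x + (- g b / f b) * f x" for x
      have "lc B h = lc B g \<oplus>\<^bsub>M\<^esub> act (scalar (- g b / f b)) (lc B f)"
        unfolding h_def using B by (simp only: lc_add lc_scale)
      then have hv: "lc B h = v" using f g v by (simp add: scalar_in_carrier)
      have "lc (insert b (B - {b})) h = act (scalar (h b)) b \<oplus>\<^bsub>M\<^esub> lc (B - {b}) h"
        unfolding lc_def using B b by (intro M.finsum_insert) (auto simp: scalar_in_carrier)
      moreover have "act (scalar (h b)) b = \<zero>\<^bsub>M\<^esub>"
        using B b fb by (auto simp: h_def scalar_zero)
      moreover have "lc (B - {b}) h \<in> carrier M" using B by (intro lc_closed) auto
      ultimately show ?thesis using hv b by (metis M.l_zero insert_Diff)
    qed
    then have "?P (B - {b})" using B by auto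
    then have "card B \<le> card (B - {b})" by (rule min[rule_format])
    then show False using B b by (metis card_Diff1_less not_le)
  qed
  then show ?thesis using B by (intro that[of B]) auto
qed

end

locale hecke_basis_module = hecke_left_module n q M
  for n :: nat and q :: "'f::alg_closed_field" and M :: "('f, 'v) hecke_mod" +
  fixes B :: "'v set"
  assumes finite_B: "finite B" and B_carrier: "B \<subseteq> carrier M"
    and B_spans: "v \<in> carrier M \<Longrightarrow> \<exists>f. lc B f = v"
    and B_independent: "lc B f = \<zero>\<^bsub>M\<^esub> \<Longrightarrow> b \<in> B \<Longrightarrow> f b = 0"
    and q_nz: "q \<noteq> 0" and q_ne_1: "q \<noteq> 1"
begin

lemma lc_B_closed [simp]: "lc B f \<in> carrier M"
  using lc_closed B_carrier .

lemma lc_unique: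
  assumes "lc B f = lc B g" "b \<in> B"
  shows "f b = g b"
proof -
  have "lc B (\<lambda>x. f x + (- 1) * g x) = lc B (\<lambda>x. g x + (- 1) * g x)"
    unfolding lc_add[OF B_carrier] assms(1) ..
  also have "\<dots> = lc B (\<lambda>x. 0 * g x)" by (rule lc_cong[OF _ B_carrier]) simp
  also have "\<dots> = \<zero>\<^bsub>M\<^esub>"
    unfolding lc_scale[OF finite_B B_carrier] by (simp add: scalar_zero)
  finally have "f b + (- 1) * g b = 0" using B_independent assms(2) by blast
  then show ?thesis by simp
qed

definition coords :: "'v \<Rightarrow> 'v \<Rightarrow> 'f" where
  "coords v = (\<lambda>x. if x \<in> B then (SOME f. lc B f = v) x else 0)"

lemma lc_coords [simp]:
  assumes "v \<in> carrier M"
  shows "lc B (coords v) = v"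
proof -
  have "lc B (coords v) = lc B (SOME f. lc B f = v)"
    by (rule lc_cong[OF _ B_carrier]) (simp add: coords_def)
  also have "\<dots> = v" by (rule someI_ex[OF B_spans[OF assms]])
  finally show ?thesis .
qed

lemma coords_outside [simp]: "x \<notin> B \<Longrightarrow> coords v x = 0"
  by (simp add: coords_def)

lemma coords_eqI:
  assumes "lc B f = v" "\<And>x. x \<notin> B \<Longrightarrow> f x = 0"
  shows "coords v = f"
proof
  fix x
  have "lc B (coords v) = lc B f" using assms(1) by auto
  then show "coords v x = f x" using lc_unique assms(2) by (cases "x \<in> B") auto
qed

lemma coords_add:
  "u \<in> carrier M \<Longrightarrow> v \<in> carrier M \<Longrightarrow> coords (u \<oplus>\<^bsub>M\<^esub> v) = coords u + coords v"
  by (rule coords_eqI) (simp_all add: plus_fun_def lc_add[OF B_carrier])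

lemma coords_scale:
  "v \<in> carrier M \<Longrightarrow> coords (act (scalar c) v) = fscale c (coords v)"
  by (rule coords_eqI) (simp_all add: fscale_def lc_scale[OF finite_B B_carrier])

lemma coords_zero [simp]: "coords \<zero>\<^bsub>M\<^esub> = 0"
  using coords_scale[of "\<zero>\<^bsub>M\<^esub>" 0] by (simp add: scalar_zero fun_eq_iff fscale_apply)

lemma coords_inj: "inj_on coords (carrier M)"
  by (rule inj_on_inverseI) (rule lc_coords)

lemma coords_eq_iff [simp]: "u \<in> carrier M \<Longrightarrow> v \<in> carrier M \<Longrightarrow> coords u = coords v \<longleftrightarrow> u = v"
  using coords_inj by (auto dest: inj_onD)

text \<open>
  Off the basis the generators act through the one-dimensional sign module, so that the
  Hecke relations hold on the whole function space.
\<close>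

definition ext :: "('v \<Rightarrow> 'v) \<Rightarrow> 'f \<Rightarrow> ('v \<Rightarrow> 'f) \<Rightarrow> 'v \<Rightarrow> 'f" where
  "ext A c f = (\<lambda>x. if x \<in> B then coords (A (lc B f)) x else c * f x)"

definition TT :: "nat \<Rightarrow> ('v \<Rightarrow> 'f) \<Rightarrow> 'v \<Rightarrow> 'f" where
  "TT i = (if 1 \<le> i \<and> i < n then ext (act (var (GT i))) (- 1) else (\<lambda>f. f))"

text \<open>Off the basis \<open>T i\<close> is \<open>- 1\<close> and \<open>X 1\<close> is one;
  the relation expressing each \<open>X (Suc i)\<close> by \<open>X i\<close> then forces the powers
  of \<open>inverse q\<close>. For indices out of range the operators are the identity, because the
  locale states its commutation relations for all indices.\<close>

definition XX :: "nat \<Rightarrow> ('v \<Rightarrow> 'f) \<Rightarrow> 'v \<Rightarrow> 'f" where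
  "XX i = (if 1 \<le> i \<and> i \<le> n then ext (act (var (GX i))) (inverse q ^ (i - 1)) else (\<lambda>f. f))"

definition VV :: "('v \<Rightarrow> 'f) set" where
  "VV = coords ` carrier M"

lemma lc_ext: "A (lc B f) \<in> carrier M \<Longrightarrow> lc B (ext A c f) = A (lc B f)"
  using lc_cong[OF _ B_carrier, of "ext A c f" "coords (A (lc B f))"] by (simp add: ext_def)

lemma ext_ext:
  "A' (lc B f) \<in> carrier M \<Longrightarrow> ext A c (ext A' c' f) = ext (\<lambda>v. A (A' v)) (c * c') f"
  unfolding ext_def[of A] lc_ext unfolding ext_def by (auto simp: fun_eq_iff)

lemma ext_cong:
  assumes "\<And>v. v \<in> carrier M \<Longrightarrow> A v = A' v" "c = c'"
  shows "ext A c f = ext A' c' f"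
  by (auto simp: ext_def fun_eq_iff assms)

lemma ext_coords:
  "v \<in> carrier M \<Longrightarrow> ext A c (coords v) = coords (A v)"
  by (auto simp: ext_def fun_eq_iff)

lemma linear_ext:
  assumes g: "(var g :: 'f free_alg) \<in> carrier (free_ring n)"
  shows "Vector_Spaces.linear fscale fscale (ext (act (var g)) c)"
proof -
  have "act (var g) (act (scalar a) v) = act (scalar a) (act (var g) v)" if "v \<in> carrier M" for a v
    using act_mult[OF g scalar_in_carrier that] act_mult[OF scalar_in_carrier g that]
    by (simp add: var_scalar_comm)
  moreover have "lc B (f + h) = lc B f \<oplus>\<^bsub>M\<^esub> lc B h" for f h
    unfolding plus_fun_def by (rule lc_add[OF B_carrier])
  moreover have "lc B (fscale a f) = act (scalar a) (lc B f)" for a f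
    unfolding fscale_def by (rule lc_scale[OF finite_B B_carrier])
  ultimately show ?thesis
    using g unfolding Vector_Spaces.linear_iff
    by (auto simp: fs.vector_space_axioms ext_def fun_eq_iff act_add_right coords_add coords_scale
        fscale_apply algebra_simps)
qed

lemma in_span_delta:
  fixes f :: "'v \<Rightarrow> 'f"
  assumes "finite A"
  shows "(\<And>x. x \<notin> A \<Longrightarrow> f x = 0) \<Longrightarrow>
    f \<in> fs.span ((\<lambda>b x. if x = b then 1 else 0) ` A)"
  using assms
proof (induction A arbitrary: f)
  case empty
  then have "f = 0" by (simp add: fun_eq_iff)
  then show ?case by (metis fs.span_zero)
next
  case (insert b A)
  let ?D = "(\<lambda>b x. if x = b then 1 else 0 :: 'f)"
  have "f(b := 0) \<in> fs.span (?D ` A)"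
    by (rule insert.IH) (use insert.prems in auto)
  then have "f(b := 0) \<in> fs.span (?D ` insert b A)"
    using fs.span_mono[of "?D ` A" "?D ` insert b A"] by blast
  moreover have "fscale (f b) (?D b) \<in> fs.span (?D ` insert b A)"
    by (intro fs.span_scale fs.span_base) auto
  moreover have "f = fscale (f b) (?D b) + f(b := 0)" by (auto simp: fun_eq_iff fscale_apply)
  ultimately show ?case by (metis fs.span_add)
qed

lemma TT_coords:
  "1 \<le> i \<Longrightarrow> i < n \<Longrightarrow> v \<in> carrier M \<Longrightarrow> TT i (coords v) = coords (act (var (GT i)) v)"
  by (simp add: TT_def ext_coords)

lemma XX_coords:
  "1 \<le> i \<Longrightarrow> i \<le> n \<Longrightarrow> v \<in> carrier M \<Longrightarrow> XX i (coords v) = coords (act (var (GX i)) v)"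
  by (simp add: XX_def ext_coords)

lemma subspace_coords:
  assumes "S \<subseteq> carrier M" "\<zero>\<^bsub>M\<^esub> \<in> S" "\<And>u v. u \<in> S \<Longrightarrow> v \<in> S \<Longrightarrow> u \<oplus>\<^bsub>M\<^esub> v \<in> S"
    and "\<And>c v. v \<in> S \<Longrightarrow> act (scalar c) v \<in> S"
  shows "fs.subspace (coords ` S)"
proof (rule fs.subspaceI)
  show "0 \<in> coords ` S" using assms(2) by (metis coords_zero imageI)
next
  fix x y assume "x \<in> coords ` S" "y \<in> coords ` S"
  then obtain u v where uv: "u \<in> S" "v \<in> S" "x = coords u" "y = coords v" by blast
  then have "x + y = coords (u \<oplus>\<^bsub>M\<^esub> v)" by (simp add: coords_add subsetD[OF assms(1)])
  then show "x + y \<in> coords ` S" using assms(3) uv by blast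
next
  fix c x assume "x \<in> coords ` S"
  then obtain v where v: "v \<in> S" "x = coords v" by blast
  then have "fscale c x = coords (act (scalar c) v)" by (simp add: coords_scale subsetD[OF assms(1)])
  then show "fscale c x \<in> coords ` S" using assms(4) v by blast
qed

sublocale rep: affine_hecke_rep fscale n q TT XX
proof (intro affine_hecke_rep.intro affine_hecke_rep_axioms.intro fs.vector_space_axioms)
  have linear_id: "Vector_Spaces.linear fscale fscale (\<lambda>f. f :: 'v \<Rightarrow> 'f)"
    unfolding Vector_Spaces.linear_iff by (simp add: fs.vector_space_axioms)
  fix i k :: nat and v :: "'v \<Rightarrow> 'f"
  show "Vector_Spaces.linear fscale fscale (TT i)"
    unfolding TT_def using linear_ext var_carriers(1)[of i n] linear_id by auto
  show "Vector_Spaces.linear fscale fscale (XX i)"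
    unfolding XX_def using linear_ext var_carriers(2)[of i n] linear_id by auto
  show "q \<noteq> 0" by (rule q_nz)
  note act_carriers = var_carriers act_closed lc_B_closed
  show "TT i (TT i v) = fscale (q - 1) (TT i v) + fscale q v" if "1 \<le> i" "i < n"
  proof -
    have "TT i (TT i v) = ext (\<lambda>v. act (var (GT i)) (act (var (GT i)) v)) 1 v"
      using that by (simp add: TT_def ext_ext act_carriers)
    also have "\<dots> = fscale (q - 1) (TT i v) + fscale q v"
      using that lc_unique[of "coords (lc B v)" v]
      by (auto simp: ext_def TT_def fun_eq_iff act_T_quad coords_add coords_scale act_carriers
          scalar_in_carrier fscale_apply algebra_simps)
    finally show ?thesis .
  qed
  show "TT i (TT (Suc i) (TT i v)) = TT (Suc i) (TT i (TT (Suc i) v))" if "1 \<le> i" "Suc i < n"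
    using that by (simp add: TT_def ext_ext act_carriers) (rule ext_cong; simp add: act_T_braid)
  show "TT i (TT k v) = TT k (TT i v)" if "Suc i < k"
  proof (cases "1 \<le> i \<and> k < n")
    case True
    then show ?thesis
      using that by (simp add: TT_def ext_ext act_carriers) (auto intro!: ext_cong act_TT)
  qed (auto simp: TT_def)
  show "XX i (XX k v) = XX k (XX i v)"
  proof (cases "1 \<le> i \<and> i \<le> n \<and> 1 \<le> k \<and> k \<le> n")
    case True
    then show ?thesis
      by (simp add: XX_def ext_ext act_carriers) (rule ext_cong; simp add: act_XX mult.commute)
  qed (auto simp: XX_def)
  show "TT i (XX k v) = XX k (TT i v)" if "k \<noteq> i" "k \<noteq> Suc i"
  proof (cases "1 \<le> i \<and> i < n \<and> 1 \<le> k \<and> k \<le> n")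
    case True
    then show ?thesis using that
      by (simp add: XX_def TT_def ext_ext act_carriers) (rule ext_cong; simp add: act_TX)
  qed (auto simp: XX_def TT_def)
  show "TT i (XX i (TT i v)) = fscale q (XX (Suc i) v)" if "1 \<le> i" "i < n"
  proof -
    define j where "j = i - 1"
    then have j: "i = Suc j" using that(1) by simp
    have "TT i (XX i (TT i v))
        = ext (\<lambda>v. act (var (GT i)) (act (var (GX i)) (act (var (GT i)) v))) (inverse q ^ (i - 1)) v"
      using that by (simp add: XX_def TT_def ext_ext act_carriers)
    also have "\<dots> = fscale q (XX (Suc i) v)"
      using that q_nz j
      by (auto simp: ext_def XX_def fun_eq_iff act_TXT coords_scale act_carriers fscale_apply field_simps)
    finally show ?thesis .
  qed
qed

sublocale flat: affine_hecke_module fscale n q TT XX VV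
proof
  have sub: "fs.subspace VV"
    unfolding VV_def by (rule subspace_coords) (auto simp: scalar_in_carrier)
  show "rep.stable 0 n n VV"
    unfolding rep.stable_def using sub
    by (auto simp: VV_def TT_coords XX_coords var_carriers)
  have "VV \<subseteq> fs.span ((\<lambda>b x. if x = b then 1 else 0) ` B)"
    unfolding VV_def using in_span_delta[OF finite_B coords_outside] by auto
  then show "\<exists>B. finite B \<and> VV \<subseteq> fs.span B" using finite_B by blast
  show "q \<noteq> 1" by (rule q_ne_1)
qed

section \<open>Translation between subsets of the module and of the coordinate space\<close>

lemma gen_carrier:
  "1 \<le> i \<Longrightarrow> i < k \<Longrightarrow> (var (GT i) :: 'f free_alg) \<in> carrier (free_ring k)"
  "1 \<le> i \<Longrightarrow> i \<le> k \<Longrightarrow> (var (GX i) :: 'f free_alg) \<in> carrier (free_ring k)"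
  "1 \<le> i \<Longrightarrow> i \<le> k \<Longrightarrow> (var (GXinv i) :: 'f free_alg) \<in> carrier (free_ring k)"
  by (rule var_carriers; assumption)+

text \<open>Closure is stated for representatives in the free algebra of rank \<open>k\<close>,
  acting through rank \<open>n\<close>, so that submodules of all ranks are subsets of the same
  carrier.\<close>

definition subm :: "nat \<Rightarrow> 'v set \<Rightarrow> bool" where
  "subm k S \<longleftrightarrow> S \<subseteq> carrier M \<and> \<zero>\<^bsub>M\<^esub> \<in> S \<and> (\<forall>u\<in>S. \<forall>v\<in>S. u \<oplus>\<^bsub>M\<^esub> v \<in> S) \<and>
     (\<forall>p\<in>carrier (free_ring k). \<forall>v\<in>S. act p v \<in> S)"

lemma coords_mem_iff: "S \<subseteq> carrier M \<Longrightarrow> v \<in> carrier M \<Longrightarrow> coords v \<in> coords ` S \<longleftrightarrow> v \<in> S"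
  using inj_on_image_mem_iff[OF coords_inj] by blast

lemma coords_image_eq_iff:
  "S \<subseteq> carrier M \<Longrightarrow> S' \<subseteq> carrier M \<Longrightarrow> coords ` S = coords ` S' \<longleftrightarrow> S = S'"
  by (rule inj_on_image_eq_iff[OF coords_inj])

lemma coords_image_zero: "S \<subseteq> carrier M \<Longrightarrow> coords ` S = {0} \<longleftrightarrow> S = {\<zero>\<^bsub>M\<^esub>}"
  using coords_image_eq_iff[of S "{\<zero>\<^bsub>M\<^esub>}"] by simp

lemma subm_imp_sub:
  assumes k: "k \<le> n" and S: "subm k S"
  shows "flat.sub k (coords ` S)"
proof -
  have C: "v \<in> carrier M" if "v \<in> S" for v using that S by (auto simp: subm_def)
  have act: "act p v \<in> S" if "p \<in> carrier (free_ring k)" "v \<in> S" for p v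
    using that S by (auto simp: subm_def)
  have "fs.subspace (coords ` S)"
    using S act scalar_in_carrier by (intro subspace_coords) (auto simp: subm_def)
  moreover have "TT i f \<in> coords ` S" if "0 < i" "i < k" "f \<in> coords ` S" for i f
  proof -
    obtain v where "v \<in> S" "f = coords v" using \<open>f \<in> coords ` S\<close> by blast
    then show ?thesis using that(1,2) k C act[OF gen_carrier(1)[of i k]] by (simp add: TT_coords)
  qed
  moreover have "XX i f \<in> coords ` S" if "0 < i" "i \<le> k" "f \<in> coords ` S" for i f
  proof -
    obtain v where "v \<in> S" "f = coords v" using \<open>f \<in> coords ` S\<close> by blast
    then show ?thesis using that(1,2) k C act[OF gen_carrier(2)[of i k]] by (simp add: XX_coords)
  qed
  moreover have "coords ` S \<subseteq> VV" using C by (auto simp: VV_def)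
  ultimately show ?thesis by (simp add: flat.sub_def rep.stable_def)
qed

lemma sub_imp_subm:
  assumes k: "k \<le> n" and SC: "S \<subseteq> carrier M" and S: "flat.sub k (coords ` S)"
  shows "subm k S"
proof -
  let ?W = "coords ` S"
  note W = flat.sub_subspace[OF S]
  note st = flat.sub_stable[OF S]
  have C: "v \<in> carrier M" if "v \<in> S" for v using that SC by auto
  have mem: "v \<in> S" if "coords v \<in> ?W" "v \<in> carrier M" for v
    using that coords_mem_iff[OF SC] by blast
  have zero_S: "\<zero>\<^bsub>M\<^esub> \<in> S" using fs.subspace_0[OF W] by (intro mem) auto
  have add_S: "u \<oplus>\<^bsub>M\<^esub> v \<in> S" if "u \<in> S" "v \<in> S" for u v
    using that fs.subspace_add[OF W, of "coords u" "coords v"] C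
    by (intro mem) (auto simp: coords_add)
  have scalar_S: "act (scalar c) v \<in> S" if "v \<in> S" for c v
    using that fs.subspace_scale[OF W, of "coords v" c] C
    by (intro mem) (auto simp: coords_scale scalar_in_carrier)
  have X: "act (var (GX i)) v \<in> S" if "1 \<le> i" "i \<le> k" "v \<in> S" for i v
  proof (rule mem)
    have "XX i (coords v) \<in> ?W" using rep.stable_X[OF st] that by auto
    then show "coords (act (var (GX i)) v) \<in> ?W" using that k C by (simp add: XX_coords)
  qed (use that k C gen_carrier(2)[of i n] in auto)
  have var_S: "act (var g) v \<in> S" if g: "g \<in> gens k" and v: "v \<in> S" for g v
  proof -
    consider i where "g = GT i" "1 \<le> i" "i < k" | i where "g = GX i" "1 \<le> i" "i \<le> k"
      | i where "g = GXinv i" "1 \<le> i" "i \<le> k"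
      using g by (auto simp: gens_def)
    then show ?thesis
    proof cases
      case 1
      have "TT i (coords v) \<in> ?W" using rep.stable_T[OF st] 1 v by auto
      then have "coords (act (var g) v) \<in> ?W" using 1 k C v by (simp add: TT_coords)
      then show ?thesis using 1 k C v gen_carrier(1)[of i n] by (intro mem) auto
    next
      case 2
      then show ?thesis using X v by simp
    next
      case 3
      \<comment> \<open>The coordinate side has no inverse generators. \<open>X i\<close> is
        injective because the inverse acts on \<open>M\<close>, hence maps onto \<open>?W\<close>,
        and the preimage of \<open>v\<close> is its image under the inverse generator.\<close>
      have "\<exists>u\<in>?W. XX i u = coords v"
      proof (rule flat.X_surj_on[OF _ _ _ W flat.sub_V[OF S]])
        fix u assume u: "u \<in> VV" "XX i u = 0"
        then obtain w where w: "w \<in> carrier M" "u = coords w" by (auto simp: VV_def)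
        then have *: "coords (act (var (GX i)) w) = coords \<zero>\<^bsub>M\<^esub>"
          using u 3 k by (simp add: XX_coords)
        have "act (var (GX i)) w = \<zero>\<^bsub>M\<^esub>"
          by (rule inj_onD[OF coords_inj *]) (use w 3 k gen_carrier(2)[of i n] in auto)
        then have "w = \<zero>\<^bsub>M\<^esub>" using act_Xinv_X[of i w] 3 k w gen_carrier(3)[of i n] by simp
        then show "u = 0" using w by simp
      qed (use 3 k v rep.stable_X[OF st] in auto)
      then obtain u where u: "u \<in> S" "coords (act (var (GX i)) u) = coords v"
        using 3 k C by (auto simp: XX_coords)
      then have "act (var (GX i)) u = v" using C v 3 k gen_carrier(2)[of i n] by simp
      then show ?thesis using act_Xinv_X[of i u] 3 k C u by simp
    qed
  qed
  have "p \<in> carrier (free_ring n) \<and> (\<forall>v\<in>S. act p v \<in> S)" if "p \<in> carrier (free_ring k)" for p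
    using that
  proof (induction p rule: free_ring_induct)
    case zero
    then show ?case using zero_S C by (simp add: free_ring_zero)
  next
    case (add p r)
    then show ?case using add_S C
      by (simp add: act_add free_ring_closed)
  next
    case (scalar c p)
    then show ?case using scalar_S C
      by (simp add: act_mult free_ring_closed scalar_in_carrier)
  next
    case one
    then show ?case using C by (simp add: free_ring_one)
  next
    case (var g p)
    have "(var g :: 'f free_alg) \<in> carrier (free_ring n)"
      using var(1) k by (intro var_in_carrier) (auto simp: gens_def)
    then show ?case using var_S var C
      by (simp add: act_mult free_ring_closed)
  qed
  then show ?thesis using SC zero_S add_S by (simp add: subm_def)
qed

lemma sub_iff_subm: "k \<le> n \<Longrightarrow> S \<subseteq> carrier M \<Longrightarrow> flat.sub k (coords ` S) \<longleftrightarrow> subm k S"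
  using subm_imp_sub sub_imp_subm by blast

text \<open>\<open>M'\<close> is an \<open>H\<^sub>k\<close>-submodule of the restriction of \<open>M\<close>.\<close>

definition restricts :: "nat \<Rightarrow> ('f, 'v) hecke_mod \<Rightarrow> bool" where
  "restricts k M' \<longleftrightarrow> k \<le> n \<and> add M' = add M \<and> zero M' = zero M \<and> subm k (carrier M') \<and>
     (\<forall>p\<in>carrier (free_ring k). \<forall>v\<in>carrier M'. hecke_class k q p \<odot>\<^bsub>M'\<^esub> v = act p v)"

definition flat_carrier :: "('f, 'v) hecke_mod \<Rightarrow> ('v \<Rightarrow> 'f) set" where
  "flat_carrier M' = coords ` carrier M'"

lemma restrictsD:
  assumes "restricts k M'"
  shows "k \<le> n" "add M' = add M" "zero M' = zero M" "subm k (carrier M')" "carrier M' \<subseteq> carrier M"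
    and "\<And>p v. p \<in> carrier (free_ring k) \<Longrightarrow> v \<in> carrier M' \<Longrightarrow> hecke_class k q p \<odot>\<^bsub>M'\<^esub> v = act p v"
    and "\<And>p v. p \<in> carrier (free_ring k) \<Longrightarrow> v \<in> carrier M' \<Longrightarrow> act p v \<in> carrier M'"
  using assms unfolding restricts_def subm_def by blast+

lemma restricts_self: "restricts n M"
  by (auto simp: restricts_def subm_def act_def[symmetric])

lemma restricts_subset:
  assumes "restricts k M'" "subm k N" "N \<subseteq> carrier M'"
  shows "restricts k (M'\<lparr>carrier := N\<rparr>)"
  using assms restrictsD[OF assms(1)] by (auto simp: restricts_def)

lemma restricts_left_module:
  assumes "restricts k M'"
  shows "left_module (hecke k q) M'"
proof -
  note R = restrictsD[OF assms]
  have C: "v \<in> carrier M" if "v \<in> carrier M'" for v using that R(5) by auto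
  have mono: "p \<in> carrier (free_ring n)" if "p \<in> carrier (free_ring k)" for p :: "'f free_alg"
    using that free_ring_mono[OF R(1)] by auto
  have grp: "abelian_group M'"
  proof (rule abelian_groupI; (unfold R(2,3))?)
    fix x assume x: "x \<in> carrier M'"
    have "act (scalar (- 1)) x \<oplus>\<^bsub>M\<^esub> act 1 x = act (scalar (- 1) + 1) x"
      using C[OF x] by (simp add: act_add scalar_in_carrier free_ring_one del: act_one)
    also have "scalar (- 1) + (1 :: 'f free_alg) = 0"
      using scalar_add[of "- 1 :: 'f" 1] by (simp add: scalar_one scalar_zero)
    finally show "\<exists>y\<in>carrier M'. y \<oplus>\<^bsub>M\<^esub> x = \<zero>\<^bsub>M\<^esub>"
      using R(7)[OF scalar_in_carrier x] C[OF x] by auto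
  qed (use R(4) C in \<open>auto simp: subm_def M.a_assoc M.a_comm M.a_lcomm\<close>)
  have smult: "hecke_class k q (p + r) \<odot>\<^bsub>M'\<^esub> v = act p v \<oplus>\<^bsub>M\<^esub> act r v"
    "hecke_class k q (p * r) \<odot>\<^bsub>M'\<^esub> v = act p (act r v)"
    if pr: "p \<in> carrier (free_ring k)" "r \<in> carrier (free_ring k)" and v: "v \<in> carrier M'" for p r v
    using R(6)[OF free_ring_closed(1)[OF pr] v] R(6)[OF free_ring_closed(2)[OF pr] v]
      mono[OF pr(1)] mono[OF pr(2)] C[OF v] by (simp_all add: act_add act_mult)
  have "module_axioms (hecke k q) M'"
    unfolding module_axioms_def hecke_carrier R(2)
    using R(6,7) C mono R(4) smult
    by (auto simp: act_add_right free_ring_one subm_def simp flip: hecke_class_hom hecke_class_one)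
  then show ?thesis using grp ring_hecke by (simp add: left_module_def)
qed

lemma submodule_iff:
  assumes "restricts k M'"
  shows "submodule N (hecke k q) M' \<longleftrightarrow> N \<subseteq> carrier M' \<and> subm k N"
proof
  note R = restrictsD[OF assms]
  assume N: "submodule N (hecke k q) M'"
  interpret N: submodule N "hecke k q" M' by (rule N)
  have sub: "N \<subseteq> carrier M'" using N.subset by simp
  moreover have "\<zero>\<^bsub>M\<^esub> \<in> N" "\<And>u v. u \<in> N \<Longrightarrow> v \<in> N \<Longrightarrow> u \<oplus>\<^bsub>M\<^esub> v \<in> N"
    using N.one_closed N.m_closed R(2,3) by auto
  moreover have "act p v \<in> N" if "p \<in> carrier (free_ring k)" "v \<in> N" for p v
  proof -
    have v: "v \<in> carrier M'" using sub that(2) by (rule subsetD)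
    show ?thesis
      using N.smult_closed[OF hecke_class_carrier[OF that(1)] that(2)] unfolding R(6)[OF that(1) v] .
  qed
  ultimately show "N \<subseteq> carrier M' \<and> subm k N"
    by (simp add: subm_def subset_trans[OF sub R(5)])
next
  note R = restrictsD[OF assms]
  assume N: "N \<subseteq> carrier M' \<and> subm k N"
  interpret M': abelian_group M' using restricts_left_module[OF assms] by (simp add: left_module_def)
  show "submodule N (hecke k q) M'"
  proof (intro submodule.intro subgroup.intro submodule_axioms.intro)
    fix x assume x: "x \<in> N"
    then have xC: "x \<in> carrier M'" "x \<in> carrier M" using N R(5) by auto
    have "act (scalar (- 1)) x \<oplus>\<^bsub>M\<^esub> act 1 x = act (scalar (- 1) + 1) x"
      using xC by (simp add: act_add scalar_in_carrier free_ring_one del: act_one)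
    also have "scalar (- 1) + (1 :: 'f free_alg) = 0"
      using scalar_add[of "- 1 :: 'f" 1] by (simp add: scalar_one scalar_zero)
    finally have "act (scalar (- 1)) x \<oplus>\<^bsub>M'\<^esub> x = \<zero>\<^bsub>M'\<^esub>" using xC R(2,3) by simp
    then have "\<ominus>\<^bsub>M'\<^esub> x = act (scalar (- 1)) x"
      using R(7)[OF scalar_in_carrier xC(1)] xC(1) by (intro M'.minus_equality)
    moreover have "act (scalar (- 1)) x \<in> N"
      using N x scalar_in_carrier[of "- 1 :: 'f" k] by (auto simp: subm_def)
    ultimately show "inv\<^bsub>add_monoid M'\<^esub> x \<in> N" by (simp add: a_inv_def)
  next
    fix a x assume "a \<in> carrier (hecke k q)" "x \<in> N"
    then obtain p where p: "p \<in> carrier (free_ring k)" "a = hecke_class k q p" "x \<in> N"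
      by (auto simp: hecke_carrier)
    have "x \<in> carrier M'" using N p(3) by blast
    moreover have "act p x \<in> N" using N p(1,3) by (simp add: subm_def)
    ultimately show "a \<odot>\<^bsub>M'\<^esub> x \<in> N" using R(6)[OF p(1)] p(2) by simp
  qed (use N R(2,3) in \<open>auto simp: subm_def\<close>)
qed

lemma nonzero_module_iff:
  assumes "restricts k M'"
  shows "nonzero_module M' \<longleftrightarrow> flat_carrier M' \<noteq> {0}"
proof -
  note R = restrictsD[OF assms]
  show ?thesis by (simp add: nonzero_module_def flat_carrier_def R(3) coords_image_zero[OF R(5)])
qed

lemma preimage_coords:
  assumes "W \<subseteq> coords ` S" "S \<subseteq> carrier M"
  obtains N where "N \<subseteq> S" "W = coords ` N"
proof
  show "{v\<in>S. coords v \<in> W} \<subseteq> S" by blast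
  show "W = coords ` {v\<in>S. coords v \<in> W}" using assms(1) by auto
qed

lemma simple_iff:
  assumes "restricts k M'"
  shows "simple_module (hecke k q) M' \<longleftrightarrow> flat.simple k (flat_carrier M')"
proof -
  note R = restrictsD[OF assms]
  have "(\<forall>N. submodule N (hecke k q) M' \<longrightarrow> N = {\<zero>\<^bsub>M'\<^esub>} \<or> N = carrier M') \<longleftrightarrow>
      (\<forall>W. flat.sub k W \<longrightarrow> W \<subseteq> flat_carrier M' \<longrightarrow> W = {0} \<or> W = flat_carrier M')"
    (is "?l \<longleftrightarrow> ?r")
  proof
    assume l: ?l
    show ?r
    proof (intro allI impI)
      fix W assume W: "flat.sub k W" "W \<subseteq> flat_carrier M'"
      then obtain N where N: "N \<subseteq> carrier M'" "W = coords ` N"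
        using preimage_coords R(5) unfolding flat_carrier_def by metis
      then have "subm k N" using W(1) sub_iff_subm[OF R(1), of N] R(5) by auto
      then have "N = {\<zero>\<^bsub>M\<^esub>} \<or> N = carrier M'" using l N(1) submodule_iff[OF assms] R(3) by auto
      then show "W = {0} \<or> W = flat_carrier M'" using N(2) by (auto simp: flat_carrier_def)
    qed
  next
    assume r: ?r
    show ?l
    proof (intro allI impI)
      fix N assume "submodule N (hecke k q) M'"
      then have N: "N \<subseteq> carrier M'" "subm k N" using submodule_iff[OF assms] by auto
      then have "coords ` N = {0} \<or> coords ` N = flat_carrier M'"
        using r[rule_format, OF subm_imp_sub[OF R(1) N(2)]] image_mono[OF N(1), of coords]
        by (simp add: flat_carrier_def)
      moreover have "N \<subseteq> carrier M" using N(1) R(5) by (rule subset_trans)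
      ultimately show "N = {\<zero>\<^bsub>M'\<^esub>} \<or> N = carrier M'"
        unfolding flat_carrier_def R(3) by (simp add: coords_image_zero coords_image_eq_iff R(5))
    qed
  qed
  then show ?thesis
    unfolding simple_module_def flat.simple_def
    using restricts_left_module[OF assms] nonzero_module_iff[OF assms] subm_imp_sub[OF R(1,4)]
    by (simp add: flat_carrier_def)
qed

text \<open>With a unique simple submodule, the intersection defining the socle ranges over the
  submodules containing it and is attained by it.\<close>

lemma socle_eq:
  assumes M': "restricts k M'" and N: "N \<subseteq> carrier M'" "flat.simple k (coords ` N)"
    and unique: "\<And>W. flat.simple k W \<Longrightarrow> W \<subseteq> flat_carrier M' \<Longrightarrow> W = coords ` N"
  shows "socle (hecke k q) M' = M'\<lparr>carrier := N\<rparr>"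
proof -
  note R = restrictsD[OF M']
  have simple: "submodule S (hecke k q) M' \<and> simple_module (hecke k q) (M'\<lparr>carrier := S\<rparr>)
      \<longleftrightarrow> S = N" for S
  proof -
    have *: "simple_module (hecke k q) (M'\<lparr>carrier := S\<rparr>) \<longleftrightarrow> flat.simple k (coords ` S)"
      if "S \<subseteq> carrier M'" "subm k S" for S
      using simple_iff[OF restricts_subset[OF M' that(2,1)]] by (simp add: flat_carrier_def)
    have subN: "subm k N"
      using flat.simple_sub[OF N(2)] sub_iff_subm[OF R(1), of N] N(1) R(5) by auto
    show ?thesis
    proof
      assume "submodule S (hecke k q) M' \<and> simple_module (hecke k q) (M'\<lparr>carrier := S\<rparr>)"
      then have S: "S \<subseteq> carrier M'" "flat.simple k (coords ` S)"
        using submodule_iff[OF M'] * by auto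
      then have "coords ` S = coords ` N"
        using unique[of "coords ` S"] by (auto simp: flat_carrier_def)
      then show "S = N" using coords_image_eq_iff[of S N] S(1) N(1) R(5) by auto
    qed (use submodule_iff[OF M'] * N subN in auto)
  qed
  have "\<Inter>{L. submodule L (hecke k q) M' \<and> (\<forall>S. submodule S (hecke k q) M' \<and>
      simple_module (hecke k q) (M'\<lparr>carrier := S\<rparr>) \<longrightarrow> S \<subseteq> L)} = N"
    unfolding simple using simple[of N] by auto
  then show ?thesis by (simp add: socle_def)
qed

lemma Xm_coords:
  assumes "1 \<le> k" "k \<le> n" "v \<in> carrier M"
  shows "rep.Xm k c (coords v) = coords (act (var (GX k) - scalar c) v)"
proof -
  have p: "(var (GX k) :: 'f free_alg) \<in> carrier (free_ring n)" "(scalar c :: 'f free_alg) \<in> carrier (free_ring n)"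
    using assms by (auto intro: var_carriers scalar_in_carrier)
  have "act (var (GX k)) v = act (var (GX k) - scalar c) v \<oplus>\<^bsub>M\<^esub> act (scalar c) v"
    using act_add[OF free_ring_closed(3)[OF p] p(2) assms(3)] by simp
  then have "coords (act (var (GX k)) v) = coords (act (var (GX k) - scalar c) v) + fscale c (coords v)"
    using assms p by (simp add: coords_add coords_scale free_ring_closed)
  then show ?thesis using assms by (simp add: rep.Xm_def XX_coords)
qed

text \<open>The action of rank \<open>k - 1\<close> on the eigenspace is defined through rank
  \<open>k\<close>; \<open>hecke_incl_class\<close> identifies it with the action of the same
  representative on \<open>M\<close>, so a restriction is determined by its carrier.\<close>

lemma e_res_restricts:
  assumes M': "restricts k M'"
  shows "restricts (k - 1) (e_res k q i M')"
    and "flat_carrier (e_res k q i M') = flat.ef k (q powi i) (flat_carrier M')"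
proof -
  note R = restrictsD[OF M']
  let ?c = "q powi i"
  show eq: "flat_carrier (e_res k q i M') = flat.ef k ?c (flat_carrier M')"
  proof (cases "k = 0")
    case True
    then show ?thesis by (simp add: e_res_def flat.ef_def flat_carrier_def R(3))
  next
    case False
    let ?p = "var (GX k) - scalar ?c :: 'f free_alg"
    let ?f = "\<lambda>w. hecke_class k q ?p \<odot>\<^bsub>M'\<^esub> w"
    have p: "?p \<in> carrier (free_ring k)"
      using False by (intro free_ring_closed var_carriers scalar_in_carrier) auto
    have iter: "(?f ^^ m) v \<in> carrier M' \<and> coords ((?f ^^ m) v) = (rep.Xm k ?c ^^ m) (coords v)"
      if "v \<in> carrier M'" for v m
    proof (induction m)
      case (Suc m)
      then have w: "(?f ^^ m) v \<in> carrier M'" "(?f ^^ m) v \<in> carrier M" using R(5) by auto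
      have "(?f ^^ Suc m) v = act ?p ((?f ^^ m) v)" using R(6)[OF p w(1)] by simp
      then show ?case
        using R(7)[OF p w(1)] Xm_coords[of k "(?f ^^ m) v" ?c] False R(1) w(2) Suc by simp
    qed (use that in simp)
    have "(?f ^^ m) v = \<zero>\<^bsub>M'\<^esub> \<longleftrightarrow> (rep.Xm k ?c ^^ m) (coords v) = 0" if "v \<in> carrier M'" for v m
    proof -
      have "(?f ^^ m) v = \<zero>\<^bsub>M'\<^esub> \<longleftrightarrow> coords ((?f ^^ m) v) = coords \<zero>\<^bsub>M\<^esub>"
        using iter[OF that, of m] R(3,5) coords_eq_iff[of "(?f ^^ m) v" "\<zero>\<^bsub>M\<^esub>"] by auto
      then show ?thesis using iter[OF that, of m] by simp
    qed
    then show ?thesis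
      using False by (auto simp: e_res_def flat.ef_def flat_carrier_def rep.nil_def)
  qed
  have sub: "flat.sub (k - 1) (flat_carrier (e_res k q i M'))"
    using flat.sub_ef[OF subm_imp_sub[OF R(1,4)]] unfolding eq by (simp add: flat_carrier_def)
  have CC: "carrier (e_res k q i M') \<subseteq> carrier M'"
    using R(3,4) by (auto simp: e_res_def subm_def)
  have "subm (k - 1) (carrier (e_res k q i M'))"
    using sub_imp_subm[of "k - 1" "carrier (e_res k q i M')"] sub CC R(1,5) by (simp add: flat_carrier_def)
  moreover have "hecke_class (k - 1) q p \<odot>\<^bsub>e_res k q i M'\<^esub> v = act p v"
    if p: "p \<in> carrier (free_ring (k - 1))" and v: "v \<in> carrier (e_res k q i M')" for p v
  proof -
    have pk: "p \<in> carrier (free_ring k)" using p free_ring_mono[of "k - 1" k] by auto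
    have vM: "v \<in> carrier M'" using v CC by auto
    show ?thesis
    proof (cases "k = 0")
      case True
      then show ?thesis using R(6)[OF pk vM] by (simp add: e_res_def)
    next
      case False
      then show ?thesis using R(6)[OF pk vM] p by (simp add: e_res_def hecke_incl_class)
    qed
  qed
  moreover have "add (e_res k q i M') = add M" "zero (e_res k q i M') = zero M"
    using R(2,3) by (auto simp: e_res_def)
  ultimately show "restricts (k - 1) (e_res k q i M')"
    using R(1) by (simp add: restricts_def)
qed

lemma e_hat_restricts:
  assumes M': "restricts k M'"
  shows "restricts (k - 2) (e_hat l k q i M')"
    and "flat_carrier (e_hat l k q i M')
      = flat.ef (k - 1) (q powi i) (flat.ef k (q powi (i + int l)) (flat_carrier M'))"
proof -
  note E = e_res_restricts[OF M', of "i + int l"]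
  show "restricts (k - 2) (e_hat l k q i M')"
    using e_res_restricts(1)[OF E(1), of i] by (simp add: e_hat_def numeral_2_eq_2)
  show "flat_carrier (e_hat l k q i M')
      = flat.ef (k - 1) (q powi i) (flat.ef k (q powi (i + int l)) (flat_carrier M'))"
    using e_res_restricts(2)[OF E(1), of i] E(2) by (simp add: e_hat_def)
qed

lemma nonzero_e_hat_pow:
  "restricts k M' \<Longrightarrow> nonzero_module (e_hat_pow m l k q i M') \<longleftrightarrow>
    flat.ef_pow m k (q powi i) (q powi (i + int l)) (flat_carrier M') \<noteq> {0}"
proof (induction m arbitrary: k M')
  case 0
  show ?case
    using nonzero_module_iff[OF 0] unfolding flat.ef_pow.simps e_hat_pow.simps .
next
  case (Suc m)
  show ?case using Suc.IH[OF e_hat_restricts(1)[OF Suc.prems]] e_hat_restricts(2)[OF Suc.prems] by simp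
qed

lemma finite_ef_pow:
  assumes "flat.sub k W"
  shows "finite {m. flat.ef_pow m k a b W \<noteq> {0}}"
proof (rule finite_subset)
  show "{m. flat.ef_pow m k a b W \<noteq> {0}} \<subseteq> {..k}"
  proof
    fix m assume "m \<in> {m. flat.ef_pow m k a b W \<noteq> {0}}"
    then obtain v where "v \<in> flat.ef_pow m k a b W" "v \<noteq> 0"
      using flat.sub_zero_mem[OF flat.sub_ef_pow[OF assms]] by blast
    then show "m \<in> {..k}" using flat.ef_pow_weights by fastforce
  qed
qed simp

lemma module_iso_restricts:
  assumes "restricts k M1" "restricts k M2" "carrier M1 = carrier M2"
  shows "module_iso (hecke k q) M1 M2"
  unfolding module_iso_def
proof (intro exI[of _ "\<lambda>x. x"] conjI ballI)
  note R1 = restrictsD[OF assms(1)] and R2 = restrictsD[OF assms(2)]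
  show "bij_betw (\<lambda>x. x) (carrier M1) (carrier M2)" by (simp add: assms(3) bij_betw_def)
  show "x \<oplus>\<^bsub>M1\<^esub> y = x \<oplus>\<^bsub>M2\<^esub> y" for x y by (simp add: R1(2) R2(2))
  fix c x assume c: "c \<in> carrier (hecke k q)" and x: "x \<in> carrier M1"
  then obtain p where "p \<in> carrier (free_ring k)" "c = hecke_class k q p"
    by (auto simp: hecke_carrier)
  then show "c \<odot>\<^bsub>M1\<^esub> x = c \<odot>\<^bsub>M2\<^esub> x" using R1(6) R2(6) x assms(3) by simp
qed

end

theorem proposition4p3:
  fixes l n :: nat
    and q :: "'f::alg_closed_field"
    and i :: int
    and M :: "('f, 'v) hecke_mod"
  assumes "l > 1"
    and "primitive_root_of_unity (2 * l) q"
    and "M \<in> Rep_I n q"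
    and "simple_module (hecke n q) M"
    and "nonzero_module (e_hat l n q i M)"
  shows "simple_module (hecke (n - 2) q) (socle (hecke (n - 2) q) (e_hat l n q i M))
    \<and> module_iso (hecke (n - 2) q)
        (socle (hecke (n - 2) q) (e_hat l n q i M))
        (e_tilde (n - 1) q i (e_tilde n q (i + int l) M))
    \<and> int (eps_hat l (n - 2) q i (socle (hecke (n - 2) q) (e_hat l n q i M)))
        = int (eps_hat l n q i M) - 1"
proof -
  define a where "a = q powi i"
  define b where "b = q powi (i + int l)"
  have root: "q ^ (2 * l) = 1" "\<And>m. 0 < m \<Longrightarrow> m < 2 * l \<Longrightarrow> q ^ m \<noteq> 1"
    using assms(2) by (auto simp: primitive_root_of_unity_def)
  have q0: "q \<noteq> 0" using root(1) assms(1) by (cases "q = 0") (auto simp: power_0_left)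
  have q1: "q \<noteq> 1" using root(2)[of 1] assms(1) by auto
  \<comment> \<open>This needs \<open>2 < 2 * l\<close>. For \<open>l = 1\<close> one would have
    \<open>q = - 1\<close>, and \<open>b = - a\<close> would be linked to \<open>a\<close>.\<close>
  have qm1: "q \<noteq> - 1" using root(2)[of 2] assms(1) by auto
  have "q ^ l \<noteq> 1" using root(2)[of l] assms(1) by simp
  moreover have "(q ^ l - 1) * (q ^ l + 1) = 0"
    using root(1) by (simp add: algebra_simps flip: power_add mult_2)
  ultimately have ql: "q ^ l = - 1" by (simp add: add_eq_0_iff2)
  have m1: "(- 1 :: 'f) \<noteq> 1" using \<open>q ^ l \<noteq> 1\<close> ql by simp
  have a0: "a \<noteq> 0" using q0 by (simp add: a_def)
  have ba: "b = - a" using q0 ql by (simp add: a_def b_def power_int_add)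
  then have b0: "b \<noteq> 0" using a0 by simp

  have fd: "finite_dim n q M" and left: "left_module (hecke n q) M"
    using assms(3) by (auto simp: Rep_I_def)
  interpret hecke_left_module n q M by unfold_locales (rule left)
  obtain B where B: "finite B" "B \<subseteq> carrier M" "\<And>v. v \<in> carrier M \<Longrightarrow> \<exists>f. lc B f = v"
    "\<And>f b. lc B f = \<zero>\<^bsub>M\<^esub> \<Longrightarrow> b \<in> B \<Longrightarrow> f b = 0"
    using basis_exists[OF fd] by metis
  interpret hecke_basis_module n q M B
    by unfold_locales (use B q0 q1 in auto)

  have linked: "\<not> flat.linked a b"
  proof -
    have "c \<noteq> 1 \<Longrightarrow> a \<noteq> c * a" for c using a0 by simp
    then show ?thesis
      using m1 qm1 a0 unfolding flat.linked_def ba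
      by (metis equation_minus_iff minus_mult_left mult_minus1 mult_minus_right mult_cancel_right)
  qed
  note RM = restricts_self
  note EH = e_hat_restricts[OF RM, of l i, folded a_def b_def]
  note E = e_res_restricts[OF RM, of "i + int l", folded b_def]
  have sM: "flat.simple n (flat_carrier M)" using assms(4) simple_iff[OF RM] by simp
  have ne: "flat.ef (n - 1) a (flat.ef n b (flat_carrier M)) \<noteq> {0}"
    using assms(5) nonzero_module_iff[OF EH(1)] EH(2) by simp
  obtain W U where U: "flat.simple (n - 1) U" "U \<subseteq> flat.ef n b (flat_carrier M)"
    and uU: "\<And>U'. flat.simple (n - 1) U' \<Longrightarrow> U' \<subseteq> flat.ef n b (flat_carrier M) \<Longrightarrow> U' = U"
    and W: "flat.simple (n - 2) W" "W \<subseteq> flat.ef (n - 1) a U"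
    and uW: "\<And>W'. flat.simple (n - 2) W' \<Longrightarrow>
      W' \<subseteq> flat.ef (n - 1) a (flat.ef n b (flat_carrier M)) \<Longrightarrow> W' = W"
    and pow: "\<And>m. flat.ef_pow m (n - 2) a b W \<noteq> {0} \<longleftrightarrow> flat.ef_pow (Suc m) n a b (flat_carrier M) \<noteq> {0}"
  proof (rule flat.socle_structure[OF sM order_refl linked a0 b0 ne], goal_cases)
    case (1 N R)
    show ?case by (rule 1(1)[OF 1(2-)])
  qed
  have WW: "W \<subseteq> flat.ef (n - 1) a (flat.ef n b (flat_carrier M))"
    using W(2) flat.ef_mono[OF U(2)] by blast

  let ?E = "e_res n q (i + int l) M" and ?H = "e_hat l n q i M"
  obtain R where R: "R \<subseteq> carrier ?E" "U = coords ` R"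
    using preimage_coords[of U "carrier ?E"] U(2) E(2) restrictsD(5)[OF E(1)]
    unfolding flat_carrier_def by metis
  have soc1: "e_tilde n q (i + int l) M = ?E\<lparr>carrier := R\<rparr>"
    unfolding e_tilde_def
    using socle_eq[OF E(1) R(1)] U(1) uU E(2) R(2) by simp
  have "subm (n - 1) R"
    using flat.simple_sub[OF U(1)] R sub_iff_subm[of "n - 1" R] restrictsD(1,5)[OF E(1)] by auto
  then have RE: "restricts (n - 1) (?E\<lparr>carrier := R\<rparr>)"
    using restricts_subset[OF E(1)] R(1) by blast
  let ?G = "e_res (n - 1) q i (?E\<lparr>carrier := R\<rparr>)"
  have G: "restricts (n - 2) ?G" "flat_carrier ?G = flat.ef (n - 1) a U"
    using e_res_restricts[OF RE, of i, folded a_def] R(2)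
    by (simp_all add: numeral_2_eq_2 flat_carrier_def)
  obtain N where N: "N \<subseteq> carrier ?G" "W = coords ` N"
    using preimage_coords[of W "carrier ?G"] W(2) G(2) restrictsD(5)[OF G(1)]
    unfolding flat_carrier_def by metis
  have NC: "N \<subseteq> carrier M" using N(1) restrictsD(5)[OF G(1)] by blast
  have NH: "N \<subseteq> carrier ?H"
  proof
    fix v assume v: "v \<in> N"
    then have "coords v \<in> coords ` carrier ?H" using WW EH(2) N(2) by (auto simp: flat_carrier_def)
    then show "v \<in> carrier ?H"
      using coords_mem_iff[OF restrictsD(5)[OF EH(1)]] v NC by blast
  qed
  have socH: "socle (hecke (n - 2) q) ?H = ?H\<lparr>carrier := N\<rparr>"
    using socle_eq[OF EH(1) NH] W(1) uW EH(2) N(2) by simp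
  have socG: "e_tilde (n - 1) q i (e_tilde n q (i + int l) M) = ?G\<lparr>carrier := N\<rparr>"
  proof -
    have "socle (hecke (n - 2) q) ?G = ?G\<lparr>carrier := N\<rparr>"
    proof (rule socle_eq[OF G(1) N(1)])
      show "flat.simple (n - 2) (coords ` N)" using W(1) N(2) by simp
      fix W' assume "flat.simple (n - 2) W'" "W' \<subseteq> flat_carrier ?G"
      then show "W' = coords ` N"
        using uW flat.ef_mono[OF U(2), of "n - 1" a] G(2) N(2) by auto
    qed
    then show ?thesis unfolding soc1 by (simp add: e_tilde_def numeral_2_eq_2)
  qed
  have subN: "subm (n - 2) N"
    using flat.simple_sub[OF W(1)] N(2) sub_iff_subm[of "n - 2" N] NC by simp
  have RH: "restricts (n - 2) (?H\<lparr>carrier := N\<rparr>)" using restricts_subset[OF EH(1) subN NH] .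
  have RG: "restricts (n - 2) (?G\<lparr>carrier := N\<rparr>)" using restricts_subset[OF G(1) subN N(1)] .
  have "simple_module (hecke (n - 2) q) (?H\<lparr>carrier := N\<rparr>)"
    using simple_iff[OF RH] W(1) N(2) by (simp add: flat_carrier_def)
  \<comment> \<open>The two socles are different records, coming from different restrictions, but
    they share the carrier \<open>N\<close> and the action of rank \<open>n - 2\<close>, so the
    identity is an isomorphism.\<close>
  moreover have "module_iso (hecke (n - 2) q) (?H\<lparr>carrier := N\<rparr>) (?G\<lparr>carrier := N\<rparr>)"
    by (rule module_iso_restricts[OF RH RG]) simp
  moreover have "int (eps_hat l (n - 2) q i (?H\<lparr>carrier := N\<rparr>)) = int (eps_hat l n q i M) - 1"
  proof -
    let ?A = "{m. flat.ef_pow m (n - 2) a b W \<noteq> {0}}"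
    let ?A' = "{m. flat.ef_pow m n a b (flat_carrier M) \<noteq> {0}}"
    have "0 \<in> ?A" using flat.simple_nonzero[OF W(1)] by simp
    then have nonempty: "?A \<noteq> {}" by blast
    have fin: "finite ?A" by (rule finite_ef_pow[OF flat.simple_sub[OF W(1)]])
    \<comment> \<open>\<open>pow\<close> shifts the nonvanishing exponents by one; the exponent
      \<open>0\<close> of \<open>M\<close> is below the bound anyway.\<close>
    have "Max ?A' = Suc (Max ?A)"
    proof (rule Max_eqI)
      show "finite ?A'" by (rule finite_ef_pow[OF flat.simple_sub[OF sM]])
      show "Suc (Max ?A) \<in> ?A'" using Max_in[OF fin nonempty] pow[of "Max ?A"] by blast
      fix m assume m: "m \<in> ?A'"
      show "m \<le> Suc (Max ?A)"
      proof (cases m)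
        case (Suc m')
        then have "m' \<in> ?A" using m pow[of m'] by blast
        from Max_ge[OF fin this] show ?thesis using Suc by simp
      qed simp
    qed
    moreover have "eps_hat l n q i M = Max ?A'"
      unfolding eps_hat_def nonzero_e_hat_pow[OF RM] a_def b_def ..
    moreover have "eps_hat l (n - 2) q i (?H\<lparr>carrier := N\<rparr>) = Max ?A"
      unfolding eps_hat_def nonzero_e_hat_pow[OF RH] a_def b_def
      by (simp add: flat_carrier_def N(2))
    ultimately show ?thesis by simp
  qed
  ultimately show ?thesis unfolding socH socG by blast
qed

end
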